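(* Let $\rho: W_F\to \mathrm{GL}_2(\overline{\mathbb{Q}}_\ell)$ be a nonexceptional supercuspidal representation such that $\rho(W_F)\subset \mathrm{GL}_2(\mathcal{O}_K)$. Then $\rho\cong \mathrm{Ind}_{W_E}^{W_F}\xi$, where $\xi$ is a $1$-dimensional representation of $W_E$ such that $\xi\neq\xi^\sigma$. Using Iwasawa decomposition, assume without loss of generality that there exists an upper triangular matrix $U=\begin{pmatrix} a& b\\ 0& d\end{pmatrix}\in \mathrm{GL}_2(K)$ such that $\rho(g)=U\,\mathrm{Ind}_{W_E}^{W_F}\xi(g)\,U^{-1}$ for all $g\in W_F$. Let $i$ be the maximal nonnegative integer such that $\xi(h)\equiv \xi^\sigma(h)\pmod{\lambda^i}$ for all $h\in W_E$. Then $\overline{\rho}$ is irreducible if and only if $\overline{\xi}\neq\overline{\xi}^\sigma$. If $\overline{\rho}$ is reducible, then: (i) If $d/a\in\mathcal{O}_K^\times$, then $\overline{\rho}$ is isomorphic to $\mathrm{Ind}_{W_E}^{W_F}\overline{\xi}$ and decomposes as $\overline{\theta}_1\oplus\overline{\theta}_2$, where, for $h\in W_E$, $\theta_1(h)=\theta_2(h)=\xi(h)$, $\theta_1(h\sigma)=\sqrt{\xi(\sigma^2)}\,\xi(h)$ and $\theta_2(h\sigma)=-\sqrt{\xi(\sigma^2)}\,\xi(h)$. (ii) If $d/a\in\lambda$, then $\overline{\rho}$ is decomposable if and only if $v(b/d)\geq 1-i$, or equivalently, if and only if $\overline{\rho}|_{W_E}$ is decomposable. When $\overline{\rho}$ is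 decomposable, it decomposes as $\overline{\theta}_1\oplus\overline{\theta}_2$, where, for $h\in W_E$, $\theta_1(h)=\xi(h)$, $\theta_1(h\sigma)=\frac{b}{a}\xi(\sigma h\sigma)$, $\theta_2(h)=\xi^\sigma(h)$ and $\theta_2(h\sigma)=-\frac{b}{a}\xi(\sigma h\sigma)$.
   Context: $p\neq\ell$ are odd primes. $F/\mathbb{Q}_p$ is a finite extension with Weil group $W_F$; $E/F$ is a quadratic extension with Weil group $W_E\subset W_F$ (index $2$), and $\sigma\in W_F\setminus W_E$ is a fixed representative of the nontrivial coset. $K/\mathbb{Q}_\ell$ is a finite extension with ring of integers $\mathcal{O}_K$, maximal ideal $\lambda$, and normalized valuation $v$ (a uniformizer has valuation $1$). Representations are continuous for the $\ell$-adic topology. A bar denotes reduction modulo $\lambda$: for $\rho$ with image in $\mathrm{GL}_2(\mathcal{O}_K)$, acting on the lattice $\Lambda=\mathcal{O}_K^2$, $\overline{\rho}$ is the induced action of $W_F$ on $\Lambda/\lambda\Lambda$, a $2$-dimensional vector space over the finite field $\mathcal{O}_K/\lambda$. $\sqrt{\xi(\sigma^2)}$ denotes a square root of $\xi(\sigma^2)$. For a character $\xi$ of $W_E$, $\xi^\sigma(h)=\xi(\sigma h\sigma^{-1})$. $\mathrm{Ind}_{W_E}^{W_F}\xi$ denotes the induced representation, in the matrix form given for $h\in W_E$ by $$\mathrm{Ind}_{W_E}^{W_F}\xi(h)=\begin{pmatrix}\xi(h)&0\\0&\xi^\sigma(h)\end{pmatrix},\qquad \mathrm{Ind}_{W_E}^{W_F}\xi(h\sigma)=\begin{pmatrix}0&\xi(h)\\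 \xi(\sigma h\sigma)&0\end{pmatrix}.$$ A continuous representation $\rho$ of $W_F$ is called a nonexceptional supercuspidal representation if its associated Weil--Deligne representation has zero monodromy operator (i.e. $\rho$ is trivial on an open subgroup of the inertia group) and $\rho\cong \mathrm{Ind}_{W_E}^{W_F}\xi$ for some quadratic $E/F$ and some $1$-dimensional representation $\xi$ of $W_E$ with $\xi\ne\xi^\sigma$.
   Formalization: When d/a is a unit, "ρ̄ irreducible only if ξ̄ ≠ ξ̄^σ" is proved assuming √ξ(σ²) lies in K; without this it fails over O_K/λ (U = 1, ξ̄ = ξ̄^σ, ξ(σ²) a non-square mod λ); the converse and (i), (ii) need no such assumption. *)

theory Defs
  imports
    "HOL-Analysis.Analysis"
    "HOL-Algebra.Algebra"
    "HOL-Algebra.Algebraic_Closure_Type"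
begin

unbundle no fps_syntax

section \<open>\<open>p\<close>-adic fields\<close>

abbreviation field_on :: "'a::field set \<Rightarrow> 'a ring" where
  "field_on S \<equiv> ring_of_type_algebra\<lparr>carrier := S\<rparr>"

definition padic_abs :: "nat \<Rightarrow> rat \<Rightarrow> real" where
  "padic_abs p q = (if q = 0 then 0 else
     (case quotient_of q of (n, d) \<Rightarrow>
        real p powi (int (multiplicity (int p) d) - int (multiplicity (int p) n))))"

definition nonarch_abs :: "('a::field \<Rightarrow> real) \<Rightarrow> bool" where
  "nonarch_abs nrm \<longleftrightarrow>
     (\<forall>x. 0 \<le> nrm x) \<and> (\<forall>x. nrm x = 0 \<longleftrightarrow> x = 0) \<and>
     (\<forall>x y. nrm (x * y) = nrm x * nrm y) \<and>
     (\<forall>x y. nrm (x + y) \<le> max (nrm x) (nrm y))"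

abbreviation nrm_dist :: "('a::field \<Rightarrow> real) \<Rightarrow> 'a \<Rightarrow> 'a \<Rightarrow> real" where
  "nrm_dist nrm \<equiv> \<lambda>x y. nrm (x - y)"

abbreviation nrm_topology :: "('a::field \<Rightarrow> real) \<Rightarrow> 'a topology" where
  "nrm_topology nrm \<equiv> Metric_space.mtopology UNIV (nrm_dist nrm)"

text \<open>Inside a valued field whose absolute value extends the \<open>p\<close>-adic one on \<open>\<rat>\<close>, the completion
  of \<open>\<rat>\<close> is realised as the closure of \<open>\<rat>\<close>, provided that this closure is complete.\<close>

definition rat_closure :: "('a::field_char_0 \<Rightarrow> real) \<Rightarrow> 'a set" where
  "rat_closure nrm = nrm_topology nrm closure_of \<rat>"

text \<open>The type \<^typ>\<open>'a\<close>, with the absolute value \<open>nrm\<close>, is an algebraic closure of \<open>\<rat>\<^sub>p\<close>; the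
  copy of \<open>\<rat>\<^sub>p\<close> is \<^term>\<open>rat_closure nrm\<close>.\<close>

definition padic_alg_closure :: "nat \<Rightarrow> ('a::{field_char_0, alg_closed_field} \<Rightarrow> real) \<Rightarrow> bool" where
  "padic_alg_closure p nrm \<longleftrightarrow>
     nonarch_abs nrm \<and> (\<forall>q. nrm (of_rat q) = padic_abs p q) \<and>
     Metric_space.mcomplete (rat_closure nrm) (nrm_dist nrm) \<and>
     (\<forall>x. (ring.algebraic (field_on (UNIV :: 'a set)) over rat_closure nrm) x)"

definition finite_ext :: "'a::field set \<Rightarrow> 'a set \<Rightarrow> bool" where
  "finite_ext F M \<longleftrightarrow>
     subfield M (field_on UNIV) \<and> F \<subseteq> M \<and> ring.finite_dimension (field_on UNIV) F M"

definition quadratic_ext :: "'a::field set \<Rightarrow> 'a set \<Rightarrow> bool" where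
  "quadratic_ext F E \<longleftrightarrow>
     subfield E (field_on UNIV) \<and> F \<subseteq> E \<and> ring.dimension (field_on UNIV) 2 F E"

definition integers :: "('a::field \<Rightarrow> real) \<Rightarrow> 'a set \<Rightarrow> 'a ring" where
  "integers nrm K = field_on {x \<in> K. nrm x \<le> 1}"

definition max_ideal :: "('a::field \<Rightarrow> real) \<Rightarrow> 'a set \<Rightarrow> 'a set" where
  "max_ideal nrm K = {x \<in> K. nrm x < 1}"

definition residue_field :: "('a::field \<Rightarrow> real) \<Rightarrow> 'a set \<Rightarrow> 'a set ring" where
  "residue_field nrm K = integers nrm K Quot max_ideal nrm K"

definition residue :: "('a::field \<Rightarrow> real) \<Rightarrow> 'a set \<Rightarrow> 'a \<Rightarrow> 'a set" where
  "residue nrm K x = max_ideal nrm K +>\<^bsub>integers nrm K\<^esub> x"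

definition cong_max_ideal_power :: "('a::field \<Rightarrow> real) \<Rightarrow> 'a set \<Rightarrow> nat \<Rightarrow> 'a \<Rightarrow> 'a \<Rightarrow> bool" where
  "cong_max_ideal_power nrm K n x y \<longleftrightarrow>
     x - y \<in> max_ideal nrm K [^]\<^bsub>ideals_set (integers nrm K)\<^esub> n"

text \<open>The normalized valuation of \<open>K\<close>, as an extended real so that \<open>v(0) = \<infinity>\<close>: for \<open>x \<noteq> 0\<close> it
  is the integer \<open>n\<close> such that \<open>x = u \<pi>\<^sup>n\<close> for a uniformizer \<open>\<pi>\<close> and a unit \<open>u\<close> of the
  ring of integers.\<close>

definition norm_val :: "('a::field \<Rightarrow> real) \<Rightarrow> 'a set \<Rightarrow> 'a \<Rightarrow> ereal" where
  "norm_val nrm K x = (if x = 0 then \<infinity> else ereal (of_int (THE n.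
     \<exists>\<pi> \<in> max_ideal nrm K. \<exists>u \<in> Units (integers nrm K).
       max_ideal nrm K = PIdl\<^bsub>integers nrm K\<^esub> \<pi> \<and> x = u * \<pi> powi n)))"

section \<open>Weil groups\<close>

text \<open>All Galois groups are taken inside the automorphism group of the whole type, which plays the
  role of the fixed algebraic closure.\<close>

definition galois_set :: "'a::field set \<Rightarrow> ('a \<Rightarrow> 'a) set" where
  "galois_set F = {g \<in> ring_iso (field_on UNIV) (field_on UNIV). \<forall>x \<in> F. g x = x}"

text \<open>\<open>g\<close> induces on the residue field of the algebraic closure an integral power of
  \<open>x \<mapsto> x\<^sup>q\<close>, where \<open>q\<close> is the cardinality of the residue field of \<open>F\<close>. The two disjuncts
  are the powers with exponent \<open>n\<close> and \<open>-n\<close>.\<close>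

definition weil_set :: "('a::field \<Rightarrow> real) \<Rightarrow> 'a set \<Rightarrow> ('a \<Rightarrow> 'a) set" where
  "weil_set nrm F = (let q = card (carrier (residue_field nrm F)) in
     {g \<in> galois_set F. \<exists>n::nat.
        (\<forall>x. nrm x \<le> 1 \<longrightarrow> nrm (g x - x ^ (q ^ n)) < 1) \<or>
        (\<forall>x. nrm x \<le> 1 \<longrightarrow> nrm ((g x) ^ (q ^ n) - x) < 1)})"

definition weil_group :: "('a::field \<Rightarrow> real) \<Rightarrow> 'a set \<Rightarrow> ('a \<Rightarrow> 'a) monoid" where
  "weil_group nrm F = \<lparr>carrier = weil_set nrm F, monoid.mult = (\<circ>), one = id\<rparr>"

definition inertia_set :: "('a::field \<Rightarrow> real) \<Rightarrow> 'a set \<Rightarrow> ('a \<Rightarrow> 'a) set" where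
  "inertia_set nrm F = {g \<in> galois_set F. \<forall>x. nrm x \<le> 1 \<longrightarrow> nrm (g x - x) < 1}"

text \<open>The topology in which the inertia group, with its Krull topology, is an open subgroup: the
  sets \<open>I\<^sub>F \<inter> Gal(M)\<close>, for \<open>M/F\<close> finite, form a basis of neighbourhoods of the identity.\<close>

definition weil_topology :: "('a::field \<Rightarrow> real) \<Rightarrow> 'a set \<Rightarrow> ('a \<Rightarrow> 'a) topology" where
  "weil_topology nrm F = topology (\<lambda>U. U \<subseteq> weil_set nrm F \<and>
     (\<forall>g \<in> U. \<exists>M. finite_ext F M \<and> (\<forall>t \<in> inertia_set nrm F \<inter> galois_set M. g \<circ> t \<in> U)))"

section \<open>Two-dimensional representations\<close>

type_synonym 'c mat2 = "'c^2^2"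

definition mat2 :: "'c \<Rightarrow> 'c \<Rightarrow> 'c \<Rightarrow> 'c \<Rightarrow> 'c mat2" where
  "mat2 a b c d = (\<chi> i j. if i = 1 then (if j = 1 then a else b) else (if j = 1 then c else d))"

definition map_mat2 :: "('c \<Rightarrow> 'e) \<Rightarrow> 'c mat2 \<Rightarrow> 'e mat2" where
  "map_mat2 f A = (\<chi> i j. f (A $ i $ j))"

definition mat2_monoid :: "('c, 'm) ring_scheme \<Rightarrow> 'c mat2 monoid" where
  "mat2_monoid R = \<lparr>carrier = {A. \<forall>i j. A $ i $ j \<in> carrier R},
     monoid.mult = (\<lambda>A B. \<chi> i j. A $ i $ 1 \<otimes>\<^bsub>R\<^esub> B $ 1 $ j \<oplus>\<^bsub>R\<^esub> A $ i $ 2 \<otimes>\<^bsub>R\<^esub> B $ 2 $ j),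
     one = mat2 \<one>\<^bsub>R\<^esub> \<zero>\<^bsub>R\<^esub> \<zero>\<^bsub>R\<^esub> \<one>\<^bsub>R\<^esub>\<rparr>"

definition GL2 :: "('c, 'm) ring_scheme \<Rightarrow> 'c mat2 monoid" where
  "GL2 R = units_of (mat2_monoid R)"

text \<open>The free module \<open>R\<^sup>2\<close>; the multiplicative part of the record is irrelevant.\<close>

definition vec2_module :: "('c, 'm) ring_scheme \<Rightarrow> ('c, 'c^2) module" where
  "vec2_module R = \<lparr>carrier = {v. \<forall>i. v $ i \<in> carrier R},
     monoid.mult = undefined, one = undefined,
     ring.zero = (\<chi> i. \<zero>\<^bsub>R\<^esub>), ring.add = (\<lambda>v w. \<chi> i. v $ i \<oplus>\<^bsub>R\<^esub> w $ i),
     smult = (\<lambda>c v. \<chi> i. c \<otimes>\<^bsub>R\<^esub> v $ i)\<rparr>"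

definition mat2_act :: "('c, 'm) ring_scheme \<Rightarrow> 'c mat2 \<Rightarrow> 'c^2 \<Rightarrow> 'c^2" where
  "mat2_act R A v = (\<chi> i. A $ i $ 1 \<otimes>\<^bsub>R\<^esub> v $ 1 \<oplus>\<^bsub>R\<^esub> A $ i $ 2 \<otimes>\<^bsub>R\<^esub> v $ 2)"

text \<open>In what follows \<open>r\<close> is a matrix-valued function and \<open>G\<close> the set of group elements acting
  through it, so that restricting to a subgroup amounts to shrinking \<open>G\<close>.\<close>

definition subrep :: "('c, 'm) ring_scheme \<Rightarrow> 'g set \<Rightarrow> ('g \<Rightarrow> 'c mat2) \<Rightarrow> ('c^2) set \<Rightarrow> bool" where
  "subrep R G r S \<longleftrightarrow>
     submodule S R (vec2_module R) \<and> (\<forall>g \<in> G. \<forall>v \<in> S. mat2_act R (r g) v \<in> S)"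

definition irreducible_rep :: "('c, 'm) ring_scheme \<Rightarrow> 'g set \<Rightarrow> ('g \<Rightarrow> 'c mat2) \<Rightarrow> bool" where
  "irreducible_rep R G r \<longleftrightarrow>
     (\<forall>S. subrep R G r S \<longrightarrow> S = {\<zero>\<^bsub>vec2_module R\<^esub>} \<or> S = carrier (vec2_module R))"

definition decomposable_rep :: "('c, 'm) ring_scheme \<Rightarrow> 'g set \<Rightarrow> ('g \<Rightarrow> 'c mat2) \<Rightarrow> bool" where
  "decomposable_rep R G r \<longleftrightarrow>
     (\<exists>S T. subrep R G r S \<and> subrep R G r T \<and>
        S \<noteq> {\<zero>\<^bsub>vec2_module R\<^esub>} \<and> T \<noteq> {\<zero>\<^bsub>vec2_module R\<^esub>} \<and>
        S \<inter> T = {\<zero>\<^bsub>vec2_module R\<^esub>} \<and>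
        S <+>\<^bsub>vec2_module R\<^esub> T = carrier (vec2_module R))"

definition conj_mat2 :: "('c, 'm) ring_scheme \<Rightarrow> 'c mat2 \<Rightarrow> 'c mat2 \<Rightarrow> 'c mat2" where
  "conj_mat2 R U A = U \<otimes>\<^bsub>mat2_monoid R\<^esub> A \<otimes>\<^bsub>mat2_monoid R\<^esub> inv\<^bsub>mat2_monoid R\<^esub> U"

definition isomorphic_reps ::
    "('c, 'm) ring_scheme \<Rightarrow> 'g set \<Rightarrow> ('g \<Rightarrow> 'c mat2) \<Rightarrow> ('g \<Rightarrow> 'c mat2) \<Rightarrow> bool" where
  "isomorphic_reps R G r r' \<longleftrightarrow>
     (\<exists>U \<in> carrier (GL2 R). \<forall>g \<in> G. r g = conj_mat2 R U (r' g))"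

definition direct_sum_chars :: "('c, 'm) ring_scheme \<Rightarrow> ('g \<Rightarrow> 'c) \<Rightarrow> ('g \<Rightarrow> 'c) \<Rightarrow> 'g \<Rightarrow> 'c mat2" where
  "direct_sum_chars R \<theta>\<^sub>1 \<theta>\<^sub>2 = (\<lambda>g. mat2 (\<theta>\<^sub>1 g) \<zero>\<^bsub>R\<^esub> \<zero>\<^bsub>R\<^esub> (\<theta>\<^sub>2 g))"

definition conj_char :: "('a \<Rightarrow> 'a) \<Rightarrow> (('a \<Rightarrow> 'a) \<Rightarrow> 'c) \<Rightarrow> ('a \<Rightarrow> 'a) \<Rightarrow> 'c" where
  "conj_char \<sigma> \<xi> = (\<lambda>h. \<xi> (\<sigma> \<circ> h \<circ> inv_into UNIV \<sigma>))"

text \<open>The function on \<open>W\<^sub>F = W\<^sub>E \<union> W\<^sub>E\<sigma>\<close> given by \<open>h \<mapsto> f h\<close> and \<open>h\<sigma> \<mapsto> f' h\<close> for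
  \<open>h \<in> W\<^sub>E\<close>.\<close>

definition on_cosets ::
    "('a \<Rightarrow> 'a) set \<Rightarrow> ('a \<Rightarrow> 'a) \<Rightarrow> (('a \<Rightarrow> 'a) \<Rightarrow> 'c) \<Rightarrow> (('a \<Rightarrow> 'a) \<Rightarrow> 'c) \<Rightarrow> ('a \<Rightarrow> 'a) \<Rightarrow> 'c" where
  "on_cosets WE \<sigma> f f' = (\<lambda>g. if g \<in> WE then f g else f' (g \<circ> inv_into UNIV \<sigma>))"

definition Ind ::
    "('c, 'm) ring_scheme \<Rightarrow> ('a \<Rightarrow> 'a) set \<Rightarrow> ('a \<Rightarrow> 'a) \<Rightarrow> (('a \<Rightarrow> 'a) \<Rightarrow> 'c) \<Rightarrow> ('a \<Rightarrow> 'a) \<Rightarrow> 'c mat2" where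
  "Ind R WE \<sigma> \<xi> = on_cosets WE \<sigma>
     (\<lambda>h. mat2 (\<xi> h) \<zero>\<^bsub>R\<^esub> \<zero>\<^bsub>R\<^esub> (conj_char \<sigma> \<xi> h))
     (\<lambda>h. mat2 \<zero>\<^bsub>R\<^esub> (\<xi> h) (\<xi> (\<sigma> \<circ> h \<circ> \<sigma>)) \<zero>\<^bsub>R\<^esub>)"

section \<open>\<open>\<ell>\<close>-adic representations of Weil groups\<close>

text \<open>Here \<open>nrm\<close> is the absolute value on the algebraic closure of \<open>\<rat>\<^sub>p\<close> and \<open>nrm'\<close> the one
  on the algebraic closure of \<open>\<rat>\<^sub>\<ell>\<close>.\<close>

definition weil_character ::
    "('a::field \<Rightarrow> real) \<Rightarrow> ('b::field \<Rightarrow> real) \<Rightarrow> 'a set \<Rightarrow> (('a \<Rightarrow> 'a) \<Rightarrow> 'b) \<Rightarrow> bool" where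
  "weil_character nrm nrm' E \<xi> \<longleftrightarrow>
     \<xi> \<in> hom (weil_group nrm E) (units_of (field_on UNIV)) \<and>
     continuous_map (weil_topology nrm E) (nrm_topology nrm') \<xi>"

text \<open>Continuity is entrywise; for homomorphisms into \<open>GL\<^sub>2\<close> this is continuity for the
  \<open>\<ell>\<close>-adic topology of \<open>GL\<^sub>2\<close>, the inverse being \<open>g \<mapsto> \<rho> (g\<inverse>)\<close>.\<close>

definition weil_rep2 ::
    "('a::field \<Rightarrow> real) \<Rightarrow> ('b::field \<Rightarrow> real) \<Rightarrow> 'a set \<Rightarrow> (('a \<Rightarrow> 'a) \<Rightarrow> 'b mat2) \<Rightarrow> bool" where
  "weil_rep2 nrm nrm' F \<rho> \<longleftrightarrow>
     \<rho> \<in> hom (weil_group nrm F) (GL2 (field_on UNIV)) \<and>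
     (\<forall>i j. continuous_map (weil_topology nrm F) (nrm_topology nrm') (\<lambda>g. \<rho> g $ i $ j))"

definition zero_monodromy ::
    "('a::field \<Rightarrow> real) \<Rightarrow> 'a set \<Rightarrow> (('a \<Rightarrow> 'a) \<Rightarrow> 'b::field mat2) \<Rightarrow> bool" where
  "zero_monodromy nrm F \<rho> \<longleftrightarrow>
     (\<exists>N. subgroup N (weil_group nrm F) \<and>
        openin (subtopology (weil_topology nrm F) (inertia_set nrm F)) N \<and>
        (\<forall>t \<in> N. \<rho> t = \<one>\<^bsub>mat2_monoid (field_on UNIV)\<^esub>))"

definition nonexceptional_supercuspidal ::
    "('a::field \<Rightarrow> real) \<Rightarrow> ('b::field \<Rightarrow> real) \<Rightarrow> 'a set \<Rightarrow> (('a \<Rightarrow> 'a) \<Rightarrow> 'b mat2) \<Rightarrow> bool" where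
  "nonexceptional_supercuspidal nrm nrm' F \<rho> \<longleftrightarrow>
     weil_rep2 nrm nrm' F \<rho> \<and> zero_monodromy nrm F \<rho> \<and>
     (\<exists>E \<sigma> \<xi>. quadratic_ext F E \<and> \<sigma> \<in> weil_set nrm F - weil_set nrm E \<and>
        weil_character nrm nrm' E \<xi> \<and>
        (\<exists>h \<in> weil_set nrm E. \<xi> h \<noteq> conj_char \<sigma> \<xi> h) \<and>
        isomorphic_reps (field_on UNIV) (weil_set nrm F) \<rho> (Ind (field_on UNIV) (weil_set nrm E) \<sigma> \<xi>))"

end

theory Submission
  imports Defs
begin

text \<open>Conjugating the induced representation by \<open>U\<close> gives explicit matrices: \<open>\<rho>(h)\<close> is upper triangular
  with diagonal \<open>\<xi>(h), \<xi>\<^sup>\<sigma>(h)\<close> and corner \<open>(b/d)(\<xi>\<^sup>\<sigma>(h) - \<xi>(h))\<close>, and the lower left entry of \<open>\<rho>(h\<sigma>)\<close>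
  is \<open>(d/a) \<xi>(\<sigma>h\<sigma>)\<close>. Integrality of \<open>\<rho>\<close> therefore puts \<open>d/a\<close> and \<open>b/a\<close> in \<open>\<O>\<close>. If \<open>d/a\<close> is a unit,
  then \<open>U/a\<close> is integrally invertible and the reduction is the induced representation of the reduced
  character, for which an invariant line yields a square root of \<open>\<xi>(\<sigma>\<^sup>2)\<close> modulo \<open>\<lambda>\<close>; this lifts to \<open>K\<close>
  by Newton's iteration, as \<open>\<ell>\<close> is odd. If \<open>d/a \<in> \<lambda>\<close>, then the reduction is upper triangular, \<open>b/a\<close> is
  a unit, and everything is decided by whether the corners \<open>(b/d)(\<xi>\<^sup>\<sigma>(h) - \<xi>(h))\<close> vanish modulo \<open>\<lambda>\<close>.\<close>

section \<open>Nonarchimedean fields and their residue fields\<close>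

text \<open>Reductions live over the residue field of \<open>K\<close>, which is not algebraically
  closed. If \<open>d / a\<close> is a unit and the reduced characters agree, \<sigma> acts on the
  reduction with square \<open>u = \<xi> (\<sigma> \<circ> \<sigma>)\<close>, and an invariant line
  exists only if \<open>u\<close> is a square modulo \<lambda>. Hence one direction of the
  irreducibility criterion carries a condition on a square root. If \<open>d / a\<close> lies in
  \<lambda>, the determinant of \<open>\<rho> \<sigma>\<close> already gives
  \<open>(b / a)^2 * u = 1\<close> modulo \<lambda>, so no condition appears there. Two facts about
  \<open>K\<close> carry the argument: completeness, to lift square roots, and discreteness, for
  valuations and ideal powers. Both are propagated from the closure of the rationals along flags of
  subspaces. The inclusion of Weil groups rests on the residue cardinality of \<open>E\<close> being
  a power of that of \<open>F\<close>. Multiplicativity of the induced matrices and index two are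
  both extracted from \<rho> being a homomorphism. Congruences modulo \<lambda> are handled as
  strict inequalities \<open>nrm x < 1\<close> between lifts, so that computations stay in a
  field.\<close>

lemma ring_of_type_algebra_simps [simp]:
  "carrier ring_of_type_algebra = UNIV"
  "x \<otimes>\<^bsub>ring_of_type_algebra\<^esub> y = x * y" "x \<oplus>\<^bsub>ring_of_type_algebra\<^esub> y = x + y"
  "\<one>\<^bsub>ring_of_type_algebra\<^esub> = 1" "\<zero>\<^bsub>ring_of_type_algebra\<^esub> = 0"
  by (simp_all add: ring_of_type_algebra_def)

lemma field_on_UNIV: "field_on UNIV = (ring_of_type_algebra :: 'a::field ring)"
  by (simp add: ring_of_type_algebra_def)

lemma field_field_on_UNIV: "field (field_on (UNIV :: 'a::field set))"
  unfolding field_on_UNIV by (rule field_from_type_algebra)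

lemma cring_field_on:
  assumes "1 \<in> S" "\<And>x y. x \<in> S \<Longrightarrow> y \<in> S \<Longrightarrow> x + y \<in> S"
    "\<And>x y. x \<in> S \<Longrightarrow> y \<in> S \<Longrightarrow> x * y \<in> S" "\<And>x. x \<in> S \<Longrightarrow> - x \<in> S"
  shows "cring (field_on S)"
proof (rule cringI)
  have z: "0 \<in> S" using assms(2)[OF assms(1) assms(4)[OF assms(1)]] by simp
  show "abelian_group (field_on S)"
  proof (rule abelian_groupI)
    fix x assume "x \<in> carrier (field_on S)"
    then show "\<exists>y\<in>carrier (field_on S). y \<oplus>\<^bsub>field_on S\<^esub> x = \<zero>\<^bsub>field_on S\<^esub>"
      using assms(4) by (intro bexI[of _ "- x"]) auto
  qed (use assms z in auto)
  show "comm_monoid (field_on S)"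
    by (rule comm_monoidI) (use assms z in auto)
qed (simp add: algebra_simps)

locale nonarch_field =
  fixes nrm :: "'b::field \<Rightarrow> real"
  assumes nonarch: "nonarch_abs nrm"
begin

lemma nrm_nonneg [simp]: "0 \<le> nrm x"
  using nonarch by (simp add: nonarch_abs_def)

lemma nrm_eq_0 [simp]: "nrm x = 0 \<longleftrightarrow> x = 0"
  using nonarch by (simp add: nonarch_abs_def)

lemma nrm_0 [simp]: "nrm 0 = 0" by simp

lemma nrm_pos: "x \<noteq> 0 \<Longrightarrow> 0 < nrm x"
  using nrm_nonneg[of x] nrm_eq_0[of x] by linarith

lemma nrm_mult: "nrm (x * y) = nrm x * nrm y"
  using nonarch by (simp add: nonarch_abs_def)

lemma nrm_1 [simp]: "nrm 1 = 1"
  using nrm_mult[of 1 1] nrm_eq_0[of 1] by simp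

lemma nrm_minus [simp]: "nrm (- x) = nrm x"
proof -
  have "nrm (- 1) * nrm (- 1) = 1"
    using nrm_mult[of "- 1" "- 1"] by simp
  then have "nrm (- 1) = 1"
    using nrm_nonneg[of "- 1"] by (metis abs_of_nonneg abs_mult_self_eq abs_square_eq_1 power2_eq_square)
  then show ?thesis
    using nrm_mult[of "- 1" x] by simp
qed

lemma nrm_minus_commute: "nrm (x - y) = nrm (y - x)"
  using nrm_minus[of "x - y"] by simp

lemma nrm_add: "nrm (x + y) \<le> max (nrm x) (nrm y)"
  using nonarch by (simp add: nonarch_abs_def)

lemma nrm_diff: "nrm (x - y) \<le> max (nrm x) (nrm y)"
  using nrm_add[of x "- y"] by simp

lemma nrm_add_le: "nrm x \<le> r \<Longrightarrow> nrm y \<le> r \<Longrightarrow> nrm (x + y) \<le> r"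
  and nrm_add_less: "nrm x < r \<Longrightarrow> nrm y < r \<Longrightarrow> nrm (x + y) < r"
  and nrm_diff_le: "nrm x \<le> r \<Longrightarrow> nrm y \<le> r \<Longrightarrow> nrm (x - y) \<le> r"
  and nrm_diff_less: "nrm x < r \<Longrightarrow> nrm y < r \<Longrightarrow> nrm (x - y) < r"
  using nrm_add[of x y] nrm_diff[of x y] by linarith+

lemma nrm_trans_less: "nrm (x - y) < r \<Longrightarrow> nrm (y - z) < r \<Longrightarrow> nrm (x - z) < r"
  using nrm_add_less[of "x - y" r "y - z"] by simp

text \<open>Writing \<open>y = (x + y) - x\<close> gives the reverse of the ultrametric inequality:
  the strictly larger summand determines the norm.\<close>

lemma nrm_add_eq_right:
  assumes "nrm x < nrm y"
  shows "nrm (x + y) = nrm y"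
  using nrm_add[of x y] nrm_diff[of "x + y" x] assms by simp

lemma nrm_diff_eq_max:
  assumes "nrm x \<noteq> nrm y"
  shows "nrm (x - y) = max (nrm x) (nrm y)"
  using nrm_add_eq_right[of x "- y"] nrm_add_eq_right[of "- y" x] assms by (auto simp: max_def)

lemma nrm_eq_if_close: "nrm (x - y) < nrm y \<Longrightarrow> nrm x = nrm y"
  using nrm_add_eq_right[of "x - y" y] by simp

lemma nrm_inverse: "nrm (inverse x) = inverse (nrm x)"
proof (cases "x = 0")
  case False
  then have "nrm x * nrm (inverse x) = 1"
    using nrm_mult[of x "inverse x"] by simp
  then show ?thesis
    by (rule inverse_unique[symmetric])
qed simp

lemma nrm_divide: "nrm (x / y) = nrm x / nrm y"
  by (simp add: divide_inverse nrm_mult nrm_inverse)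

lemma nrm_power: "nrm (x ^ n) = nrm x ^ n"
  by (induction n) (simp_all add: nrm_mult)

lemma nrm_powi: "nrm (x powi n) = nrm x powi n"
  by (simp add: power_int_def nrm_power nrm_inverse)

lemma nrm_mult_le: "nrm x \<le> r \<Longrightarrow> nrm y \<le> s \<Longrightarrow> nrm (x * y) \<le> r * s"
  unfolding nrm_mult by (meson mult_mono nrm_nonneg order_trans)

lemma nrm_mult_le_1: "nrm x \<le> 1 \<Longrightarrow> nrm y \<le> 1 \<Longrightarrow> nrm (x * y) \<le> 1"
  using nrm_mult_le[of x 1 y 1] by simp

lemma nrm_mult_less_1:
  assumes "nrm x \<le> 1" "nrm y < 1"
  shows "nrm (x * y) < 1" "nrm (y * x) < 1"
proof -
  have "nrm x * nrm y \<le> nrm y"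
    using assms by (simp add: mult_left_le_one_le)
  then show "nrm (x * y) < 1" "nrm (y * x) < 1"
    using assms by (simp_all add: nrm_mult mult.commute)
qed

lemma nrm_power_diff_less:
  assumes "nrm (x - y) < 1" "nrm x \<le> 1" "nrm y \<le> 1"
  shows "nrm (x ^ n - y ^ n) < 1"
proof (induction n)
  case (Suc n)
  have "x ^ Suc n - y ^ Suc n = x * (x ^ n - y ^ n) + (x - y) * y ^ n"
    by (simp add: algebra_simps)
  moreover have "nrm (y ^ n) \<le> 1"
    using assms by (simp add: nrm_power power_le_one)
  ultimately show ?case
    using Suc assms by (simp add: nrm_add_less nrm_mult_less_1)
qed simp

lemma Metric_space_nrm: "Metric_space M (nrm_dist nrm)"
proof
  fix x y z
  show "nrm (x - z) \<le> nrm (x - y) + nrm (y - z)"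
    using nrm_add[of "x - y" "y - z"] nrm_nonneg[of "x - y"] nrm_nonneg[of "y - z"]
    by (simp del: nrm_nonneg)
qed (simp_all add: nrm_minus_commute)

end

section \<open>Subfields, their rings of integers and residue fields\<close>

locale nonarch_subfield = nonarch_field nrm for nrm :: "'b::field \<Rightarrow> real" +
  fixes K :: "'b set"
  assumes subfield: "subfield K (field_on UNIV)"
begin

lemma K_0 [simp]: "0 \<in> K" and K_1 [simp]: "1 \<in> K"
  and K_add [simp]: "x \<in> K \<Longrightarrow> y \<in> K \<Longrightarrow> x + y \<in> K"
  and K_mult [simp]: "x \<in> K \<Longrightarrow> y \<in> K \<Longrightarrow> x * y \<in> K"
proof -
  interpret F: field "field_on (UNIV :: 'b set)" by (rule field_field_on_UNIV)
  note K = subringE[OF subfieldE(1)[OF subfield]]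
  show "0 \<in> K" using K(2) by simp
  show "1 \<in> K" using K(3) by simp
  show "x \<in> K \<Longrightarrow> y \<in> K \<Longrightarrow> x + y \<in> K" using K(7) by simp
  show "x \<in> K \<Longrightarrow> y \<in> K \<Longrightarrow> x * y \<in> K" using K(6) by simp
qed

lemma K_inverse [simp]: "x \<in> K \<Longrightarrow> inverse x \<in> K"
proof (cases "x = 0")
  case False
  assume "x \<in> K"
  then have "x \<in> Units (field_on K)"
    using subfield.subfield_Units[OF subfield] False by simp
  then obtain y where y: "y \<in> K" "x * y = 1"
    by (auto simp: Units_def)
  then show ?thesis
    using inverse_unique[OF y(2)] by simp
qed simp

lemma K_minus [simp]: "x \<in> K \<Longrightarrow> - x \<in> K"
proof -
  assume "x \<in> K"
  interpret F: field "field_on (UNIV :: 'b set)" by (rule field_field_on_UNIV)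
  have "\<ominus>\<^bsub>field_on UNIV\<^esub> x = - x"
    by (rule F.minus_equality) simp_all
  moreover have "\<ominus>\<^bsub>field_on UNIV\<^esub> x \<in> K"
    using subringE(5)[OF subfieldE(1)[OF subfield] \<open>x \<in> K\<close>] .
  ultimately show ?thesis by simp
qed

lemma K_diff [simp]: "x \<in> K \<Longrightarrow> y \<in> K \<Longrightarrow> x - y \<in> K"
  using K_add[of x "- y"] by auto

lemma K_divide [simp]: "x \<in> K \<Longrightarrow> y \<in> K \<Longrightarrow> x / y \<in> K"
  by (auto simp: divide_inverse)

lemma K_power [simp]: "x \<in> K \<Longrightarrow> x ^ n \<in> K"
  by (induction n) auto

lemma K_powi [simp]: "x \<in> K \<Longrightarrow> x powi n \<in> K"
  by (auto simp: power_int_def)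

abbreviation "isint x \<equiv> x \<in> K \<and> nrm x \<le> 1"

abbreviation "red \<equiv> residue nrm K"

abbreviation "k \<equiv> residue_field nrm K"

lemma carrier_integers [simp]: "x \<in> carrier (integers nrm K) \<longleftrightarrow> isint x"
  by (simp add: integers_def)

lemma integers_simps [simp]:
  "x \<otimes>\<^bsub>integers nrm K\<^esub> y = x * y" "x \<oplus>\<^bsub>integers nrm K\<^esub> y = x + y"
  "\<one>\<^bsub>integers nrm K\<^esub> = 1" "\<zero>\<^bsub>integers nrm K\<^esub> = 0"
  by (simp_all add: integers_def)

lemma cring_integers: "cring (integers nrm K)"
  unfolding integers_def by (rule cring_field_on) (auto intro: nrm_add_le nrm_mult_le_1)

lemma Units_integers: "Units (integers nrm K) = {x \<in> K. nrm x = 1}"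
proof (rule Set.set_eqI, rule iffI)
  fix x assume "x \<in> Units (integers nrm K)"
  then obtain y where y: "isint x" "isint y" "y * x = 1"
    by (auto simp: Units_def)
  then have "nrm y * nrm x = 1"
    by (metis nrm_1 nrm_mult)
  moreover have "nrm y * nrm x \<le> nrm x"
    using y by (intro mult_left_le_one_le) auto
  ultimately have "nrm x = 1"
    using y by linarith
  then show "x \<in> {x \<in> K. nrm x = 1}"
    using y by simp
next
  fix x assume x: "x \<in> {x \<in> K. nrm x = 1}"
  then have "x \<noteq> 0" by auto
  then show "x \<in> Units (integers nrm K)"
    using x unfolding Units_def
    by (auto intro!: bexI[of _ "inverse x"] simp: nrm_inverse)
qed

lemma ideal_max_ideal: "ideal (max_ideal nrm K) (integers nrm K)"
proof -
  interpret O: cring "integers nrm K" by (rule cring_integers)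
  show ?thesis
  proof (rule idealI)
    show "subgroup (max_ideal nrm K) (add_monoid (integers nrm K))"
    proof (rule O.add.subgroupI)
      fix x assume x: "x \<in> max_ideal nrm K"
      have "\<ominus>\<^bsub>integers nrm K\<^esub> x = - x"
        using x by (intro O.minus_equality) (auto simp: max_ideal_def)
      then show "\<ominus>\<^bsub>integers nrm K\<^esub> x \<in> max_ideal nrm K"
        using x by (auto simp: max_ideal_def)
    qed (auto simp: max_ideal_def nrm_add_less intro!: exI[of _ 0])
  qed (auto simp: max_ideal_def nrm_mult_less_1 O.ring_axioms)
qed

lemma cring_k: "cring k"
  unfolding residue_field_def
  by (rule ideal.quotient_is_cring[OF ideal_max_ideal cring_integers])

lemma red_hom: "red \<in> ring_hom (integers nrm K) k"
  using ideal.rcos_ring_hom[OF ideal_max_ideal]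
  unfolding residue_field_def residue_def[abs_def] .

lemma red_closed [simp]: "isint x \<Longrightarrow> red x \<in> carrier k"
  using ring_hom_closed[OF red_hom, of x] by simp

lemma red_mult: "isint x \<Longrightarrow> isint y \<Longrightarrow> red x \<otimes>\<^bsub>k\<^esub> red y = red (x * y)"
  using ring_hom_mult[OF red_hom, of x y] by simp

lemma red_add: "isint x \<Longrightarrow> isint y \<Longrightarrow> red x \<oplus>\<^bsub>k\<^esub> red y = red (x + y)"
  using ring_hom_add[OF red_hom, of x y] by simp

lemma red_1: "\<one>\<^bsub>k\<^esub> = red 1"
  using ring_hom_one[OF red_hom] by simp

lemma red_0: "\<zero>\<^bsub>k\<^esub> = red 0"
  using ring_hom_zero[OF red_hom] cring.axioms(1)[OF cring_integers] cring.axioms(1)[OF cring_k]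
  by simp

text \<open>The bridge between cosets and norms: statements over the residue field are turned into
  inequalities between lifts by this equivalence.\<close>

lemma red_eq_iff:
  assumes "isint x" "isint y"
  shows "red x = red y \<longleftrightarrow> nrm (x - y) < 1"
proof -
  interpret O: cring "integers nrm K" by (rule cring_integers)
  interpret I: ideal "max_ideal nrm K" "integers nrm K" by (rule ideal_max_ideal)
  have "x \<ominus>\<^bsub>integers nrm K\<^esub> y = x - y"
  proof -
    have "\<ominus>\<^bsub>integers nrm K\<^esub> y = - y"
      using assms by (intro O.minus_equality) auto
    then show ?thesis
      by (simp add: a_minus_def)
  qed
  moreover have "red x = red y \<longleftrightarrow> x \<ominus>\<^bsub>integers nrm K\<^esub> y \<in> max_ideal nrm K"
    unfolding residue_def using O.quotient_eq_iff_same_a_r_cos[OF ideal_max_ideal, of x y] assms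
    by auto
  ultimately show ?thesis
    using assms by (auto simp: max_ideal_def)
qed

lemma carrier_kE:
  assumes "c \<in> carrier k"
  obtains x where "isint x" "c = red x"
  using assms unfolding residue_field_def residue_def FactRing_simps by auto

text \<open>A nonzero class has a representative of norm one, whose inverse is again
  integral.\<close>

lemma field_k: "field k"
proof -
  interpret k: cring k by (rule cring_k)
  show ?thesis
  proof (rule k.cring_fieldI2)
    show "\<zero>\<^bsub>k\<^esub> \<noteq> \<one>\<^bsub>k\<^esub>"
      unfolding red_0 red_1 by (simp add: red_eq_iff)
    fix c assume "c \<in> carrier k" "c \<noteq> \<zero>\<^bsub>k\<^esub>"
    then obtain x where x: "isint x" "c = red x" "red x \<noteq> red 0"
      by (metis carrier_kE red_0)
    then have "nrm x = 1"
      using red_eq_iff[of x 0] by auto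
    note x = x(1,2) this
    then show "\<exists>b\<in>carrier k. c \<otimes>\<^bsub>k\<^esub> b = \<one>\<^bsub>k\<^esub>"
      using red_mult[of x "inverse x"] nrm_eq_0[of x]
      by (intro bexI[of _ "red (inverse x)"]) (auto simp: nrm_inverse red_1)
  qed
qed

end

section \<open>Completeness, discreteness and square roots\<close>

context nonarch_field begin

text \<open>Cauchy sequences are taken in the ambient field and only the limit is required to lie in
  \<open>V\<close>. Sequences can thus be split into components in different subspaces without
  changing the metric space.\<close>

definition nrm_Cauchy :: "(nat \<Rightarrow> 'b) \<Rightarrow> bool" where
  "nrm_Cauchy f \<longleftrightarrow> (\<forall>e>0. \<exists>N. \<forall>m\<ge>N. \<forall>n\<ge>N. nrm (f m - f n) < e)"

definition nrm_complete :: "'b set \<Rightarrow> bool" where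
  "nrm_complete V \<longleftrightarrow>
     (\<forall>f. range f \<subseteq> V \<longrightarrow> nrm_Cauchy f \<longrightarrow> (\<exists>x\<in>V. (\<lambda>n. nrm (f n - x)) \<longlonglongrightarrow> 0))"

lemma nrm_CauchyD:
  assumes "nrm_Cauchy f" "0 < e"
  obtains N where "\<And>m n. m \<ge> N \<Longrightarrow> n \<ge> N \<Longrightarrow> nrm (f m - f n) < e"
  using assms unfolding nrm_Cauchy_def by blast

lemma nrm_limD:
  assumes "(\<lambda>n. nrm (f n - x)) \<longlonglongrightarrow> 0" "0 < e"
  obtains N where "\<And>n. n \<ge> N \<Longrightarrow> nrm (f n - x) < e"
  using order_tendstoD(2)[OF assms] unfolding eventually_sequentially by blast

lemma nrm_limI:
  assumes "\<And>e. 0 < e \<Longrightarrow> \<exists>N. \<forall>n\<ge>N. nrm (f n - x) < e"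
  shows "(\<lambda>n. nrm (f n - x)) \<longlonglongrightarrow> 0"
  using assms by (simp add: LIMSEQ_iff)

lemma nrm_lim_imp_Cauchy:
  assumes "(\<lambda>n. nrm (f n - x)) \<longlonglongrightarrow> 0"
  shows "nrm_Cauchy f"
  unfolding nrm_Cauchy_def
proof (intro allI impI)
  fix e :: real assume "0 < e"
  then obtain N where "\<And>n. n \<ge> N \<Longrightarrow> nrm (f n - x) < e"
    using nrm_limD[OF assms] by blast
  then show "\<exists>N. \<forall>m\<ge>N. \<forall>n\<ge>N. nrm (f m - f n) < e"
    by (metis nrm_minus_commute nrm_trans_less)
qed

lemma nrm_lim_unique:
  assumes "(\<lambda>n. nrm (f n - x)) \<longlonglongrightarrow> 0" "(\<lambda>n. nrm (f n - y)) \<longlonglongrightarrow> 0"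
  shows "x = y"
proof (rule ccontr)
  assume "x \<noteq> y"
  then have pos: "0 < nrm (x - y)"
    by (simp add: nrm_pos)
  obtain N M where "\<And>n. n \<ge> N \<Longrightarrow> nrm (f n - x) < nrm (x - y)"
    "\<And>n. n \<ge> M \<Longrightarrow> nrm (f n - y) < nrm (x - y)"
    using nrm_limD[OF assms(1) pos] nrm_limD[OF assms(2) pos] by metis
  then have "nrm (x - f (max N M)) < nrm (x - y)" "nrm (f (max N M) - y) < nrm (x - y)"
    by (simp_all add: nrm_minus_commute)
  from nrm_trans_less[OF this] show False by simp
qed

lemma mcomplete_imp_nrm_complete:
  assumes "Metric_space.mcomplete V (nrm_dist nrm)"
  shows "nrm_complete V"
  unfolding nrm_complete_def
proof (intro allI impI)
  interpret M: Metric_space V "nrm_dist nrm" by (rule Metric_space_nrm)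
  fix f :: "nat \<Rightarrow> 'b" assume "range f \<subseteq> V" "nrm_Cauchy f"
  then have "M.MCauchy f"
    unfolding M.MCauchy_def nrm_Cauchy_def by (metis (no_types))
  then obtain x where "limitin M.mtopology f x sequentially"
    using assms M.mcomplete_def by blast
  then have "x \<in> V" "\<And>e. e > 0 \<Longrightarrow> \<exists>N. \<forall>n\<ge>N. nrm (f n - x) < e"
    unfolding M.limit_metric_sequentially by metis+
  then show "\<exists>x\<in>V. (\<lambda>n. nrm (f n - x)) \<longlonglongrightarrow> 0"
    using nrm_limI by blast
qed

end

lemma rat_closure_iff: 
  fixes nrm :: "'c::field_char_0 \<Rightarrow> real"
  assumes "nonarch_abs nrm"
  shows "x \<in> rat_closure nrm \<longleftrightarrow> (\<forall>e>0. \<exists>q. nrm (x - of_rat q) < e)"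
proof -
  interpret N: nonarch_field nrm by unfold_locales fact
  interpret M: Metric_space UNIV "nrm_dist nrm" by (rule N.Metric_space_nrm)
  show ?thesis
    unfolding rat_closure_def M.metric_closure_of by (auto simp: Rats_def)
qed

section \<open>Finite-dimensional subspaces over a valued field\<close>

context nonarch_subfield begin

definition subspace :: "'b set \<Rightarrow> bool" where
  "subspace V \<longleftrightarrow> 0 \<in> V \<and> (\<forall>u\<in>V. \<forall>v\<in>V. u + v \<in> V) \<and> (\<forall>c\<in>K. \<forall>v\<in>V. c * v \<in> V)"

lemma subspaceD:
  assumes "subspace V"
  shows "0 \<in> V" "\<And>u v. u \<in> V \<Longrightarrow> v \<in> V \<Longrightarrow> u + v \<in> V" "\<And>c v. c \<in> K \<Longrightarrow> v \<in> V \<Longrightarrow> c * v \<in> V"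
    "\<And>u v. u \<in> V \<Longrightarrow> v \<in> V \<Longrightarrow> u - v \<in> V"
proof -
  show *: "0 \<in> V" "\<And>u v. u \<in> V \<Longrightarrow> v \<in> V \<Longrightarrow> u + v \<in> V" "\<And>c v. c \<in> K \<Longrightarrow> v \<in> V \<Longrightarrow> c * v \<in> V"
    using assms unfolding subspace_def by auto
  show "u - v \<in> V" if "u \<in> V" "v \<in> V" for u v
    using *(2)[OF that(1) *(3)[of "- 1", OF _ that(2)]] by simp
qed

text \<open>Induction along a flag: a space of finite dimension arises from zero by successively
  adding a line through some \<open>x\<close> outside the space built so far.\<close>

lemma dimension_induct_subspace [consumes 1, case_names zero extend]:
  assumes "ring.dimension (field_on UNIV) n K V"
    and zero: "P {0}"
    and extend: "\<And>V x. subspace V \<Longrightarrow> P V \<Longrightarrow> x \<notin> V \<Longrightarrow> P {c * x + v | c v. c \<in> K \<and> v \<in> V}"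
  shows "P V"
proof -
  interpret F: field "field_on (UNIV :: 'b set)" by (rule field_field_on_UNIV)
  have "subspace V \<and> P V"
    using assms(1)
  proof (induction n K\<equiv>K V rule: F.dimension.induct)
    case zero_dim
    show ?case using zero by (simp add: subspace_def)
  next
    case (Suc_dim x V n)
    let ?V = "{c * x + v | c v. c \<in> K \<and> v \<in> V}"
    have IH: "subspace V" "P V" using Suc_dim by auto
    note V = subspaceD[OF IH(1)]
    have eq: "F.line_extension K x V = ?V"
      unfolding Set.set_eq_iff F.line_extension_mem_iff by simp blast
    have "subspace ?V"
      unfolding subspace_def
    proof (intro conjI ballI)
      show "0 \<in> ?V" using V(1) K_0 by (auto intro!: exI[of _ 0])
      fix u assume "u \<in> ?V"
      then obtain c w where u: "c \<in> K" "w \<in> V" "u = c * x + w" by blast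
      show "u + v \<in> ?V" if v: "v \<in> ?V" for v
      proof -
        obtain c' w' where "c' \<in> K" "w' \<in> V" "v = c' * x + w'" using v by blast
        then show ?thesis
          using u V(2) by (intro CollectI exI[of _ "c + c'"] exI[of _ "w + w'"]) (simp add: algebra_simps)
      qed
      show "a * u \<in> ?V" if "a \<in> K" for a
        using u V(3) that
        by (intro CollectI exI[of _ "a * c"] exI[of _ "a * w"]) (simp add: algebra_simps)
    qed
    then show ?case
      using extend[OF IH Suc_dim(2)] by (simp only: eq simp_thms)
  qed
  then show ?thesis ..
qed

text \<open>A point \<open>x\<close> outside a complete \<open>V\<close> has positive distance
  \<delta> from \<open>V\<close>. Hence the coefficient of \<open>x\<close> in
  \<open>c * x + v\<close> is bounded by the norm of the sum divided by \<delta>, and a Cauchy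
  sequence has Cauchy components.\<close>

lemma complete_dimension:
  assumes "ring.dimension (field_on UNIV) n K V" and complete: "nrm_complete K"
  shows "nrm_complete V"
  using assms(1)
proof (induction rule: dimension_induct_subspace)
  case zero
  show ?case
    unfolding nrm_complete_def
  proof (intro allI impI bexI[of _ 0])
    fix f :: "nat \<Rightarrow> 'b" assume "range f \<subseteq> {0}"
    then have "f = (\<lambda>_. 0)" by auto
    then show "(\<lambda>n. nrm (f n - 0)) \<longlonglongrightarrow> 0" by simp
  qed simp
next
  case (extend V x)
  note V = subspaceD[OF \<open>subspace V\<close>]
  \<comment> \<open>Otherwise elements of \<open>V\<close> converge to \<open>- x\<close>;
    completeness of \<open>V\<close> and uniqueness of limits then put \<open>x\<close> into
    \<open>V\<close>.\<close>
  have "\<exists>\<delta>>0. \<forall>v\<in>V. \<delta> \<le> nrm (x + v)"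
  proof (rule ccontr)
    assume "\<not> ?thesis"
    then have "\<exists>v\<in>V. nrm (x + v) < 1 / real (Suc n)" for n
      by (meson not_less of_nat_0_less_iff zero_less_Suc zero_less_divide_1_iff)
    then obtain v where v: "\<And>n. v n \<in> V" "\<And>n. nrm (x + v n) < 1 / real (Suc n)"
      by metis
    have "(\<lambda>n. nrm (v n - (- x))) \<longlonglongrightarrow> 0"
    proof (rule tendsto_sandwich[OF _ _ tendsto_const LIMSEQ_inverse_real_of_nat])
      show "\<forall>\<^sub>F n in sequentially. nrm (v n - - x) \<le> inverse (real (Suc n))"
        using less_imp_le[OF v(2)] by (simp add: add.commute inverse_eq_divide)
    qed simp
    moreover from this obtain y where "y \<in> V" "(\<lambda>n. nrm (v n - y)) \<longlonglongrightarrow> 0"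
      using extend.IH v(1) nrm_lim_imp_Cauchy unfolding nrm_complete_def by blast
    ultimately have "- x \<in> V"
      using nrm_lim_unique by blast
    then have "x \<in> V"
      using V(3)[of "- 1" "- x"] by simp
    with \<open>x \<notin> V\<close> show False ..
  qed
  then obtain \<delta> where \<delta>: "0 < \<delta>" "\<And>v. v \<in> V \<Longrightarrow> \<delta> \<le> nrm (x + v)"
    by blast
  \<comment> \<open>Factor out \<open>c\<close>: what remains is \<open>x\<close> plus an element of
    \<open>V\<close>.\<close>
  have dist: "nrm c * \<delta> \<le> nrm (c * x + v)" if "c \<in> K" "v \<in> V" for c v
  proof (cases "c = 0")
    case False
    have "c * x + v = c * (x + inverse c * v)"
      using False by (simp add: algebra_simps)
    then show ?thesis
      using \<delta>(2)[of "inverse c * v"] that V(3) by (simp add: nrm_mult mult_left_mono)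
  qed simp
  show ?case
    unfolding nrm_complete_def
  proof (intro allI impI)
    fix f :: "nat \<Rightarrow> 'b"
    assume f: "range f \<subseteq> {c * x + v | c v. c \<in> K \<and> v \<in> V}" "nrm_Cauchy f"
    have "\<exists>c v. c \<in> K \<and> v \<in> V \<and> f n = c * x + v" for n
      using f(1) by blast
    then obtain c v where cv: "\<And>n. c n \<in> K" "\<And>n. v n \<in> V" "\<And>n. f n = c n * x + v n"
      by metis
    have "nrm_Cauchy c"
      unfolding nrm_Cauchy_def
    proof (intro allI impI)
      fix e :: real assume "0 < e"
      then obtain N where N: "\<And>m n. m \<ge> N \<Longrightarrow> n \<ge> N \<Longrightarrow> nrm (f m - f n) < e * \<delta>"
        using nrm_CauchyD[OF f(2)] \<delta>(1) by (metis mult_pos_pos)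
      have "nrm (c m - c n) < e" if "m \<ge> N" "n \<ge> N" for m n
      proof -
        have "f m - f n = (c m - c n) * x + (v m - v n)"
          by (simp add: cv algebra_simps)
        then have "nrm (c m - c n) * \<delta> < e * \<delta>"
          using dist[of "c m - c n" "v m - v n"] N[OF that] cv(1,2) V(4) by simp
        then show ?thesis
          using \<delta>(1) by simp
      qed
      then show "\<exists>N. \<forall>m\<ge>N. \<forall>n\<ge>N. nrm (c m - c n) < e" by blast
    qed
    then obtain c' where c': "c' \<in> K" "(\<lambda>n. nrm (c n - c')) \<longlonglongrightarrow> 0"
      using complete cv(1) unfolding nrm_complete_def by blast
    then have cx: "(\<lambda>n. nrm (c n * x - c' * x)) \<longlonglongrightarrow> 0"
      using tendsto_mult_right[OF c'(2), of "nrm x"] by (simp add: nrm_mult flip: left_diff_distrib)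
    have "nrm_Cauchy v"
      unfolding nrm_Cauchy_def
    proof (intro allI impI)
      fix e :: real assume "0 < e"
      then obtain N M where N: "\<And>m n. m \<ge> N \<Longrightarrow> n \<ge> N \<Longrightarrow> nrm (f m - f n) < e"
        and M: "\<And>m n. m \<ge> M \<Longrightarrow> n \<ge> M \<Longrightarrow> nrm (c m * x - c n * x) < e"
        using nrm_CauchyD[OF f(2)] nrm_CauchyD[OF nrm_lim_imp_Cauchy[OF cx]] by metis
      have "nrm (v m - v n) < e" if "m \<ge> max N M" "n \<ge> max N M" for m n
        using nrm_diff_less[OF N M, of m n m n] that by (simp add: cv algebra_simps)
      then show "\<exists>N. \<forall>m\<ge>N. \<forall>n\<ge>N. nrm (v m - v n) < e" by blast
    qed
    then obtain v' where v': "v' \<in> V" "(\<lambda>n. nrm (v n - v')) \<longlonglongrightarrow> 0"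
      using extend.IH cv(2) unfolding nrm_complete_def by blast
    have "(\<lambda>n. nrm (f n - (c' * x + v'))) \<longlonglongrightarrow> 0"
    proof (rule nrm_limI)
      fix e :: real assume "0 < e"
      then obtain N M where N: "\<And>n. n \<ge> N \<Longrightarrow> nrm (c n * x - c' * x) < e"
        and M: "\<And>n. n \<ge> M \<Longrightarrow> nrm (v n - v') < e"
        using nrm_limD[OF cx] nrm_limD[OF v'(2)] by metis
      have "nrm (f n - (c' * x + v')) < e" if "n \<ge> max N M" for n
        using nrm_add_less[OF N M, of n n] that by (simp add: cv algebra_simps)
      then show "\<exists>N. \<forall>n\<ge>N. nrm (f n - (c' * x + v')) < e" by blast
    qed
    then show "\<exists>y\<in>{c * x + v | c v. c \<in> K \<and> v \<in> V}. (\<lambda>n. nrm (f n - y)) \<longlonglongrightarrow> 0"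
      using c'(1) v'(1) by blast
  qed
qed

text \<open>Each step of a flag of subspaces contributes at most one new coset of the value group of the
  base field: if \<open>v\<close> and \<open>v'\<close> lie outside the smaller space, some combination of them lies inside,
  and its norm is the larger of the two when these are not proportional.\<close>

lemma finite_norm_classes_dimension:
  assumes "ring.dimension (field_on UNIV) n K V"
  shows "\<exists>R. finite R \<and> R \<subseteq> {0<..} \<and> (\<forall>v\<in>V - {0}. \<exists>r\<in>R. \<exists>c\<in>K - {0}. nrm v = r * nrm c)"
  using assms
proof (induction rule: dimension_induct_subspace)
  case zero
  show ?case by (intro exI[of _ "{}"]) auto
next
  case (extend V x)
  note V = subspaceD[OF \<open>subspace V\<close>]
  let ?V = "{c * x + v | c v. c \<in> K \<and> v \<in> V}"
  obtain R where *: "finite R" "R \<subseteq> {0<..}"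
    "\<forall>v\<in>V - {0}. \<exists>r\<in>R. \<exists>c\<in>K - {0}. nrm v = r * nrm c"
    using extend.IH by (elim exE conjE)
  then have R: "finite R" "R \<subseteq> {0<..}"
    "\<And>v. v \<in> V \<Longrightarrow> v \<noteq> 0 \<Longrightarrow> \<exists>r\<in>R. \<exists>c\<in>K - {0}. nrm v = r * nrm c"
    by simp_all
  show ?case
  proof (cases "\<forall>v\<in>?V - {0}. \<exists>r\<in>R. \<exists>c\<in>K - {0}. nrm v = r * nrm c")
    case True
    then show ?thesis using R(1,2) by blast
  next
    case False
    \<comment> \<open>The norm of \<open>v0\<close> represents the only class that has to be added;
      any other vector is compared with \<open>v0\<close>.\<close>
    then obtain v0 where v0: "v0 \<in> ?V" "v0 \<noteq> 0"
      and new: "\<And>r c. r \<in> R \<Longrightarrow> c \<in> K \<Longrightarrow> c \<noteq> 0 \<Longrightarrow> nrm v0 \<noteq> r * nrm c"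
      by blast
    obtain c0 w0 where c0: "c0 \<in> K" "w0 \<in> V" "v0 = c0 * x + w0"
      using v0(1) by blast
    have "c0 \<noteq> 0"
      using R(3)[of v0] c0 v0(2) new by auto
    have "\<exists>r\<in>insert (nrm v0) R. \<exists>c\<in>K - {0}. nrm v = r * nrm c" if v: "v \<in> ?V" "v \<noteq> 0" for v
    proof -
      obtain c w where c: "c \<in> K" "w \<in> V" "v = c * x + w"
        using v(1) by blast
      have *: "\<exists>r\<in>insert (nrm v0) R. \<exists>c\<in>K - {0}. nrm v = r * nrm c"
        if "nrm (c * v0) = nrm (c0 * v)" "c \<noteq> 0"
      proof -
        have "nrm v = nrm v0 * nrm (c / c0)"
          using that(1) \<open>c0 \<noteq> 0\<close> by (simp add: nrm_mult nrm_divide field_simps)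
        then show ?thesis
          using that(2) c0(1) c(1) \<open>c0 \<noteq> 0\<close>
          by (intro bexI[of _ "nrm v0"] bexI[of _ "c / c0"]) simp_all
      qed
      \<comment> \<open>This combination cancels the coefficient of \<open>x\<close>, so
        \<open>z\<close> lies in \<open>V\<close> and its norm is in a known class.\<close>
      define z where "z = c * v0 - c0 * v"
      have z: "z \<in> V"
        using V(4)[OF V(3)[OF c(1) c0(2)] V(3)[OF c0(1) c(2)]]
        by (simp add: z_def c0(3) c(3) algebra_simps)
      consider "c = 0" | "c \<noteq> 0" "nrm (c * v0) = nrm (c0 * v)"
        | "c \<noteq> 0" "nrm (c * v0) \<noteq> nrm (c0 * v)" by blast
      then show ?thesis
      proof cases
        case 1
        then show ?thesis using R(3)[of v] c v by auto
      next
        case 2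
        then show ?thesis using * by blast
      next
        case 3
        then have "z \<noteq> 0" by (auto simp: z_def)
        then obtain r e where re: "r \<in> R" "e \<in> K" "e \<noteq> 0" "nrm z = r * nrm e"
          using R(3)[OF z] by blast
        have "nrm z = max (nrm (c * v0)) (nrm (c0 * v))"
          unfolding z_def by (rule nrm_diff_eq_max) (use 3 in simp)
        then consider "nrm (c * v0) = r * nrm e" | "nrm (c0 * v) = r * nrm e"
          using re(4) by (metis max_def)
        then show ?thesis
        proof cases
          case 1
          \<comment> \<open>If the term with \<open>v0\<close> dominates, the class of
            \<open>v0\<close> is an old one, against its choice; so the term with \<open>v\<close>
            must dominate.\<close>
          then have "nrm v0 = r * nrm (e / c)"
            using \<open>c \<noteq> 0\<close> by (simp add: nrm_mult nrm_divide field_simps)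
          then show ?thesis
            using new[of r "e / c"] re c \<open>c \<noteq> 0\<close> by simp
        next
          case 2
          then have "nrm v = r * nrm (e / c0)"
            using \<open>c0 \<noteq> 0\<close> by (simp add: nrm_mult nrm_divide field_simps)
          then show ?thesis
            using re c0 \<open>c0 \<noteq> 0\<close> by (intro bexI[of _ r] bexI[of _ "e / c0"]) auto
        qed
      qed
    qed
    moreover have "nrm v0 > 0" using v0(2) by (rule nrm_pos)
    ultimately show ?thesis
      using R(1,2) by (intro exI[of _ "insert (nrm v0) R"]) auto
  qed
qed

text \<open>Newton's iteration \<open>t \<mapsto> (t + u / t) / 2\<close> converges to the square root of \<open>u\<close> closest to \<open>t\<close>.\<close>

lemma hensel_sqrt:
  assumes complete: "nrm_complete K" and two: "nrm 2 = 1"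
    and t: "t \<in> K" and s: "s\<^sup>2 \<in> K" "nrm s = 1" and close: "nrm (t\<^sup>2 - s\<^sup>2) < 1"
  shows "s \<in> K"
proof -
  \<comment> \<open>Stated for an arbitrary root \<open>r\<close> because closeness of the squares
    does not tell which of \<open>s\<close> and \<open>- s\<close> is near \<open>t\<close>.\<close>
  have main: "r \<in> K" if r: "r\<^sup>2 = s\<^sup>2" "nrm (t - r) < 1" for r
  proof -
    define e where "e = nrm (t - r)"
    have "nrm r * nrm r = nrm s * nrm s"
      using r(1) by (metis nrm_mult power2_eq_square)
    then have nr: "nrm r = 1"
      using s(2) nrm_nonneg[of r] by (simp add: square_eq_1_iff)
    define T where "T = rec_nat t (\<lambda>_ y. (y + s\<^sup>2 / y) / 2)"
    have T0: "T 0 = t" and TS: "T (Suc n) = (T n + s\<^sup>2 / T n) / 2" for n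
      by (simp_all add: T_def)
    have two0: "(2::'b) \<noteq> 0"
      using two by auto
    have e: "0 \<le> e" "e < 1" using r by (simp_all add: e_def)
    have inv: "T n \<in> K \<and> nrm (T n - r) \<le> e ^ Suc n" for n
    proof (induction n)
      case 0
      show ?case using t by (simp add: T0 e_def)
    next
      case (Suc n)
      have "e ^ Suc n < 1"
        using power_decreasing[of 1 "Suc n" e] e by simp
      then have nT: "nrm (T n) = 1"
        using Suc nr nrm_eq_if_close[of "T n" r] by linarith
      then have "T n \<noteq> 0" by auto
      have "T (Suc n) - r = (T n - r)\<^sup>2 / (2 * T n)"
        using \<open>T n \<noteq> 0\<close> two0 r(1) unfolding TS
        by (simp add: field_simps power2_eq_square)
      then have "nrm (T (Suc n) - r) = nrm (T n - r) * nrm (T n - r)"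
        using nT two by (simp add: nrm_divide nrm_mult nrm_power power2_eq_square)
      \<comment> \<open>The error is squared at each step; bounding one of the two factors by
        \<open>e\<close> keeps the geometric rate, which suffices for convergence.\<close>
      also have "\<dots> \<le> e ^ Suc n * e ^ 1"
        using Suc e power_decreasing[of 1 "Suc n" e] by (intro mult_mono) auto
      finally have "nrm (T (Suc n) - r) \<le> e ^ Suc (Suc n)"
        by (simp add: mult_ac)
      moreover have "(2::'b) \<in> K"
        using K_add[of 1 1] by simp
      ultimately show ?case
        using Suc s(1) by (simp add: TS)
    qed
    have lim: "(\<lambda>n. nrm (T n - r)) \<longlonglongrightarrow> 0"
    proof (rule tendsto_sandwich[OF _ _ tendsto_const])
      show "(\<lambda>n. e ^ Suc n) \<longlonglongrightarrow> 0"
        using LIMSEQ_Suc[OF LIMSEQ_power_zero[of e]] e by simp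
    qed (use inv in auto)
    moreover have "range T \<subseteq> K" using inv by blast
    ultimately obtain y where "y \<in> K" "(\<lambda>n. nrm (T n - y)) \<longlonglongrightarrow> 0"
      using complete nrm_lim_imp_Cauchy unfolding nrm_complete_def by blast
    then show ?thesis using nrm_lim_unique[OF lim] by simp
  qed
  \<comment> \<open>The difference of squares factors, so at least one of the two factors has norm
    below one.\<close>
  have "nrm (t - s) * nrm (t - - s) < 1"
    using close by (simp add: power2_eq_square algebra_simps flip: nrm_mult)
  then consider "nrm (t - s) < 1" | "nrm (t - - s) < 1"
    by (metis leI mult_mono' mult_1 nrm_nonneg not_less zero_le_one)
  then show ?thesis
  proof cases
    case 2
    then have "- s \<in> K" using main[of "- s"] by simp
    then show ?thesis using K_minus by fastforce
  qed (use main in auto)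
qed

text \<open>Each class \<open>r * q powi m\<close> meets the interval from \<open>1 / q\<close> to
  1, right end excluded, at most once, so only finitely many norms of \<open>K\<close> lie there.
  The element \<open>y\<close> provides the left end: the maximum exists and also dominates all
  smaller norms.\<close>

lemma exists_uniformizer:
  assumes fin: "finite R" "R \<subseteq> {0<..}"
    and R: "\<And>x. x \<in> K \<Longrightarrow> x \<noteq> 0 \<Longrightarrow> \<exists>r\<in>R. \<exists>m::int. nrm x = r * q powi m"
    and q: "1 < q" and y: "y \<in> K" "nrm y = inverse q"
  shows "\<exists>\<pi>\<in>K. 0 < nrm \<pi> \<and> nrm \<pi> < 1 \<and> (\<forall>x\<in>K. nrm x < 1 \<longrightarrow> nrm x \<le> nrm \<pi>)"
proof -
  define A where "A = nrm ` {x \<in> K. inverse q \<le> nrm x \<and> nrm x < 1}"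
  define C where "C r = {z. \<exists>m::int. z = r * q powi m \<and> inverse q \<le> z \<and> z < 1}" for r
  have "\<exists>z. C r \<subseteq> {z}" if "r \<in> R" for r
  proof -
    have "r > 0" using that fin(2) by auto
    \<comment> \<open>The interval spans exactly one factor \<open>q\<close> and omits its right
      end, so a larger exponent would leave it.\<close>
    have *: False if "r * q powi m < 1" "inverse q \<le> r * q powi n" "n < m" for m n
    proof -
      have "q * (r * q powi n) = r * q powi (n + 1)"
        using q by (simp add: power_int_add)
      also have "\<dots> \<le> r * q powi m"
        using \<open>r > 0\<close> q that(3) by (intro mult_left_mono power_int_increasing) auto
      finally have "q * (r * q powi n) < 1"
        using that(1) by simp
      moreover have "q * inverse q \<le> q * (r * q powi n)"
        using that(2) q by (intro mult_left_mono) auto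
      ultimately show False using q by simp
    qed
    have "z = z'" if z: "z \<in> C r" "z' \<in> C r" for z z'
    proof -
      obtain m n where mn: "z = r * q powi m" "inverse q \<le> r * q powi m" "r * q powi m < 1"
        "z' = r * q powi n" "inverse q \<le> r * q powi n" "r * q powi n < 1"
        using z unfolding C_def by blast
      have "m = n" using *[of m n] *[of n m] mn by (cases m n rule: linorder_cases) simp_all
      then show ?thesis using mn by simp
    qed
    then show ?thesis by blast
  qed
  then have "finite (C r)" if "r \<in> R" for r
    using that finite_subset by blast
  moreover have "A \<subseteq> (\<Union>r\<in>R. C r)"
  proof
    fix z assume "z \<in> A"
    then obtain x where x: "x \<in> K" "z = nrm x" "inverse q \<le> z" "z < 1"
      by (auto simp: A_def)
    have "0 < inverse q" using q by simp
    then have "x \<noteq> 0" using x by auto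
    then show "z \<in> (\<Union>r\<in>R. C r)"
      using R[of x] x unfolding C_def by blast
  qed
  ultimately have finA: "finite A"
    using fin(1) finite_subset by blast
  have q1: "inverse q < 1" "0 < inverse q"
    using q by (simp_all add: inverse_less_1_iff)
  then have "nrm y \<in> A"
    using y unfolding A_def by (intro imageI) simp
  then have "Max A \<in> A" and le: "nrm y \<le> Max A"
    using finA Max_in[of A] Max_ge[of A] by blast+
  then obtain \<pi> where \<pi>: "\<pi> \<in> K" "nrm \<pi> = Max A" "nrm \<pi> < 1" "inverse q \<le> nrm \<pi>"
    unfolding A_def by auto
  have "nrm x \<le> nrm \<pi>" if "x \<in> K" "nrm x < 1" for x
  proof (cases "inverse q \<le> nrm x")
    case True
    then have "nrm x \<in> A" using that by (auto simp: A_def)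
    then show ?thesis using finA \<pi>(2) by simp
  qed (use \<pi> in linarith)
  then show ?thesis
    using \<pi> less_le_trans[OF q1(2) \<pi>(4)] by (intro bexI[of _ \<pi>]) simp_all
qed

end

text \<open>Discreteness is encoded by an element whose norm is the largest one below 1. This yields
  the generator of the maximal ideal and the integrality of valuations.\<close>

locale discretely_valued = nonarch_subfield nrm K for nrm :: "'b::field \<Rightarrow> real" and K +
  fixes \<pi> :: 'b
  assumes \<pi>: "\<pi> \<in> K" "0 < nrm \<pi>" "nrm \<pi> < 1" "\<And>x. x \<in> K \<Longrightarrow> nrm x < 1 \<Longrightarrow> nrm x \<le> nrm \<pi>"
begin

lemma \<pi>_nonzero [simp]: "\<pi> \<noteq> 0"
  using \<pi>(2) by auto

text \<open>With \<open>n\<close> the floor of the logarithm to base \<open>nrm \<pi>\<close>, which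
  is below one and so reverses order, the quotient \<open>x / \<pi> powi n\<close> has norm above
  \<open>nrm \<pi>\<close> and at most 1. No norm of \<open>K\<close> lies strictly between these
  two, so it is a unit.\<close>

lemma exists_valuation:
  assumes "x \<in> K" "x \<noteq> 0"
  obtains n :: int where "nrm x = nrm \<pi> powi n"
proof
  define n where "n = \<lfloor>log (nrm \<pi>) (nrm x)\<rfloor>"
  have "0 < nrm x" using assms nrm_pos by blast
  have pn: "\<pi> powi n \<noteq> 0" using \<pi>(2) by auto
  have eq: "nrm \<pi> powr log (nrm \<pi>) (nrm x) = nrm x"
    using \<pi> \<open>0 < nrm x\<close> by simp
  have "log (nrm \<pi>) (nrm x) < real_of_int (n + 1)" "real_of_int n \<le> log (nrm \<pi>) (nrm x)"
    unfolding n_def by linarith+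
  then have "nrm \<pi> powr real_of_int (n + 1) < nrm x" "nrm x \<le> nrm \<pi> powr real_of_int n"
    using \<pi> eq powr_less_mono'[of "nrm \<pi>" "log (nrm \<pi>) (nrm x)" "real_of_int (n + 1)"]
      powr_mono'[of "real_of_int n" "log (nrm \<pi>) (nrm x)" "nrm \<pi>"]
    by auto
  then have bounds: "nrm \<pi> powi (n + 1) < nrm x" "nrm x \<le> nrm \<pi> powi n"
    using powr_real_of_int'[of "nrm \<pi>" n] powr_real_of_int'[of "nrm \<pi>" "n + 1"] \<pi>(2)
    by (metis less_eq_real_def less_irrefl)+
  let ?y = "x / \<pi> powi n"
  have pos: "0 < nrm \<pi> powi n" using \<pi> by simp
  have y: "nrm ?y = nrm x / nrm \<pi> powi n"
    by (simp add: nrm_divide nrm_powi)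
  have "nrm \<pi> < nrm ?y"
    using bounds(1) \<pi>(2) pos power_int_add_1'[of "nrm \<pi>" n] unfolding y
    by (simp add: pos_less_divide_eq)
  moreover have "nrm ?y \<le> 1"
    using bounds(2) pos unfolding y by (simp add: field_simps)
  moreover have "?y \<in> K" using assms \<pi> by simp
  ultimately have "nrm ?y = 1"
    using \<pi>(4)[of ?y] by linarith
  then show "nrm x = nrm \<pi> powi n"
    using pos unfolding y by (simp add: field_simps)
qed

lemma powi_less_iff: "nrm \<pi> powi m < nrm \<pi> powi n \<longleftrightarrow> n < m"
  using \<pi> power_int_strict_decreasing[of n m "nrm \<pi>"] power_int_decreasing[of m n "nrm \<pi>"]
  by force

lemma powi_inj: "nrm \<pi> powi m = nrm \<pi> powi n \<longleftrightarrow> m = n"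
  using powi_less_iff[of m n] powi_less_iff[of n m] by (cases m n rule: linorder_cases) auto

lemma max_ideal_eq: "max_ideal nrm K = PIdl\<^bsub>integers nrm K\<^esub> \<pi>"
proof (rule Set.set_eqI, rule iffI)
  fix x assume "x \<in> max_ideal nrm K"
  then have x: "x \<in> K" "nrm x \<le> nrm \<pi>" by (auto simp: max_ideal_def \<pi>)
  have "\<pi> \<noteq> 0" using \<pi>(2) by auto
  then show "x \<in> PIdl\<^bsub>integers nrm K\<^esub> \<pi>"
    using x \<pi> unfolding cgenideal_def by (auto simp: nrm_divide field_simps intro!: exI[of _ "x / \<pi>"])
next
  fix x assume "x \<in> PIdl\<^bsub>integers nrm K\<^esub> \<pi>"
  then show "x \<in> max_ideal nrm K"
    using \<pi> unfolding cgenideal_def max_ideal_def by (auto intro: nrm_mult_less_1)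
qed

text \<open>Any generator of the maximal ideal has the norm of \<pi>, so the exponent in
  \<open>norm_val\<close> does not depend on the uniformizer, and comparing norms makes it
  unique.\<close>

lemma norm_val_eq:
  assumes x: "x \<in> K" and n: "nrm x = nrm \<pi> powi n"
  shows "norm_val nrm K x = ereal (of_int n)"
proof -
  have "\<pi> \<noteq> 0" using \<pi>(2) by auto
  have "x \<noteq> 0" using n \<pi>(2) by auto
  have "(THE n. \<exists>\<pi>' \<in> max_ideal nrm K. \<exists>u \<in> Units (integers nrm K).
       max_ideal nrm K = PIdl\<^bsub>integers nrm K\<^esub> \<pi>' \<and> x = u * \<pi>' powi n) = n"
  proof (rule the_equality)
    have "nrm (x / \<pi> powi n) = 1"
      using \<open>\<pi> \<noteq> 0\<close> by (simp add: nrm_divide nrm_powi n)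
    then show "\<exists>\<pi>' \<in> max_ideal nrm K. \<exists>u \<in> Units (integers nrm K).
       max_ideal nrm K = PIdl\<^bsub>integers nrm K\<^esub> \<pi>' \<and> x = u * \<pi>' powi n"
      using \<pi> x \<open>\<pi> \<noteq> 0\<close> max_ideal_eq
      by (intro bexI[of _ \<pi>] bexI[of _ "x / \<pi> powi n"]) (auto simp: Units_integers max_ideal_def)
  next
    fix m assume "\<exists>\<pi>' \<in> max_ideal nrm K. \<exists>u \<in> Units (integers nrm K).
       max_ideal nrm K = PIdl\<^bsub>integers nrm K\<^esub> \<pi>' \<and> x = u * \<pi>' powi m"
    then obtain \<pi>' u where *: "\<pi>' \<in> max_ideal nrm K" "u \<in> Units (integers nrm K)"
      "max_ideal nrm K = PIdl\<^bsub>integers nrm K\<^esub> \<pi>'" "x = u * \<pi>' powi m" by blast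
    have "\<pi> \<in> PIdl\<^bsub>integers nrm K\<^esub> \<pi>'"
      using \<pi> *(3) by (auto simp: max_ideal_def)
    then obtain y where "y \<in> K" "nrm y \<le> 1" "\<pi> = y * \<pi>'"
      by (auto simp: cgenideal_def)
    then have "nrm \<pi> \<le> nrm \<pi>'"
      using nrm_mult_le[of y 1 \<pi>' "nrm \<pi>'"] by simp
    moreover have "nrm \<pi>' \<le> nrm \<pi>"
      using *(1) \<pi>(4) by (auto simp: max_ideal_def)
    ultimately have "nrm x = nrm \<pi> powi m"
      using *(2,4) by (simp add: nrm_mult nrm_powi Units_integers)
    then show "m = n" using n powi_inj by simp
  qed
  then show ?thesis
    using \<open>x \<noteq> 0\<close> by (simp add: norm_val_def)
qed

text \<open>In the induction step an element of norm at most \<open>nrm \<pi> ^ Suc n\<close> is the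
  single product of \<open>x / \<pi>\<close> and \<pi>; conversely the norm bound survives sums of
  products.\<close>

lemma max_ideal_power:
  "max_ideal nrm K [^]\<^bsub>ideals_set (integers nrm K)\<^esub> (n::nat) = {x \<in> K. nrm x \<le> nrm \<pi> ^ n}"
proof (induction n)
  case 0
  show ?case by (auto simp: ideals_set_def)
next
  case (Suc n)
  have "ideal_prod (integers nrm K) {x \<in> K. nrm x \<le> nrm \<pi> ^ n} (max_ideal nrm K)
      = {x \<in> K. nrm x \<le> nrm \<pi> ^ Suc n}" (is "?L = ?R")
  proof (rule Set.set_eqI, rule iffI)
    fix x assume "x \<in> ?L"
    then show "x \<in> ?R"
    proof (induction rule: ideal_prod.induct)
      case (prod x y)
      then show ?case
        using nrm_mult_le[of x "nrm \<pi> ^ n" y "nrm \<pi>"] \<pi>(4)[of y]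
        by (auto simp: max_ideal_def mult.commute)
    next
      case (sum x y)
      then show ?case by (auto intro: nrm_add_le)
    qed
  next
    fix x assume x: "x \<in> ?R"
    have p: "\<pi> \<noteq> 0" using \<pi>(2) by auto
    have "x = (x / \<pi>) \<otimes>\<^bsub>integers nrm K\<^esub> \<pi>" using p by simp
    also have "\<dots> \<in> ?L"
      using x \<pi> by (intro ideal_prod.prod) (auto simp: max_ideal_def nrm_divide field_simps)
    finally show "x \<in> ?L" .
  qed
  then show ?case
    using Suc by (simp add: ideals_set_def)
qed

lemma cong_max_ideal_power_iff:
  "x \<in> K \<Longrightarrow> y \<in> K \<Longrightarrow> cong_max_ideal_power nrm K n x y \<longleftrightarrow> nrm (x - y) \<le> nrm \<pi> ^ n"
  unfolding cong_max_ideal_power_def max_ideal_power by simp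

end

section \<open>Finite extensions of \<open>\<rat>\<^sub>p\<close>\<close>

lemma subfield_field_onI:
  fixes S :: "'a::field set"
  assumes "1 \<in> S" "\<And>x y. x \<in> S \<Longrightarrow> y \<in> S \<Longrightarrow> x + y \<in> S"
    "\<And>x y. x \<in> S \<Longrightarrow> y \<in> S \<Longrightarrow> x * y \<in> S" "\<And>x. x \<in> S \<Longrightarrow> - x \<in> S"
    "\<And>x. x \<in> S \<Longrightarrow> x \<noteq> 0 \<Longrightarrow> inverse x \<in> S"
  shows "subfield S (field_on UNIV)"
proof -
  interpret F: field "field_on (UNIV :: 'a set)" by (rule field_field_on_UNIV)
  show ?thesis
  proof (rule F.subfieldI')
    have "\<ominus>\<^bsub>field_on UNIV\<^esub> x = - x" for x :: 'a
      by (rule F.minus_equality) simp_all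
    then show "subring S (field_on UNIV)"
      by (intro F.subringI) (use assms in auto)
    fix x assume x: "x \<in> S - {\<zero>\<^bsub>field_on UNIV\<^esub>}"
    have "inv\<^bsub>field_on UNIV\<^esub> x = inverse x"
      by (rule F.inv_char) (use x in auto)
    then show "inv\<^bsub>field_on UNIV\<^esub> x \<in> S"
      using x assms(5) by simp
  qed
qed

lemma nonarch_subfieldI:
  "nonarch_abs nrm \<Longrightarrow> subfield K (field_on UNIV) \<Longrightarrow> nonarch_subfield nrm K"
  by (intro nonarch_subfield.intro nonarch_field.intro nonarch_subfield_axioms.intro)

locale padic =
  fixes p :: nat and nrm :: "'b::{field_char_0, alg_closed_field} \<Rightarrow> real"
  assumes prime: "Factorial_Ring.prime p" and padic: "padic_alg_closure p nrm"

sublocale padic \<subseteq> nonarch_field nrm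
  using padic by unfold_locales (simp add: padic_alg_closure_def)

context padic begin

lemma rat_closure_iff': "x \<in> rat_closure nrm \<longleftrightarrow> (\<forall>e>0. \<exists>q. nrm (x - of_rat q) < e)"
  by (rule rat_closure_iff) (rule nonarch)

lemma rat_closureD: "x \<in> rat_closure nrm \<Longrightarrow> 0 < e \<Longrightarrow> \<exists>q. nrm (x - of_rat q) < e"
  by (simp add: rat_closure_iff')

lemma of_rat_in_rat_closure: "of_rat q \<in> rat_closure nrm"
  unfolding rat_closure_iff' by (metis diff_self nrm_0)

lemma subfield_rat_closure: "subfield (rat_closure nrm) (field_on UNIV)"
proof (rule subfield_field_onI)
  show "1 \<in> rat_closure nrm"
    using of_rat_in_rat_closure[of 1] by simp
next
  fix x assume x: "x \<in> rat_closure nrm"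
  show "x + y \<in> rat_closure nrm" if y: "y \<in> rat_closure nrm" for y
    unfolding rat_closure_iff'
  proof (intro allI impI)
    fix e :: real assume "0 < e"
    then obtain q r where "nrm (x - of_rat q) < e" "nrm (y - of_rat r) < e"
      using rat_closureD x y by metis
    then have "nrm (x + y - of_rat (q + r)) < e"
      using nrm_add_less[of "x - of_rat q" e "y - of_rat r"] by (simp add: of_rat_add algebra_simps)
    then show "\<exists>q. nrm (x + y - of_rat q) < e" ..
  qed
  show "x * y \<in> rat_closure nrm" if y: "y \<in> rat_closure nrm" for y
    unfolding rat_closure_iff'
  proof (intro allI impI)
    fix e :: real assume e: "0 < e"
    define C where "C = max 1 (nrm y)"
    have C: "0 < C" "nrm y \<le> C" by (auto simp: C_def)
    obtain q where q: "nrm (x - of_rat q) < e / C"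
      using rat_closureD x e C by (metis divide_pos_pos)
    \<comment> \<open>The approximation \<open>r\<close> is chosen after \<open>q\<close>, so its
      precision may depend on the norm of \<open>q\<close>. The maximum with 1 keeps the divisor
      positive.\<close>
    define D where "D = max 1 (nrm (of_rat q))"
    have D: "0 < D" "nrm (of_rat q) \<le> D" by (auto simp: D_def)
    obtain r where r: "nrm (y - of_rat r) < e / D"
      using rat_closureD y e D by (metis divide_pos_pos)
    have eq: "x * y - of_rat (q * r) = (x - of_rat q) * y + of_rat q * (y - of_rat r)"
      by (simp add: of_rat_mult algebra_simps)
    have "nrm ((x - of_rat q) * y) < e"
    proof -
      have "nrm ((x - of_rat q) * y) \<le> nrm (x - of_rat q) * C"
        using C by (intro nrm_mult_le) auto
      also have "\<dots> < e" using q C by (simp add: pos_less_divide_eq)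
      finally show ?thesis .
    qed
    moreover have "nrm (of_rat q * (y - of_rat r)) < e"
    proof -
      have "nrm (of_rat q * (y - of_rat r)) \<le> D * nrm (y - of_rat r)"
        using D by (intro nrm_mult_le) auto
      also have "\<dots> < e" using r D by (simp add: pos_less_divide_eq mult.commute)
      finally show ?thesis .
    qed
    ultimately show "\<exists>q. nrm (x * y - of_rat q) < e"
      unfolding eq[symmetric] using nrm_add_less eq by metis
  qed
  show "- x \<in> rat_closure nrm"
    unfolding rat_closure_iff'
  proof (intro allI impI)
    fix e :: real assume "0 < e"
    then obtain q where "nrm (x - of_rat q) < e"
      using rat_closureD x by metis
    then have "nrm (- x - of_rat (- q)) < e"
      using nrm_minus_commute[of x "of_rat q"] by (simp add: of_rat_minus)
    then show "\<exists>q. nrm (- x - of_rat q) < e" ..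
  qed
  show "inverse x \<in> rat_closure nrm" if "x \<noteq> 0"
    unfolding rat_closure_iff'
  proof (intro allI impI)
    fix e :: real assume e: "0 < e"
    have nx: "0 < nrm x" using that nrm_pos by blast
    \<comment> \<open>The first bound forces \<open>of_rat q\<close> to have the norm of
      \<open>x\<close>, which makes the denominator \<open>x * of_rat q\<close> known exactly; the
      second gives the precision.\<close>
    then have "0 < min (nrm x) (e * (nrm x * nrm x))" using e by simp
    then obtain q where q: "nrm (x - of_rat q) < min (nrm x) (e * (nrm x * nrm x))"
      using rat_closureD[OF x] by blast
    then have nq: "nrm (of_rat q) = nrm x"
      using nrm_eq_if_close[of "of_rat q" x] nrm_minus_commute[of x] by simp
    then have q0: "of_rat q \<noteq> (0::'b)" using nx by auto
    have "inverse x - of_rat (inverse q) = (of_rat q - x) / (x * of_rat q)"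
      using q0 that unfolding of_rat_inverse by (simp add: field_simps)
    then have "nrm (inverse x - of_rat (inverse q)) = nrm (x - of_rat q) / (nrm x * nrm x)"
      using nq by (simp add: nrm_divide nrm_mult nrm_minus_commute)
    also have "\<dots> < e" using q nx by (simp add: pos_divide_less_eq)
    finally show "\<exists>q. nrm (inverse x - of_rat q) < e" ..
  qed
qed

sublocale L: nonarch_subfield nrm "rat_closure nrm"
  by (rule nonarch_subfieldI[OF nonarch subfield_rat_closure])

lemma complete_rat_closure: "nrm_complete (rat_closure nrm)"
  using padic by (intro mcomplete_imp_nrm_complete) (simp add: padic_alg_closure_def)

lemma nrm_of_rat: "nrm (of_rat q) = padic_abs p q"
  using padic by (simp add: padic_alg_closure_def)

lemma nrm_of_rat_powi: "q \<noteq> 0 \<Longrightarrow> \<exists>m::int. nrm (of_rat q) = real p powi m"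
  unfolding nrm_of_rat padic_abs_def by (auto split: prod.splits)

text \<open>Passing to the closure adds no new norms: a rational closer to \<open>x\<close> than
  \<open>nrm x\<close> has the same norm as \<open>x\<close>.\<close>

lemma nrm_rat_closure:
  assumes "x \<in> rat_closure nrm" "x \<noteq> 0"
  shows "\<exists>m::int. nrm x = real p powi m"
proof -
  have "0 < nrm x" using assms nrm_pos by blast
  then obtain q where "nrm (x - of_rat q) < nrm x"
    using rat_closureD assms(1) by blast
  then have "nrm (of_rat q) = nrm x"
    using nrm_eq_if_close[of "of_rat q" x] nrm_minus_commute[of x] by simp
  moreover from this have "q \<noteq> 0" using \<open>0 < nrm x\<close> by auto
  ultimately show ?thesis using nrm_of_rat_powi by metis
qed

lemma nrm_p: "nrm (of_nat p) = inverse (real p)"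
proof -
  have "quotient_of (of_nat p) = (int p, 1)"
    using quotient_of_int[of "int p"] by simp
  moreover have "p \<noteq> 0" "\<not> is_unit p" "multiplicity (int p) (int p) = 1"
    using prime by (auto intro!: multiplicity_self simp: prime_gt_0_nat)
  ultimately have "padic_abs p (of_nat p) = inverse (real p)"
    by (simp add: padic_abs_def)
  then show ?thesis
    using nrm_of_rat[of "of_nat p"] by simp
qed

lemma nrm_2:
  assumes "odd p"
  shows "nrm 2 = 1"
proof -
  have "quotient_of 2 = (2, 1)"
    using quotient_of_int[of 2] by simp
  moreover have "multiplicity (int p) 2 = 0"
  proof (rule not_dvd_imp_multiplicity_0)
    show "\<not> int p dvd 2"
    proof
      assume "int p dvd 2"
      then have "p dvd 2" by presburger
      then have "p \<le> 2" by (rule dvd_imp_le) simp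
      then show False using assms prime_gt_1_nat[OF prime] by (cases "p = 2") auto
    qed
  qed
  ultimately have "padic_abs p 2 = 1"
    by (simp add: padic_abs_def)
  then show ?thesis
    using nrm_of_rat[of 2] by simp
qed

lemma finite_ext_complete: "finite_ext (rat_closure nrm) K \<Longrightarrow> nrm_complete K"
  unfolding finite_ext_def ring.finite_dimension_def[OF field.is_ring[OF field_field_on_UNIV]]
  using L.complete_dimension complete_rat_closure by blast

text \<open>The base field has only powers of \<open>p\<close> as nonzero norms, and the extension
  meets finitely many classes modulo these; \<open>p\<close> itself serves as the element of norm
  \<open>1 / p\<close>.\<close>

lemma finite_ext_uniformizer:
  assumes K: "finite_ext (rat_closure nrm) K"
  shows "\<exists>\<pi>. discretely_valued nrm K \<pi>"
proof -
  interpret K: nonarch_subfield nrm K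
    using K by (intro nonarch_subfieldI nonarch) (simp add: finite_ext_def)
  obtain n where "ring.dimension (field_on UNIV) n (rat_closure nrm) K"
    using K unfolding finite_ext_def ring.finite_dimension_def[OF field.is_ring[OF field_field_on_UNIV]]
    by blast
  from L.finite_norm_classes_dimension[OF this]
  obtain R where R: "finite R" "R \<subseteq> {0<..}"
    "\<forall>v\<in>K - {0}. \<exists>r\<in>R. \<exists>c\<in>rat_closure nrm - {0}. nrm v = r * nrm c"
    by (elim exE conjE)
  have "\<exists>\<pi>\<in>K. 0 < nrm \<pi> \<and> nrm \<pi> < 1 \<and> (\<forall>x\<in>K. nrm x < 1 \<longrightarrow> nrm x \<le> nrm \<pi>)"
  proof (rule K.exists_uniformizer[OF R(1,2)])
    fix x assume "x \<in> K" "x \<noteq> 0"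
    then obtain r c where "r \<in> R" "c \<in> rat_closure nrm" "c \<noteq> 0" "nrm x = r * nrm c"
      using R(3) by blast
    then show "\<exists>r\<in>R. \<exists>m::int. nrm x = r * real p powi m"
      using nrm_rat_closure by metis
  next
    show "1 < real p" using prime_gt_1_nat[OF prime] by simp
    show "of_nat p \<in> K"
      using K of_rat_in_rat_closure[of "of_nat p"] by (auto simp: finite_ext_def)
  qed (rule nrm_p)
  then obtain \<pi> where "\<pi> \<in> K" "0 < nrm \<pi>" "nrm \<pi> < 1" "\<forall>x\<in>K. nrm x < 1 \<longrightarrow> nrm x \<le> nrm \<pi>"
    by blast
  then show ?thesis
    using K.nonarch_subfield_axioms
    by (intro exI[of _ \<pi>] discretely_valued.intro discretely_valued_axioms.intro) auto
qed

end

text \<open>Adding a vector outside \<open>V\<close> parametrises the new space bijectively by pairs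
  from \<open>K\<close> and \<open>V\<close>, so the cardinality is multiplied by that of
  \<open>K\<close>.\<close>

lemma (in ring) card_dimension:
  assumes K: "subfield K R" and dim: "dimension n K V"
  shows "card V = card K ^ n"
  using dim
proof (induction n K\<equiv>K V rule: dimension.induct)
  case zero_dim
  show ?case by simp
next
  case (Suc_dim v V n)
  have IH: "card V = card K ^ n" using Suc_dim by simp
  note KR = subringE[OF subfieldE(1)[OF K]]
  have v: "v \<in> carrier R" "v \<notin> V" and "dimension n K V" using Suc_dim by simp_all
  note V = space_subgroup_props[OF K \<open>dimension n K V\<close>]
  have "line_extension K v V = (\<lambda>(c, u). c \<otimes> v \<oplus> u) ` (K \<times> V)"
    unfolding Set.set_eq_iff line_extension_mem_iff by auto
  moreover have "inj_on (\<lambda>(c, u). c \<otimes> v \<oplus> u) (K \<times> V)"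
  proof (rule inj_onI, clarify)
    fix c u c' u' assume *: "c \<in> K" "u \<in> V" "c' \<in> K" "u' \<in> V" "c \<otimes> v \<oplus> u = c' \<otimes> v \<oplus> u'"
    then have cs: "c \<in> carrier R" "c' \<in> carrier R" "u \<in> carrier R" "u' \<in> carrier R"
      using KR(1) V(1) by auto
    have "(c \<ominus> c') \<otimes> v = (c \<otimes> v \<oplus> u) \<ominus> (c' \<otimes> v \<oplus> u) "
      using cs v(1) by (simp add: l_distr a_minus_def l_minus minus_add a_ac r_neg1 r_neg2 r_neg)
    also have "\<dots> = u' \<ominus> u"
      unfolding *(5) using cs v(1) by (simp add: a_minus_def minus_add a_ac r_neg1 r_neg2 r_neg)
    also have "\<dots> \<in> V"
      using * V(3,4) by (simp add: a_minus_def)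
    finally have "(c \<ominus> c') \<otimes> v \<in> V" .
    moreover have "c \<ominus> c' \<in> K"
      using * KR(5,7) by (simp add: a_minus_def)
    ultimately have "c \<ominus> c' = \<zero>"
      using V(6)[of "c \<ominus> c'" v] v by auto
    then have "c = c'" using cs by simp
    then show "c = c' \<and> u = u'" using * cs v(1) by simp
  qed
  ultimately show ?case
    using IH by (simp add: card_image card_cartesian_product)
qed

text \<open>A finite field is spanned over \<open>K\<close> by the list of all its elements, hence
  has a finite dimension over \<open>K\<close>.\<close>

lemma (in field) card_subfield_power:
  assumes K: "subfield K R" and fin: "finite (carrier R)"
  shows "\<exists>n. card (carrier R) = card K ^ n"
proof -
  obtain us where us: "set us = carrier R"
    using finite_list[OF fin] by blast
  have "Span K us = carrier R"
    using Span_subgroup_props(1)[OF K, of us] Span_base_incl[OF K, of us] us by simp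
  then have "finite_dimension K (carrier R)"
    using Span_finite_dimension[OF K, of us] us by simp
  then show ?thesis
    using card_dimension[OF K] unfolding finite_dimension_def by blast
qed

section \<open>Weil groups\<close>

lemma galois_setE:
  assumes "g \<in> galois_set F"
  shows "bij g" "g (x + y) = g x + g y" "g (x * y) = g x * g y" "g 1 = 1" "x \<in> F \<Longrightarrow> g x = x"
  using assms unfolding galois_set_def ring_iso_def ring_hom_def by auto

lemma galois_setI:
  assumes "bij g" "\<And>x y. g (x + y) = g x + g y" "\<And>x y. g (x * y) = g x * g y" "g 1 = 1"
    "\<And>x. x \<in> F \<Longrightarrow> g x = x"
  shows "g \<in> galois_set F"
  using assms unfolding galois_set_def ring_iso_def ring_hom_def by auto

lemma galois_set_comp:
  assumes "g \<in> galois_set F" "h \<in> galois_set F"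
  shows "g \<circ> h \<in> galois_set F"
  by (rule galois_setI)
    (simp_all add: bij_comp galois_setE[OF assms(1)] galois_setE[OF assms(2)])

lemma galois_set_inv:
  assumes g: "g \<in> galois_set F"
  shows "inv_into UNIV g \<in> galois_set F"
proof (rule galois_setI)
  note gE = galois_setE[OF g]
  have inj: "inj g" and surj: "surj g" using gE(1) by (simp_all add: bij_def)
  show "bij (inv_into UNIV g)" using gE(1) by (rule bij_imp_bij_inv)
  show "inv_into UNIV g (x + y) = inv_into UNIV g x + inv_into UNIV g y" for x y
    by (rule inv_f_eq[OF inj]) (simp add: gE surj_f_inv_f[OF surj])
  show "inv_into UNIV g (x * y) = inv_into UNIV g x * inv_into UNIV g y" for x y
    by (rule inv_f_eq[OF inj]) (simp add: gE surj_f_inv_f[OF surj])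
  show "inv_into UNIV g 1 = 1"
    by (rule inv_f_eq[OF inj]) (simp add: gE)
  show "inv_into UNIV g x = x" if "x \<in> F" for x
    by (rule inv_f_eq[OF inj]) (simp add: gE that)
qed

section \<open>Frobenius powers and the Weil group as a group\<close>

context nonarch_field begin

text \<open>The automorphism acts on the residue field of the ambient field as the
  \<open>Q\<close>-th power map. \<open>Q\<close> is any natural number, so that factors of
  exponents can be multiplied and cancelled.\<close>

definition frob :: "nat \<Rightarrow> ('b \<Rightarrow> 'b) \<Rightarrow> bool" where
  "frob Q g \<longleftrightarrow> (\<forall>x. nrm x \<le> 1 \<longrightarrow> nrm (g x - x ^ Q) < 1)"

context
  fixes g :: "'b \<Rightarrow> 'b"
  assumes g: "g \<in> galois_set {}"
begin

lemma aut_0: "g 0 = 0"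
  using galois_setE(2)[OF g, of 0 0] by (metis add.right_neutral add_left_cancel)

lemma aut_diff: "g (x - y) = g x - g y"
  using galois_setE(2)[OF g, of "x - y" y] by simp

lemma aut_power: "g (x ^ n) = g x ^ n"
  by (induction n) (simp_all add: galois_setE[OF g])

text \<open>If \<open>nrm x > 1\<close>, then \<open>inverse x\<close> has norm below one, hence so
  does its image; but its product with the integral \<open>g x\<close> is 1.\<close>

lemma integral_if_preserved:
  assumes "\<And>x. nrm x < 1 \<Longrightarrow> nrm (g x) < 1" "nrm (g x) \<le> 1"
  shows "nrm x \<le> 1"
proof (rule ccontr)
  assume x: "\<not> nrm x \<le> 1"
  then have "x \<noteq> 0" by auto
  have "nrm (inverse x) < 1"
    using x by (simp add: nrm_inverse inverse_less_1_iff)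
  then have "nrm (g (inverse x)) < 1"
    by (rule assms(1))
  moreover have "g x * g (inverse x) = 1"
    using galois_setE(3)[OF g, of x "inverse x"] galois_setE(4)[OF g] \<open>x \<noteq> 0\<close> by simp
  ultimately show False
    using nrm_mult_less_1(1)[OF assms(2)] by fastforce
qed

text \<open>For \<open>Q = 0\<close> the condition at \<open>x = 0\<close> would say
  \<open>nrm (- 1) < 1\<close>, since \<open>0 ^ 0 = 1\<close>.\<close>

lemma frob_pos: "frob Q g \<Longrightarrow> 0 < Q"
  unfolding frob_def by (metis aut_0 diff_0 nrm_minus nrm_1 nrm_0 gr0I less_irrefl power_0 zero_le_one)

lemma frob_le: "frob Q g \<Longrightarrow> nrm x \<le> 1 \<Longrightarrow> nrm (g x) \<le> 1"
  using nrm_add_le[of "g x - x ^ Q" 1 "x ^ Q"] unfolding frob_def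
  by (simp add: less_imp_le nrm_power power_le_one)

lemma frob_less: "frob Q g \<Longrightarrow> nrm x < 1 \<Longrightarrow> nrm (g x) < 1"
  using nrm_add_less[of "g x - x ^ Q" 1 "x ^ Q"] frob_pos[of Q] unfolding frob_def
  by (simp add: nrm_power power_less_one_iff)

lemma frob_inv_le: "frob Q g \<Longrightarrow> nrm x \<le> 1 \<Longrightarrow> nrm (inv_into UNIV g x) \<le> 1"
  using integral_if_preserved[of "inv_into UNIV g x"] frob_less galois_setE(1)[OF g]
  by (metis bij_inv_eq_iff)

end

text \<open>Substituting \<open>g x\<close> for \<open>x\<close> is legitimate once \<open>g\<close>
  and its inverse preserve integrality. This identifies the second disjunct in
  \<open>weil_set\<close> with a Frobenius condition on the inverse.\<close>

lemma frob_inv_iff: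
  assumes g: "g \<in> galois_set {}"
  shows "frob Q (inv_into UNIV g) \<longleftrightarrow> (\<forall>x. nrm x \<le> 1 \<longrightarrow> nrm (g x ^ Q - x) < 1)"
proof
  have surj: "g (inv_into UNIV g x) = x" and inj: "inv_into UNIV g (g x) = x" for x
    using galois_setE(1)[OF g] by (simp_all add: bij_inv_eq_iff[symmetric] bij_def)
  show "\<forall>x. nrm x \<le> 1 \<longrightarrow> nrm (g x ^ Q - x) < 1" if f: "frob Q (inv_into UNIV g)"
  proof (intro allI impI)
    fix x assume x: "nrm x \<le> 1"
    have "nrm (g x) \<le> 1"
      using frob_inv_le[OF galois_set_inv[OF g] f x] galois_setE(1)[OF g] by (simp add: inv_inv_eq)
    then show "nrm (g x ^ Q - x) < 1"
      using f nrm_minus_commute unfolding frob_def by (metis inj)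
  qed
  assume *: "\<forall>x. nrm x \<le> 1 \<longrightarrow> nrm (g x ^ Q - x) < 1"
  have "Q \<noteq> 0"
    using *[rule_format, of 0] by (intro notI) (simp add: aut_0[OF g])
  have "nrm (g x) < 1" if "nrm x < 1" for x
  proof -
    have "nrm (g x ^ Q) < 1"
      using nrm_add_less[of "g x ^ Q - x" 1 x] * that by simp
    then show ?thesis
      using \<open>Q \<noteq> 0\<close> by (simp add: nrm_power power_less_one_iff)
  qed
  then have "nrm (inv_into UNIV g x) \<le> 1" if "nrm x \<le> 1" for x
    using integral_if_preserved[OF g, of "inv_into UNIV g x"] that surj by metis
  then show "frob Q (inv_into UNIV g)"
    using * nrm_minus_commute unfolding frob_def by (metis surj)
qed

lemma weil_set_iff:
  "g \<in> weil_set nrm F \<longleftrightarrow> g \<in> galois_set F \<and>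
     (\<exists>n. frob (card (carrier (residue_field nrm F)) ^ n) g \<or>
          frob (card (carrier (residue_field nrm F)) ^ n) (inv_into UNIV g))"
proof -
  have "g \<in> galois_set {}" if "g \<in> galois_set F"
    using that by (auto simp: galois_set_def)
  then show ?thesis
    unfolding weil_set_def Let_def
    using frob_inv_iff[of g] by (auto simp: frob_def)
qed

lemma frob_comp:
  assumes "g \<in> galois_set {}" "h \<in> galois_set {}" "frob Q g" "frob Q' h"
  shows "frob (Q' * Q) (g \<circ> h)"
  unfolding frob_def
proof (intro allI impI)
  fix x assume x: "nrm x \<le> 1"
  then have hx: "nrm (h x) \<le> 1" by (rule frob_le[OF assms(2,4)])
  have "nrm (g (h x) - h x ^ Q) < 1"
    using assms(3) hx by (simp add: frob_def)
  moreover have "nrm (h x ^ Q - (x ^ Q') ^ Q) < 1"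
    using assms(4) x hx by (intro nrm_power_diff_less) (auto simp: frob_def nrm_power power_le_one)
  ultimately show "nrm ((g \<circ> h) x - x ^ (Q' * Q)) < 1"
    using nrm_trans_less by (simp add: power_mult)
qed

text \<open>Composing with the inverse of a \<open>Q\<close>-power map cancels the factor
  \<open>Q\<close>: modulo elements of norm below one, the \<open>Q\<close>-th power of the inverse
  image of \<open>x\<close> is \<open>x\<close>.\<close>

lemma frob_comp_inv:
  assumes "g \<in> galois_set {}" "h \<in> galois_set {}" "frob (Q * R) g" "frob Q h"
  shows "frob R (g \<circ> inv_into UNIV h)" "frob R (inv_into UNIV h \<circ> g)"
proof -
  let ?h = "inv_into UNIV h"
  have surj: "h (?h x) = x" and inj: "?h (h x) = x" for x
    using galois_setE(1)[OF assms(2)] by (simp_all add: bij_def surj_f_inv_f)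
  have hx: "nrm (?h x) \<le> 1" if "nrm x \<le> 1" for x
    using frob_inv_le[OF assms(2,4) that] .
  have pow: "nrm (?h x ^ (Q * R) - x ^ R) < 1" if "nrm x \<le> 1" for x
  proof -
    have "nrm (x - ?h x ^ Q) < 1"
      using assms(4) hx[OF that] surj unfolding frob_def by metis
    then have "nrm (x ^ R - (?h x ^ Q) ^ R) < 1"
      using that hx[OF that] by (intro nrm_power_diff_less) (auto simp: nrm_power power_le_one)
    then show ?thesis
      by (simp add: power_mult nrm_minus_commute)
  qed
  show "frob R (g \<circ> ?h)"
    unfolding frob_def
  proof (intro allI impI)
    fix x assume x: "nrm x \<le> 1"
    have "nrm (g (?h x) - ?h x ^ (Q * R)) < 1"
      using assms(3) hx[OF x] unfolding frob_def by blast
    then show "nrm ((g \<circ> ?h) x - x ^ R) < 1"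
      using nrm_trans_less[OF _ pow[OF x]] by simp
  qed
  have h: "?h \<in> galois_set {}" by (rule galois_set_inv[OF assms(2)])
  show "frob R (?h \<circ> g)"
    unfolding frob_def
  proof (intro allI impI)
    fix x assume x: "nrm x \<le> 1"
    \<comment> \<open>If the preimage had norm one, so would its \<open>Q\<close>-th power, and
      therefore its image \<open>y\<close>, which is close to that power.\<close>
    have less: "nrm (?h y) < 1" if "nrm y < 1" for y
    proof (rule ccontr)
      assume *: "\<not> nrm (?h y) < 1"
      then have "nrm (?h y) = 1" using hx[of y] that by simp
      moreover have "nrm (h (?h y) - ?h y ^ Q) < 1"
        using assms(4) hx[of y] that unfolding frob_def by simp
      ultimately have "nrm (h (?h y)) = 1"
        using nrm_eq_if_close[of "h (?h y)" "?h y ^ Q"] by (simp add: nrm_power)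
      then show False using that surj by simp
    qed
    have "nrm (?h (g x - x ^ (Q * R))) < 1"
      using assms(3) x unfolding frob_def by (intro less) blast
    then have "nrm (?h (g x) - ?h x ^ (Q * R)) < 1"
      by (simp add: aut_diff[OF h] aut_power[OF h])
    then show "nrm ((?h \<circ> g) x - x ^ R) < 1"
      using nrm_trans_less[OF _ pow[OF x]] by simp
  qed
qed

lemma weil_set_galois: "g \<in> weil_set nrm F \<Longrightarrow> g \<in> galois_set F"
  by (simp add: weil_set_iff)

lemma weil_set_inv: "g \<in> weil_set nrm F \<Longrightarrow> inv_into UNIV g \<in> weil_set nrm F"
  unfolding weil_set_iff using galois_set_inv[of g F] galois_setE(1)[of g F]
  by (metis inv_inv_eq)

lemma weil_set_id: "id \<in> weil_set nrm F"
proof -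
  have "frob 1 id" by (simp add: frob_def)
  moreover have "id \<in> galois_set F" by (rule galois_setI) auto
  ultimately show ?thesis unfolding weil_set_iff by (metis power_0)
qed

text \<open>Frobenius exponents add. With opposite signs the smaller one is cancelled from the
  larger, and the sign of the difference decides whether the product or its inverse is a power of
  Frobenius.\<close>

lemma weil_set_comp:
  assumes g: "g \<in> weil_set nrm F" and h: "h \<in> weil_set nrm F"
  shows "g \<circ> h \<in> weil_set nrm F"
proof -
  define q where "q = card (carrier (residue_field nrm F))"
  let ?i = "inv_into UNIV"
  have G: "g \<in> galois_set F" "h \<in> galois_set F"
    using g h by (simp_all add: weil_set_iff)
  then have G0: "g \<in> galois_set {}" "h \<in> galois_set {}"
    by (auto simp: galois_set_def)
  then have G0i: "?i g \<in> galois_set {}" "?i h \<in> galois_set {}"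
    by (auto intro: galois_set_inv)
  have ii: "?i (?i g) = g" "?i (?i h) = h" "?i (g \<circ> h) = ?i h \<circ> ?i g"
    using galois_setE(1)[OF G(1)] galois_setE(1)[OF G(2)] by (simp_all add: inv_inv_eq o_inv_distrib)
  obtain m n where mn: "frob (q ^ m) g \<or> frob (q ^ m) (?i g)" "frob (q ^ n) h \<or> frob (q ^ n) (?i h)"
    using g h unfolding weil_set_iff q_def by blast
  have "\<exists>n. frob (q ^ n) (g \<circ> h) \<or> frob (q ^ n) (?i (g \<circ> h))"
  proof (cases "frob (q ^ m) g"; cases "frob (q ^ n) h")
    assume "frob (q ^ m) g" "frob (q ^ n) h"
    then show ?thesis
      using frob_comp[OF G0] by (metis power_add)
  next
    assume "\<not> frob (q ^ m) g" "\<not> frob (q ^ n) h"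
    then have "frob (q ^ n * q ^ m) (?i h \<circ> ?i g) \<or> frob (q ^ m * q ^ n) (?i h \<circ> ?i g)"
      using mn frob_comp[OF G0i(2,1)] by blast
    then show ?thesis
      unfolding ii by (metis power_add)
  next
    assume *: "frob (q ^ m) g" "\<not> frob (q ^ n) h"
    then have "frob (q ^ n) (?i h)" using mn by simp
    show ?thesis
    proof (cases "n \<le> m")
      case True
      then have "q ^ m = q ^ n * q ^ (m - n)" by (simp flip: power_add)
      then show ?thesis
        using frob_comp_inv(1)[OF G0(1) G0i(2), of "q ^ n" "q ^ (m - n)"] * \<open>frob (q ^ n) (?i h)\<close>
        unfolding ii by auto
    next
      case False
      then have "q ^ n = q ^ m * q ^ (n - m)" by (simp flip: power_add)
      then show ?thesis
        using frob_comp_inv(1)[OF G0i(2) G0(1), of "q ^ m" "q ^ (n - m)"] * \<open>frob (q ^ n) (?i h)\<close>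
        unfolding ii by auto
    qed
  next
    assume *: "\<not> frob (q ^ m) g" "frob (q ^ n) h"
    then have "frob (q ^ m) (?i g)" using mn by simp
    show ?thesis
    proof (cases "n \<le> m")
      case True
      then have "q ^ m = q ^ n * q ^ (m - n)" by (simp flip: power_add)
      then show ?thesis
        using frob_comp_inv(2)[OF G0i(1) G0(2), of "q ^ n" "q ^ (m - n)"] * \<open>frob (q ^ m) (?i g)\<close>
        unfolding ii by auto
    next
      case False
      then have "q ^ n = q ^ m * q ^ (n - m)" by (simp flip: power_add)
      then show ?thesis
        using frob_comp_inv(2)[OF G0(2) G0i(1), of "q ^ m" "q ^ (n - m)"] * \<open>frob (q ^ m) (?i g)\<close>
        unfolding ii by auto
    qed
  qed
  then show ?thesis
    using galois_set_comp[OF G] unfolding weil_set_iff q_def by blast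
qed

text \<open>The image \<open>I\<close> of the integers of \<open>F\<close> is a subfield of the
  residue field of \<open>E\<close>, in bijection with the residue field of \<open>F\<close>; a
  finite field has the cardinality of a power of any subfield.\<close>

lemma card_residue_field_ext:
  assumes F: "subfield F (field_on UNIV)" and E: "subfield E (field_on UNIV)" and "F \<subseteq> E"
    and fin: "finite (carrier (residue_field nrm E))"
  shows "\<exists>n. card (carrier (residue_field nrm E)) = card (carrier (residue_field nrm F)) ^ n"
proof -
  interpret F: nonarch_subfield nrm F by (rule nonarch_subfieldI[OF nonarch F])
  interpret E: nonarch_subfield nrm E by (rule nonarch_subfieldI[OF nonarch E])
  interpret kE: field E.k by (rule E.field_k)
  define I where "I = E.red ` {x \<in> F. nrm x \<le> 1}"
  have FE: "x \<in> F \<Longrightarrow> x \<in> E" for x using \<open>F \<subseteq> E\<close> by blast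
  have "subfield I E.k"
  proof (rule kE.subfieldI')
    have "\<ominus>\<^bsub>E.k\<^esub> E.red x = E.red (- x)" if "x \<in> E" "nrm x \<le> 1" for x
      by (rule kE.minus_equality) (use that in \<open>simp_all add: E.red_add E.red_0\<close>)
    then show "subring I E.k"
      by (intro kE.subringI)
        (auto simp: I_def FE E.red_mult E.red_add E.red_1 nrm_mult_le_1 nrm_add_le intro!: imageI)
    fix y assume "y \<in> I - {\<zero>\<^bsub>E.k\<^esub>}"
    then obtain x where x: "x \<in> F" "nrm x \<le> 1" "y = E.red x" "E.red x \<noteq> E.red 0"
      by (auto simp: I_def E.red_0)
    then have "nrm x = 1"
      using E.red_eq_iff[of x 0] FE by auto
    moreover from this have "x \<noteq> 0" by auto
    ultimately have "inv\<^bsub>E.k\<^esub> y = E.red (inverse x)"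
      using x FE by (intro kE.inv_char) (simp_all add: E.red_mult E.red_1 nrm_inverse)
    then show "inv\<^bsub>E.k\<^esub> y \<in> I"
      using x \<open>nrm x = 1\<close> by (auto simp: I_def nrm_inverse intro!: imageI)
  qed
  moreover have "card (carrier F.k) = card I"
  proof -
    have F: "carrier F.k = F.red ` {x \<in> F. nrm x \<le> 1}"
    proof (rule Set.equalityI; rule subsetI)
      fix c assume "c \<in> carrier F.k"
      then obtain x where "x \<in> F" "nrm x \<le> 1" "c = F.red x"
        using F.carrier_kE by metis
      then show "c \<in> F.red ` {x \<in> F. nrm x \<le> 1}" by simp
    next
      fix c assume "c \<in> F.red ` {x \<in> F. nrm x \<le> 1}"
      then show "c \<in> carrier F.k"
        by (elim imageE) simp
    qed
    have eq: "E.red x = E.red y \<longleftrightarrow> F.red x = F.red y"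
      if "x \<in> F" "nrm x \<le> 1" "y \<in> F" "nrm y \<le> 1" for x y
      using that FE by (simp add: E.red_eq_iff F.red_eq_iff)
    have "bij_betw (\<lambda>c. E.red (SOME x. x \<in> F \<and> nrm x \<le> 1 \<and> F.red x = c)) (carrier F.k) I"
    proof -
      let ?s = "\<lambda>c. SOME x. x \<in> F \<and> nrm x \<le> 1 \<and> F.red x = c"
      have s: "?s c \<in> F \<and> nrm (?s c) \<le> 1 \<and> F.red (?s c) = c" if "c \<in> carrier F.k" for c
        by (rule someI_ex) (use F.carrier_kE[OF that] in metis)
      show ?thesis
      proof (rule bij_betwI')
        show "E.red (?s c) = E.red (?s c') \<longleftrightarrow> c = c'" if "c \<in> carrier F.k" "c' \<in> carrier F.k" for c c'
          using eq[of "?s c" "?s c'"] s[OF that(1)] s[OF that(2)] by simp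
        show "E.red (?s c) \<in> I" if "c \<in> carrier F.k" for c
          using s[OF that] by (auto simp: I_def)
        show "\<exists>c\<in>carrier F.k. y = E.red (?s c)" if y: "y \<in> I" for y
        proof -
          obtain x where x: "x \<in> F" "nrm x \<le> 1" "y = E.red x"
            using y by (auto simp: I_def)
          then have "F.red x \<in> carrier F.k" by simp
          moreover have "y = E.red (?s (F.red x))"
            using eq[of x "?s (F.red x)"] s[OF calculation] x by simp
          ultimately show ?thesis ..
        qed
      qed
    qed
    then show ?thesis by (rule bij_betw_same_card)
  qed
  ultimately show ?thesis
    using kE.card_subfield_power[OF _ fin] by simp
qed

lemma weil_set_mono:
  assumes "subfield F (field_on UNIV)" "subfield E (field_on UNIV)" "F \<subseteq> E"
  shows "weil_set nrm E \<subseteq> weil_set nrm F"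
proof
  fix g assume g: "g \<in> weil_set nrm E"
  define q where "q = card (carrier (residue_field nrm F))"
  define r where "r = card (carrier (residue_field nrm E))"
  have E: "g \<in> galois_set E" using g by (simp add: weil_set_iff)
  then have F: "g \<in> galois_set F" and G: "g \<in> galois_set {}"
    using \<open>F \<subseteq> E\<close> by (auto simp: galois_set_def)
  obtain n where n: "frob (r ^ n) g \<or> frob (r ^ n) (inv_into UNIV g)"
    using g unfolding weil_set_iff r_def by blast
  then have "0 < r ^ n"
    using frob_pos[OF G] frob_pos[OF galois_set_inv[OF G]] by blast
  have "\<exists>m. r ^ n = q ^ m"
  proof (cases "r = 0")
    \<comment> \<open>An infinite residue field has \<open>card\<close> equal to 0. Positivity of
      \<open>r ^ n\<close> then leaves \<open>n = 0\<close>, where both powers are 1.\<close>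
    case True
    then have "n = 0" using \<open>0 < r ^ n\<close> by (simp add: power_0_left split: if_splits)
    then show ?thesis by (intro exI[of _ 0]) simp
  next
    case False
    then have "finite (carrier (residue_field nrm E))"
      unfolding r_def by (metis card.infinite)
    then obtain k where "r = q ^ k"
      using card_residue_field_ext[OF assms] unfolding q_def r_def by blast
    then show ?thesis by (intro exI[of _ "k * n"]) (simp add: power_mult)
  qed
  then show "g \<in> weil_set nrm F"
    using n F unfolding weil_set_iff q_def by metis
qed

end

section \<open>Two-dimensional representations over a residue field\<close>

lemma mat2_nth [simp]:
  "mat2 a b c d $ 1 $ 1 = a" "mat2 a b c d $ 1 $ 2 = b"
  "mat2 a b c d $ 2 $ 1 = c" "mat2 a b c d $ 2 $ 2 = d"
  by (simp_all add: mat2_def)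

lemma mat2_eqI:
  fixes A B :: "'c mat2"
  assumes "A $ 1 $ 1 = B $ 1 $ 1" "A $ 1 $ 2 = B $ 1 $ 2" "A $ 2 $ 1 = B $ 2 $ 1" "A $ 2 $ 2 = B $ 2 $ 2"
  shows "A = B"
  using assms by (simp add: vec_eq_iff forall_2)

lemma mat2_collapse:
  fixes A :: "'c mat2"
  shows "mat2 (A $ 1 $ 1) (A $ 1 $ 2) (A $ 2 $ 1) (A $ 2 $ 2) = A"
  by (rule mat2_eqI) simp_all

lemma mat2_eq_iff [simp]: "mat2 a b c d = mat2 a' b' c' d' \<longleftrightarrow> a = a' \<and> b = b' \<and> c = c' \<and> d = d'"
  by (metis mat2_nth)

lemma map_mat2_mat2 [simp]: "map_mat2 f (mat2 a b c d) = mat2 (f a) (f b) (f c) (f d)"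
  by (rule mat2_eqI) (simp_all add: map_mat2_def)

lemma map_mat2_nth [simp]:
  fixes A :: "'c mat2"
  shows "map_mat2 f A $ i $ j = f (A $ i $ j)"
  by (simp add: map_mat2_def)

definition vec2 :: "'c \<Rightarrow> 'c \<Rightarrow> 'c^2" where
  "vec2 x y = (\<chi> i. if i = 1 then x else y)"

lemma vec2_nth [simp]: "vec2 x y $ 1 = x" "vec2 x y $ 2 = y"
  by (simp_all add: vec2_def)

lemma vec2_eq_iff [simp]: "vec2 x y = vec2 x' y' \<longleftrightarrow> x = x' \<and> y = y'"
  by (metis vec2_nth)

lemma vec2_cases:
  fixes v :: "'c^2"
  obtains x y where "v = vec2 x y"
  using that[of "v $ 1" "v $ 2"] by (simp add: vec_eq_iff forall_2)

lemma mat2_cases: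
  fixes A :: "'c mat2"
  obtains a b c d where "A = mat2 a b c d"
  using mat2_collapse[of A] by metis

lemma mat2_monoid_mult [simp]:
  "mat2 a b c d \<otimes>\<^bsub>mat2_monoid R\<^esub> mat2 a' b' c' d' =
     mat2 (a \<otimes>\<^bsub>R\<^esub> a' \<oplus>\<^bsub>R\<^esub> b \<otimes>\<^bsub>R\<^esub> c') (a \<otimes>\<^bsub>R\<^esub> b' \<oplus>\<^bsub>R\<^esub> b \<otimes>\<^bsub>R\<^esub> d')
       (c \<otimes>\<^bsub>R\<^esub> a' \<oplus>\<^bsub>R\<^esub> d \<otimes>\<^bsub>R\<^esub> c') (c \<otimes>\<^bsub>R\<^esub> b' \<oplus>\<^bsub>R\<^esub> d \<otimes>\<^bsub>R\<^esub> d')"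
  by (rule mat2_eqI) (simp_all add: mat2_monoid_def)

lemma mat2_monoid_one: "\<one>\<^bsub>mat2_monoid R\<^esub> = mat2 \<one>\<^bsub>R\<^esub> \<zero>\<^bsub>R\<^esub> \<zero>\<^bsub>R\<^esub> \<one>\<^bsub>R\<^esub>"
  by (simp add: mat2_monoid_def)

lemma mat2_carrier [simp]:
  "mat2 a b c d \<in> carrier (mat2_monoid R) \<longleftrightarrow>
     a \<in> carrier R \<and> b \<in> carrier R \<and> c \<in> carrier R \<and> d \<in> carrier R"
  by (auto simp: mat2_monoid_def forall_2)

lemma mat2_act_simp [simp]:
  "mat2_act R (mat2 a b c d) (vec2 x y) =
     vec2 (a \<otimes>\<^bsub>R\<^esub> x \<oplus>\<^bsub>R\<^esub> b \<otimes>\<^bsub>R\<^esub> y) (c \<otimes>\<^bsub>R\<^esub> x \<oplus>\<^bsub>R\<^esub> d \<otimes>\<^bsub>R\<^esub> y)"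
  by (simp add: mat2_act_def vec_eq_iff forall_2)

lemma vec2_module_simps [simp]:
  "vec2 x y \<in> carrier (vec2_module R) \<longleftrightarrow> x \<in> carrier R \<and> y \<in> carrier R"
  "\<zero>\<^bsub>vec2_module R\<^esub> = vec2 \<zero>\<^bsub>R\<^esub> \<zero>\<^bsub>R\<^esub>"
  "vec2 x y \<oplus>\<^bsub>vec2_module R\<^esub> vec2 x' y' = vec2 (x \<oplus>\<^bsub>R\<^esub> x') (y \<oplus>\<^bsub>R\<^esub> y')"
  "c \<odot>\<^bsub>vec2_module R\<^esub> vec2 x y = vec2 (c \<otimes>\<^bsub>R\<^esub> x) (c \<otimes>\<^bsub>R\<^esub> y)"
  by (auto simp: vec2_module_def vec_eq_iff forall_2)

lemma carrier_GL2 [simp]: "carrier (GL2 R) = Units (mat2_monoid R)"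
  by (simp add: GL2_def units_of_def)

lemma mat2_carrier_cases:
  assumes "A \<in> carrier (mat2_monoid R)"
  obtains a b c d where "A = mat2 a b c d" "a \<in> carrier R" "b \<in> carrier R" "c \<in> carrier R" "d \<in> carrier R"
  using assms by (cases A rule: mat2_cases) (simp add: that)

lemma vec2_carrier_cases:
  assumes "v \<in> carrier (vec2_module R)"
  obtains x y where "v = vec2 x y" "x \<in> carrier R" "y \<in> carrier R"
  using assms by (cases v rule: vec2_cases) (simp add: that)

lemma (in cring) monoid_mat2: "Group.monoid (mat2_monoid R)"
proof (rule monoidI)
  fix A B C assume "A \<in> carrier (mat2_monoid R)" "B \<in> carrier (mat2_monoid R)" "C \<in> carrier (mat2_monoid R)"
  then show "A \<otimes>\<^bsub>mat2_monoid R\<^esub> B \<otimes>\<^bsub>mat2_monoid R\<^esub> C = A \<otimes>\<^bsub>mat2_monoid R\<^esub> (B \<otimes>\<^bsub>mat2_monoid R\<^esub> C)"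
    by (elim mat2_carrier_cases) (simp add: l_distr r_distr m_assoc a_ac)
qed (auto elim!: mat2_carrier_cases simp: mat2_monoid_one)

lemma (in cring) module_vec2: "module R (vec2_module R)"
proof (rule moduleI)
  show "abelian_group (vec2_module R)"
  proof (rule abelian_groupI)
    fix v assume "v \<in> carrier (vec2_module R)"
    then obtain x y where "v = vec2 x y" "x \<in> carrier R" "y \<in> carrier R"
      by (rule vec2_carrier_cases)
    then show "\<exists>w\<in>carrier (vec2_module R). w \<oplus>\<^bsub>vec2_module R\<^esub> v = \<zero>\<^bsub>vec2_module R\<^esub>"
      by (intro bexI[of _ "vec2 (\<ominus> x) (\<ominus> y)"]) (simp_all add: l_neg)
  qed (auto elim!: vec2_carrier_cases simp: a_ac)
qed (auto elim!: vec2_carrier_cases simp: is_cring l_distr r_distr m_assoc)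

context cring begin

lemma submodule_vec2I:
  assumes "H \<subseteq> carrier (vec2_module R)" "vec2 \<zero> \<zero> \<in> H"
    "\<And>v w. v \<in> H \<Longrightarrow> w \<in> H \<Longrightarrow> v \<oplus>\<^bsub>vec2_module R\<^esub> w \<in> H"
    "\<And>c v. c \<in> carrier R \<Longrightarrow> v \<in> H \<Longrightarrow> c \<odot>\<^bsub>vec2_module R\<^esub> v \<in> H"
  shows "submodule H R (vec2_module R)"
proof -
  interpret M: module R "vec2_module R" by (rule module_vec2)
  show ?thesis
  proof (rule M.submoduleI)
    fix v assume v: "v \<in> H"
    then have "v \<in> carrier (vec2_module R)" using assms(1) by blast
    then have "\<ominus>\<^bsub>vec2_module R\<^esub> v = (\<ominus> \<one>) \<odot>\<^bsub>vec2_module R\<^esub> v"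
      using M.smult_l_minus[of \<one> v] by simp
    then show "\<ominus>\<^bsub>vec2_module R\<^esub> v \<in> H"
      using assms(4)[OF _ v] by simp
  qed (use assms in auto)
qed

lemma mat2_act_closed:
  "A \<in> carrier (mat2_monoid R) \<Longrightarrow> v \<in> carrier (vec2_module R) \<Longrightarrow>
     mat2_act R A v \<in> carrier (vec2_module R)"
  by (elim mat2_carrier_cases vec2_carrier_cases) simp

lemma mat2_act_mult:
  "A \<in> carrier (mat2_monoid R) \<Longrightarrow> B \<in> carrier (mat2_monoid R) \<Longrightarrow> v \<in> carrier (vec2_module R) \<Longrightarrow>
     mat2_act R (A \<otimes>\<^bsub>mat2_monoid R\<^esub> B) v = mat2_act R A (mat2_act R B v)"
  by (elim mat2_carrier_cases vec2_carrier_cases) (simp add: l_distr r_distr m_assoc a_ac)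

lemma mat2_act_one: "v \<in> carrier (vec2_module R) \<Longrightarrow> mat2_act R \<one>\<^bsub>mat2_monoid R\<^esub> v = v"
  by (elim vec2_carrier_cases) (simp add: mat2_monoid_one)

lemma mat2_act_add:
  "A \<in> carrier (mat2_monoid R) \<Longrightarrow> v \<in> carrier (vec2_module R) \<Longrightarrow> w \<in> carrier (vec2_module R) \<Longrightarrow>
     mat2_act R A (v \<oplus>\<^bsub>vec2_module R\<^esub> w) = mat2_act R A v \<oplus>\<^bsub>vec2_module R\<^esub> mat2_act R A w"
  by (elim mat2_carrier_cases vec2_carrier_cases) (simp add: r_distr a_ac)

lemma mat2_act_smult:
  "A \<in> carrier (mat2_monoid R) \<Longrightarrow> v \<in> carrier (vec2_module R) \<Longrightarrow> c \<in> carrier R \<Longrightarrow>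
     mat2_act R A (c \<odot>\<^bsub>vec2_module R\<^esub> v) = c \<odot>\<^bsub>vec2_module R\<^esub> mat2_act R A v"
  by (elim mat2_carrier_cases vec2_carrier_cases) (simp add: r_distr m_lcomm)

lemma mat2_act_zero:
  "A \<in> carrier (mat2_monoid R) \<Longrightarrow> mat2_act R A (vec2 \<zero> \<zero>) = vec2 \<zero> \<zero>"
  by (elim mat2_carrier_cases) simp

text \<open>Isomorphism is reduced to an intertwining identity, in which no inverse matrix
  occurs.\<close>

lemma isomorphic_repsI:
  assumes P: "P \<in> Units (mat2_monoid R)"
    and r: "\<And>g. g \<in> G \<Longrightarrow> r g \<in> carrier (mat2_monoid R)"
    and eq: "\<And>g. g \<in> G \<Longrightarrow> r g \<otimes>\<^bsub>mat2_monoid R\<^esub> P = P \<otimes>\<^bsub>mat2_monoid R\<^esub> r' g"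
  shows "isomorphic_reps R G r r'"
proof -
  interpret M: Group.monoid "mat2_monoid R" by (rule monoid_mat2)
  have "r g = conj_mat2 R P (r' g)" if "g \<in> G" for g
    unfolding conj_mat2_def eq[OF that, symmetric]
    using P r[OF that] M.Units_closed[OF P] by (simp add: M.m_assoc)
  then show ?thesis
    unfolding isomorphic_reps_def using P by auto
qed

lemma isomorphic_repsE:
  assumes "isomorphic_reps R G r r'" and r': "\<And>g. g \<in> G \<Longrightarrow> r' g \<in> carrier (mat2_monoid R)"
  obtains P Q where "P \<in> carrier (mat2_monoid R)" "Q \<in> carrier (mat2_monoid R)"
    "P \<otimes>\<^bsub>mat2_monoid R\<^esub> Q = \<one>\<^bsub>mat2_monoid R\<^esub>" "Q \<otimes>\<^bsub>mat2_monoid R\<^esub> P = \<one>\<^bsub>mat2_monoid R\<^esub>"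
    "\<And>g. g \<in> G \<Longrightarrow> r g \<in> carrier (mat2_monoid R)"
    "\<And>g. g \<in> G \<Longrightarrow> r g \<otimes>\<^bsub>mat2_monoid R\<^esub> P = P \<otimes>\<^bsub>mat2_monoid R\<^esub> r' g"
proof -
  interpret M: Group.monoid "mat2_monoid R" by (rule monoid_mat2)
  obtain P where P: "P \<in> Units (mat2_monoid R)" "\<And>g. g \<in> G \<Longrightarrow> r g = conj_mat2 R P (r' g)"
    using assms(1) unfolding isomorphic_reps_def by auto
  show thesis
  proof (rule that[of P "inv\<^bsub>mat2_monoid R\<^esub> P"])
    fix g assume g: "g \<in> G"
    show "r g \<in> carrier (mat2_monoid R)" "r g \<otimes>\<^bsub>mat2_monoid R\<^esub> P = P \<otimes>\<^bsub>mat2_monoid R\<^esub> r' g"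
      using P(1) P(2)[OF g] r'[OF g] M.Units_closed[OF P(1)] by (simp_all add: conj_mat2_def M.m_assoc)
  qed (use P M.Units_closed in simp_all)
qed

lemma act_inverse:
  assumes "P \<in> carrier (mat2_monoid R)" "Q \<in> carrier (mat2_monoid R)"
    "P \<otimes>\<^bsub>mat2_monoid R\<^esub> Q = \<one>\<^bsub>mat2_monoid R\<^esub>" "v \<in> carrier (vec2_module R)"
  shows "mat2_act R P (mat2_act R Q v) = v"
  using assms mat2_act_mult[of P Q v] by (simp add: mat2_act_one)

text \<open>The preimage of an invariant \<open>S\<close> under the intertwiner \<open>P\<close> is
  invariant for \<open>r'\<close>. As \<open>P\<close> is invertible, a trivial or full preimage
  forces the same for \<open>S\<close>.\<close>

lemma irreducible_rep_iso:
  assumes iso: "isomorphic_reps R G r r'" and r': "\<And>g. g \<in> G \<Longrightarrow> r' g \<in> carrier (mat2_monoid R)"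
    and irr: "irreducible_rep R G r'"
  shows "irreducible_rep R G r"
  unfolding irreducible_rep_def
proof (intro allI impI)
  interpret M: module R "vec2_module R" by (rule module_vec2)
  obtain P Q where P: "P \<in> carrier (mat2_monoid R)" and Q: "Q \<in> carrier (mat2_monoid R)"
    and PQ: "P \<otimes>\<^bsub>mat2_monoid R\<^esub> Q = \<one>\<^bsub>mat2_monoid R\<^esub>"
    and QP: "Q \<otimes>\<^bsub>mat2_monoid R\<^esub> P = \<one>\<^bsub>mat2_monoid R\<^esub>"
    and r: "\<And>g. g \<in> G \<Longrightarrow> r g \<in> carrier (mat2_monoid R)"
    and eq: "\<And>g. g \<in> G \<Longrightarrow> r g \<otimes>\<^bsub>mat2_monoid R\<^esub> P = P \<otimes>\<^bsub>mat2_monoid R\<^esub> r' g"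
    using isomorphic_repsE[OF iso r'] by blast
  fix S assume S: "subrep R G r S"
  then have sub: "submodule S R (vec2_module R)"
    and stable: "\<And>g v. g \<in> G \<Longrightarrow> v \<in> S \<Longrightarrow> mat2_act R (r g) v \<in> S"
    unfolding subrep_def by auto
  note SE = M.submoduleE[OF sub]
  have S0: "vec2 \<zero> \<zero> \<in> S"
    using subgroup.one_closed[OF submodule.axioms(1)[OF sub]] by simp
  define T where "T = {v \<in> carrier (vec2_module R). mat2_act R P v \<in> S}"
  have "subrep R G r' T"
    unfolding subrep_def
  proof (intro conjI ballI)
    show "submodule T R (vec2_module R)"
      by (rule submodule_vec2I)
        (auto simp: T_def mat2_act_zero[OF P] S0 mat2_act_add[OF P] mat2_act_smult[OF P] SE
          M.smult_closed M.a_closed simp del: vec2_module_simps(3,4))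
    fix g v assume g: "g \<in> G" and v: "v \<in> T"
    then have vc: "v \<in> carrier (vec2_module R)" by (simp add: T_def)
    have "mat2_act R P (mat2_act R (r' g) v) = mat2_act R (r g) (mat2_act R P v)"
      using eq[OF g] mat2_act_mult[OF P r'[OF g] vc] mat2_act_mult[OF r[OF g] P vc] by simp
    then show "mat2_act R (r' g) v \<in> T"
      using stable[OF g] v mat2_act_closed[OF r'[OF g] vc] by (simp add: T_def)
  qed
  then consider "T = {\<zero>\<^bsub>vec2_module R\<^esub>}" | "T = carrier (vec2_module R)"
    using irr unfolding irreducible_rep_def by blast
  then show "S = {\<zero>\<^bsub>vec2_module R\<^esub>} \<or> S = carrier (vec2_module R)"
  proof cases
    case 1
    have "v = vec2 \<zero> \<zero>" if v: "v \<in> S" for v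
    proof -
      have vc: "v \<in> carrier (vec2_module R)" using v SE(1) by blast
      then have "mat2_act R Q v \<in> T"
        using act_inverse[OF P Q PQ vc] v mat2_act_closed[OF Q vc] by (simp add: T_def)
      then have "mat2_act R Q v = vec2 \<zero> \<zero>" using 1 by simp
      then show ?thesis
        using act_inverse[OF P Q PQ vc] mat2_act_zero[OF P] by simp
    qed
    then have "S = {vec2 \<zero> \<zero>}" using S0 by blast
    then show ?thesis by simp
  next
    case 2
    have "v \<in> S" if vc: "v \<in> carrier (vec2_module R)" for v
    proof -
      have "mat2_act R Q v \<in> T" using 2 mat2_act_closed[OF Q vc] by simp
      then show ?thesis using act_inverse[OF P Q PQ vc] by (simp add: T_def)
    qed
    then have "S = carrier (vec2_module R)"
      using SE(1) by (intro Set.equalityI subsetI) auto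
    then show ?thesis ..
  qed
qed

lemma decomposable_imp_not_irreducible:
  assumes "decomposable_rep R G r"
  shows "\<not> irreducible_rep R G r"
proof
  interpret M: module R "vec2_module R" by (rule module_vec2)
  assume "irreducible_rep R G r"
  moreover obtain S T where *: "subrep R G r S" "subrep R G r T"
    "S \<noteq> {\<zero>\<^bsub>vec2_module R\<^esub>}" "T \<noteq> {\<zero>\<^bsub>vec2_module R\<^esub>}" "S \<inter> T = {\<zero>\<^bsub>vec2_module R\<^esub>}"
    using assms unfolding decomposable_rep_def by blast
  ultimately have "S = carrier (vec2_module R)" "T = carrier (vec2_module R)"
    unfolding irreducible_rep_def by blast+
  then show False using * by simp
qed

lemma upper_triangular_not_irreducible:
  fixes r :: "'g \<Rightarrow> 'a mat2"
  assumes r: "\<And>g. g \<in> G \<Longrightarrow> r g \<in> carrier (mat2_monoid R)" "\<And>g. g \<in> G \<Longrightarrow> r g $ 2 $ 1 = \<zero>"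
    and nontriv: "\<one> \<noteq> \<zero>"
  shows "\<not> irreducible_rep R G r"
proof
  define S where "S = {vec2 x \<zero> | x. x \<in> carrier R}"
  assume irr: "irreducible_rep R G r"
  have "subrep R G r S"
    unfolding subrep_def
  proof (intro conjI ballI)
    show "submodule S R (vec2_module R)"
      by (rule submodule_vec2I) (auto simp: S_def)
    fix g v assume g: "g \<in> G" and "v \<in> S"
    then obtain x where x: "v = vec2 x \<zero>" "x \<in> carrier R" by (auto simp: S_def)
    obtain a b c d where "r g = mat2 a b c d" "a \<in> carrier R" "b \<in> carrier R" "d \<in> carrier R"
      using r(1)[OF g] by (elim mat2_carrier_cases) blast
    moreover from this have "c = \<zero>" using r(2)[OF g] by simp
    ultimately show "mat2_act R (r g) v \<in> S"
      using x by (auto simp: S_def)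
  qed
  then have "S = {vec2 \<zero> \<zero>} \<or> S = carrier (vec2_module R)"
    using irr by (simp add: irreducible_rep_def)
  moreover have "vec2 \<one> \<zero> \<in> S" by (auto simp: S_def)
  moreover have "vec2 \<zero> \<one> \<in> carrier (vec2_module R)" "vec2 \<zero> \<one> \<notin> S"
    using nontriv by (auto simp: S_def)
  ultimately show False using nontriv by auto
qed

text \<open>The images of the two coordinate axes under the intertwiner are the complementary
  invariant subspaces.\<close>

lemma decomposable_if_iso_direct_sum:
  assumes iso: "isomorphic_reps R G r (direct_sum_chars R \<theta>\<^sub>1 \<theta>\<^sub>2)"
    and \<theta>: "\<And>g. g \<in> G \<Longrightarrow> \<theta>\<^sub>1 g \<in> carrier R" "\<And>g. g \<in> G \<Longrightarrow> \<theta>\<^sub>2 g \<in> carrier R"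
    and nontriv: "\<one> \<noteq> \<zero>"
  shows "decomposable_rep R G r"
proof -
  interpret M: module R "vec2_module R" by (rule module_vec2)
  let ?r' = "direct_sum_chars R \<theta>\<^sub>1 \<theta>\<^sub>2"
  have r': "?r' g \<in> carrier (mat2_monoid R)" if "g \<in> G" for g
    using \<theta> that by (simp add: direct_sum_chars_def)
  obtain P Q where P: "P \<in> carrier (mat2_monoid R)" and Q: "Q \<in> carrier (mat2_monoid R)"
    and PQ: "P \<otimes>\<^bsub>mat2_monoid R\<^esub> Q = \<one>\<^bsub>mat2_monoid R\<^esub>"
    and QP: "Q \<otimes>\<^bsub>mat2_monoid R\<^esub> P = \<one>\<^bsub>mat2_monoid R\<^esub>"
    and r: "\<And>g. g \<in> G \<Longrightarrow> r g \<in> carrier (mat2_monoid R)"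
    and eq: "\<And>g. g \<in> G \<Longrightarrow> r g \<otimes>\<^bsub>mat2_monoid R\<^esub> P = P \<otimes>\<^bsub>mat2_monoid R\<^esub> ?r' g"
    using isomorphic_repsE[OF iso r'] by blast
  have act: "mat2_act R (r g) (mat2_act R P v) = mat2_act R P (mat2_act R (?r' g) v)"
    if "g \<in> G" "v \<in> carrier (vec2_module R)" for g v
    using eq[OF that(1)] mat2_act_mult[OF P r'[OF that(1)] that(2)]
      mat2_act_mult[OF r[OF that(1)] P that(2)] by simp
  have subrep: "subrep R G r (mat2_act R P ` H)"
    if sub: "submodule H R (vec2_module R)"
      and st: "\<And>g v. g \<in> G \<Longrightarrow> v \<in> H \<Longrightarrow> mat2_act R (?r' g) v \<in> H" for H
    unfolding subrep_def
  proof (intro conjI ballI)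
    note HE = M.submoduleE[OF sub]
    have Hc: "v \<in> carrier (vec2_module R)" if "v \<in> H" for v using HE(1) that by blast
    have H0: "vec2 \<zero> \<zero> \<in> H"
      using subgroup.one_closed[OF submodule.axioms(1)[OF sub]] by simp
    show "submodule (mat2_act R P ` H) R (vec2_module R)"
    proof (rule submodule_vec2I)
      show "mat2_act R P ` H \<subseteq> carrier (vec2_module R)"
        using mat2_act_closed[OF P] Hc by blast
      show "vec2 \<zero> \<zero> \<in> mat2_act R P ` H"
        using mat2_act_zero[OF P] H0 by (metis imageI)
    next
      fix v w assume "v \<in> mat2_act R P ` H" "w \<in> mat2_act R P ` H"
      then show "v \<oplus>\<^bsub>vec2_module R\<^esub> w \<in> mat2_act R P ` H"
        using mat2_act_add[OF P Hc Hc, symmetric] HE(5) by auto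
    next
      fix c v assume "c \<in> carrier R" "v \<in> mat2_act R P ` H"
      then show "c \<odot>\<^bsub>vec2_module R\<^esub> v \<in> mat2_act R P ` H"
        using mat2_act_smult[OF P Hc, symmetric] HE(4) by auto
    qed
    fix g v assume "g \<in> G" "v \<in> mat2_act R P ` H"
    then show "mat2_act R (r g) v \<in> mat2_act R P ` H"
      using act st Hc by auto
  qed
  define H1 where "H1 = {vec2 x \<zero> | x. x \<in> carrier R}"
  define H2 where "H2 = {vec2 \<zero> x | x. x \<in> carrier R}"
  have H1: "submodule H1 R (vec2_module R)" and H2: "submodule H2 R (vec2_module R)"
    by (rule submodule_vec2I; auto simp: H1_def H2_def)+
  have H1s: "mat2_act R (?r' g) v \<in> H1" if "g \<in> G" "v \<in> H1" for g v
    using that \<theta> by (auto simp: H1_def direct_sum_chars_def)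
  have H2s: "mat2_act R (?r' g) v \<in> H2" if "g \<in> G" "v \<in> H2" for g v
    using that \<theta> by (auto simp: H2_def direct_sum_chars_def)
  have Hc: "v \<in> carrier (vec2_module R)" if "v \<in> H1 \<or> v \<in> H2" for v
    using that by (auto simp: H1_def H2_def)
  have inj: "v = w" if "mat2_act R P v = mat2_act R P w" "v \<in> carrier (vec2_module R)"
    "w \<in> carrier (vec2_module R)" for v w
    using that act_inverse[OF Q P QP] by metis
  let ?S = "mat2_act R P ` H1" and ?T = "mat2_act R P ` H2"
  have ne: "mat2_act R P v \<noteq> vec2 \<zero> \<zero>" if "v \<in> carrier (vec2_module R)" "v \<noteq> vec2 \<zero> \<zero>" for v
    using inj[of v "vec2 \<zero> \<zero>"] mat2_act_zero[OF P] that by auto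
  show ?thesis
    unfolding decomposable_rep_def
  proof (rule exI[of _ ?S], rule exI[of _ ?T], intro conjI)
    show "subrep R G r ?S" by (rule subrep[OF H1]) (rule H1s)
    show "subrep R G r ?T" by (rule subrep[OF H2]) (rule H2s)
    have "vec2 \<one> \<zero> \<in> H1" "vec2 \<zero> \<one> \<in> H2" by (auto simp: H1_def H2_def)
    then show "?S \<noteq> {\<zero>\<^bsub>vec2_module R\<^esub>}" "?T \<noteq> {\<zero>\<^bsub>vec2_module R\<^esub>}"
      using ne[of "vec2 \<one> \<zero>"] ne[of "vec2 \<zero> \<one>"] nontriv by (auto simp del: mat2_act_simp)
    show "?S \<inter> ?T = {\<zero>\<^bsub>vec2_module R\<^esub>}"
    proof (rule Set.equalityI; rule subsetI)
      fix v assume "v \<in> ?S \<inter> ?T"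
      then obtain x y where xy: "x \<in> H1" "y \<in> H2" "v = mat2_act R P x" "v = mat2_act R P y" by blast
      then have "x = y" using inj Hc by metis
      then have "x = vec2 \<zero> \<zero>" using xy(1,2) by (auto simp: H1_def H2_def)
      then show "v \<in> {\<zero>\<^bsub>vec2_module R\<^esub>}" using xy(3) mat2_act_zero[OF P] by simp
    next
      fix v assume "v \<in> {\<zero>\<^bsub>vec2_module R\<^esub>}"
      moreover have "vec2 \<zero> \<zero> \<in> H1 \<inter> H2" by (auto simp: H1_def H2_def)
      ultimately show "v \<in> ?S \<inter> ?T" using mat2_act_zero[OF P] by (metis IntD1 IntD2 IntI imageI singletonD vec2_module_simps(2))
    qed
    show "?S <+>\<^bsub>vec2_module R\<^esub> ?T = carrier (vec2_module R)"
    proof (rule Set.equalityI; rule subsetI)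
      fix v assume "v \<in> ?S <+>\<^bsub>vec2_module R\<^esub> ?T"
      then obtain x y where "x \<in> H1" "y \<in> H2" "v = mat2_act R P x \<oplus>\<^bsub>vec2_module R\<^esub> mat2_act R P y"
        unfolding set_add_def' by blast
      then show "v \<in> carrier (vec2_module R)"
        using mat2_act_closed[OF P] Hc M.a_closed by metis
    next
      fix v assume v: "v \<in> carrier (vec2_module R)"
      obtain x y where xy: "mat2_act R Q v = vec2 x y" "x \<in> carrier R" "y \<in> carrier R"
        using mat2_act_closed[OF Q v] by (elim vec2_carrier_cases) blast
      have "v = mat2_act R P (vec2 x \<zero> \<oplus>\<^bsub>vec2_module R\<^esub> vec2 \<zero> y)"
        using act_inverse[OF P Q PQ v] xy by simp
      also have "\<dots> = mat2_act R P (vec2 x \<zero>) \<oplus>\<^bsub>vec2_module R\<^esub> mat2_act R P (vec2 \<zero> y)"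
        using xy by (intro mat2_act_add[OF P]) simp_all
      finally show "v \<in> ?S <+>\<^bsub>vec2_module R\<^esub> ?T"
        using xy unfolding set_add_def' H1_def H2_def by blast
    qed
  qed
qed

end

section \<open>Computing over the residue field with integral lifts\<close>

context nonarch_subfield begin

definition integral_mat :: "'b mat2 \<Rightarrow> bool" where
  "integral_mat A \<longleftrightarrow> (\<forall>i j. isint (A $ i $ j))"

lemma integral_mat_mat2 [simp]:
  "integral_mat (mat2 a b c d) \<longleftrightarrow> isint a \<and> isint b \<and> isint c \<and> isint d"
  by (auto simp: integral_mat_def forall_2)

abbreviation "redm \<equiv> map_mat2 red"

abbreviation "redv x y \<equiv> vec2 (red x) (red y)"

lemma redm_closed: "integral_mat A \<Longrightarrow> redm A \<in> carrier (mat2_monoid k)"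
  by (cases A rule: mat2_cases) simp

lemma redv_cases:
  assumes "v \<in> carrier (vec2_module k)"
  obtains x y where "v = redv x y" "isint x" "isint y"
  using assms by (elim vec2_carrier_cases carrier_kE) blast

lemma isint_add: "isint x \<Longrightarrow> isint y \<Longrightarrow> isint (x + y)"
  and isint_diff: "isint x \<Longrightarrow> isint y \<Longrightarrow> isint (x - y)"
  and isint_mult: "isint x \<Longrightarrow> isint y \<Longrightarrow> isint (x * y)"
  by (simp_all add: nrm_add_le nrm_diff_le nrm_mult_le_1)

lemma redm_mult:
  "isint a \<Longrightarrow> isint b \<Longrightarrow> isint c \<Longrightarrow> isint d \<Longrightarrow> isint a' \<Longrightarrow> isint b' \<Longrightarrow> isint c' \<Longrightarrow> isint d' \<Longrightarrow>
   redm (mat2 a b c d) \<otimes>\<^bsub>mat2_monoid k\<^esub> redm (mat2 a' b' c' d') =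
   redm (mat2 (a * a' + b * c') (a * b' + b * d') (c * a' + d * c') (c * b' + d * d'))"
  by (simp add: red_mult red_add nrm_mult_le_1)

lemma redm_act:
  "isint a \<Longrightarrow> isint b \<Longrightarrow> isint c \<Longrightarrow> isint d \<Longrightarrow> isint x \<Longrightarrow> isint y \<Longrightarrow>
   mat2_act k (redm (mat2 a b c d)) (redv x y) = redv (a * x + b * y) (c * x + d * y)"
  by (simp add: red_mult red_add nrm_mult_le_1)

text \<open>The adjugate divided by the determinant is integral because the determinant is a unit,
  and its reduction is the inverse.\<close>

lemma redm_Units:
  assumes "isint a" "isint b" "isint c" "isint d" "nrm (a * d - b * c) = 1"
  shows "redm (mat2 a b c d) \<in> Units (mat2_monoid k)"
proof -
  define D where "D = a * d - b * c"
  have D: "D \<in> K" "nrm D = 1" "D \<noteq> 0" using assms by (auto simp: D_def)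
  have int: "isint (d / D)" "isint (- b / D)" "isint (- c / D)" "isint (a / D)"
    using assms(1-4) D by (simp_all add: nrm_divide)
  let ?Q = "redm (mat2 (d / D) (- b / D) (- c / D) (a / D))"
  have "a * (d / D) + b * (- c / D) = 1" "a * (- b / D) + b * (a / D) = 0"
    "c * (d / D) + d * (- c / D) = 0" "c * (- b / D) + d * (a / D) = 1"
    "(d / D) * a + (- b / D) * c = 1" "(d / D) * b + (- b / D) * d = 0"
    "(- c / D) * a + (a / D) * c = 0" "(- c / D) * b + (a / D) * d = 1"
  proof -
    have e: "x * (y / D) + z * (w / D) = (x * y + z * w) / D"
      "(y / D) * x + (w / D) * z = (y * x + w * z) / D" for x y z w
      by (simp_all add: add_divide_distrib)
    have n: "a * d + b * - c = D" "a * - b + b * a = 0" "c * d + d * - c = 0" "c * - b + d * a = D"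
      "d * a + - b * c = D" "d * b + - b * d = 0" "- c * a + a * c = 0" "- c * b + a * d = D"
      by (simp_all add: D_def algebra_simps)
    show "a * (d / D) + b * (- c / D) = 1" "a * (- b / D) + b * (a / D) = 0"
      "c * (d / D) + d * (- c / D) = 0" "c * (- b / D) + d * (a / D) = 1"
      "(d / D) * a + (- b / D) * c = 1" "(d / D) * b + (- b / D) * d = 0"
      "(- c / D) * a + (a / D) * c = 0" "(- c / D) * b + (a / D) * d = 1"
      unfolding e n using D(3) by simp_all
  qed
  note eqs = this
  have "redm (mat2 a b c d) \<otimes>\<^bsub>mat2_monoid k\<^esub> ?Q = \<one>\<^bsub>mat2_monoid k\<^esub>"
    "?Q \<otimes>\<^bsub>mat2_monoid k\<^esub> redm (mat2 a b c d) = \<one>\<^bsub>mat2_monoid k\<^esub>"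
    unfolding redm_mult[OF assms(1-4) int] redm_mult[OF int assms(1-4)] eqs
    by (simp_all add: mat2_monoid_one red_1 red_0)
  moreover have "?Q \<in> carrier (mat2_monoid k)" "redm (mat2 a b c d) \<in> carrier (mat2_monoid k)"
    using assms int by (auto intro!: redm_closed)
  ultimately show ?thesis
    unfolding Units_def by blast
qed

lemma redm_eqI:
  assumes "isint a" "isint b" "isint c" "isint d" "isint a'" "isint b'" "isint c'" "isint d'"
    "nrm (a - a') < 1" "nrm (b - b') < 1" "nrm (c - c') < 1" "nrm (d - d') < 1"
  shows "redm (mat2 a b c d) = redm (mat2 a' b' c' d')"
  using assms by (simp add: red_eq_iff)

text \<open>The relation \<open>A P = P A'\<close> modulo \<lambda>, stated for lifts so that it can
  be checked by field arithmetic.\<close>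

definition intertwines :: "'b mat2 \<Rightarrow> 'b mat2 \<Rightarrow> 'b mat2 \<Rightarrow> bool" where
  "intertwines P A A' \<longleftrightarrow> integral_mat A \<and> integral_mat A' \<and>
     (\<forall>i j. nrm ((A ** P - P ** A') $ i $ j) < 1)"

lemma intertwines_mat2:
  "intertwines (mat2 p1 p2 p3 p4) (mat2 a b c d) (mat2 a' b' c' d') \<longleftrightarrow>
     integral_mat (mat2 a b c d) \<and> integral_mat (mat2 a' b' c' d') \<and>
     nrm ((a * p1 + b * p3) - (p1 * a' + p2 * c')) < 1 \<and> nrm ((a * p2 + b * p4) - (p1 * b' + p2 * d')) < 1 \<and>
     nrm ((c * p1 + d * p3) - (p3 * a' + p4 * c')) < 1 \<and> nrm ((c * p2 + d * p4) - (p3 * b' + p4 * d')) < 1"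
  by (simp add: intertwines_def forall_2 matrix_matrix_mult_def sum_2)

text \<open>All later isomorphisms are obtained here: an integral matrix of unit determinant and,
  separately for each \<open>g\<close>, lifts of the two reduced matrices that it intertwines modulo
  \<lambda>.\<close>

lemma isomorphic_reps_redI:
  assumes P: "isint p1" "isint p2" "isint p3" "isint p4" "nrm (p1 * p4 - p2 * p3) = 1"
    and r: "\<And>g. g \<in> G \<Longrightarrow>
      \<exists>A A'. r g = redm A \<and> r' g = redm A' \<and> intertwines (mat2 p1 p2 p3 p4) A A'"
  shows "isomorphic_reps k G r r'"
proof (rule cring.isomorphic_repsI[OF cring_k])
  show "redm (mat2 p1 p2 p3 p4) \<in> Units (mat2_monoid k)" by (rule redm_Units[OF P])
next
  fix g assume "g \<in> G"
  from r[OF this] obtain A A' where A: "r g = redm A" "r' g = redm A'" "intertwines (mat2 p1 p2 p3 p4) A A'"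
    by blast
  obtain a b c d where a: "A = mat2 a b c d" by (rule mat2_cases)
  obtain a' b' c' d' where a': "A' = mat2 a' b' c' d'" by (rule mat2_cases)
  have int: "isint a" "isint b" "isint c" "isint d" "isint a'" "isint b'" "isint c'" "isint d'"
    and n: "nrm ((a * p1 + b * p3) - (p1 * a' + p2 * c')) < 1" "nrm ((a * p2 + b * p4) - (p1 * b' + p2 * d')) < 1"
      "nrm ((c * p1 + d * p3) - (p3 * a' + p4 * c')) < 1" "nrm ((c * p2 + d * p4) - (p3 * b' + p4 * d')) < 1"
    using A(3) unfolding a a' intertwines_mat2 integral_mat_mat2 by simp_all
  note r = A(1,2)[unfolded a a']
  show "r g \<in> carrier (mat2_monoid k)" unfolding r using int by (intro redm_closed) simp
  show "r g \<otimes>\<^bsub>mat2_monoid k\<^esub> redm (mat2 p1 p2 p3 p4) = redm (mat2 p1 p2 p3 p4) \<otimes>\<^bsub>mat2_monoid k\<^esub> r' g"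
    unfolding r redm_mult[OF int(1-4) P(1-4)] redm_mult[OF P(1-4) int(5-8)]
    by (rule redm_eqI; (rule n)?; intro isint_add isint_mult int P)
qed

context
  fixes G :: "'g set" and r :: "'g \<Rightarrow> 'b set mat2" and S
  assumes S: "subrep k G r S"
begin

lemma subrep_carrier: "S \<subseteq> carrier (vec2_module k)"
  using S module.submoduleE(1)[OF cring.module_vec2[OF cring_k]] unfolding subrep_def by blast

lemma subrep_0: "redv 0 0 \<in> S"
  using S subgroup.one_closed[of S "add_monoid (vec2_module k)"]
  unfolding subrep_def submodule_def by (auto simp: red_0)

lemma subrep_add:
  "isint x \<Longrightarrow> isint y \<Longrightarrow> isint x' \<Longrightarrow> isint y' \<Longrightarrow> redv x y \<in> S \<Longrightarrow> redv x' y' \<in> S \<Longrightarrow> redv (x + x') (y + y') \<in> S"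
  using S module.submoduleE(5)[OF cring.module_vec2[OF cring_k], of S "redv x y" "redv x' y'"]
  unfolding subrep_def by (simp add: red_add)

lemma subrep_scale:
  "isint c \<Longrightarrow> isint x \<Longrightarrow> isint y \<Longrightarrow> redv x y \<in> S \<Longrightarrow> redv (c * x) (c * y) \<in> S"
  using S module.submoduleE(4)[OF cring.module_vec2[OF cring_k], of S "red c" "redv x y"]
  unfolding subrep_def by (simp add: red_mult)

lemma subrep_act:
  "g \<in> G \<Longrightarrow> r g = redm (mat2 a b c d) \<Longrightarrow> isint a \<Longrightarrow> isint b \<Longrightarrow> isint c \<Longrightarrow> isint d \<Longrightarrow> isint x \<Longrightarrow> isint y \<Longrightarrow>
   redv x y \<in> S \<Longrightarrow> redv (a * x + b * y) (c * x + d * y) \<in> S"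
  using S redm_act[of a b c d x y] unfolding subrep_def by metis

lemma subrep_nonzero:
  assumes "S \<noteq> {\<zero>\<^bsub>vec2_module k\<^esub>}"
  obtains x y where "isint x" "isint y" "redv x y \<in> S" "nrm x = 1 \<or> nrm y = 1"
proof -
  obtain v where v: "v \<in> S" "v \<noteq> redv 0 0"
    using assms subrep_0 by (auto simp: red_0)
  then have "v \<in> carrier (vec2_module k)" using subrep_carrier by blast
  then obtain x y where xy: "v = redv x y" "isint x" "isint y" by (rule redv_cases)
  then have "\<not> (nrm x < 1 \<and> nrm y < 1)"
    using v(2) by (auto simp: red_eq_iff)
  then show thesis using that[of x y] xy v by auto
qed

text \<open>Two vectors whose lifts have unit determinant span the plane over the residue field;
  \<alpha> and \<beta> are the integral coefficients from Cramer's rule.\<close>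

lemma subrep_full:
  assumes xy: "isint x" "isint y" "redv x y \<in> S" and xy': "isint x'" "isint y'" "redv x' y' \<in> S"
    and det: "nrm (x * y' - x' * y) = 1"
  shows "S = carrier (vec2_module k)"
proof (rule Set.equalityI[OF subrep_carrier]; rule subsetI)
  fix v assume "v \<in> carrier (vec2_module k)"
  then obtain a b where ab: "v = redv a b" "isint a" "isint b" by (rule redv_cases)
  define D where "D = x * y' - x' * y"
  have D: "D \<in> K" "nrm D = 1" "D \<noteq> 0" using assms by (auto simp: D_def)
  define \<alpha> \<beta> where "\<alpha> = (a * y' - b * x') / D" and "\<beta> = (b * x - a * y) / D"
  have "isint (a * y' - b * x')" "isint (b * x - a * y)"
    by (intro isint_diff isint_mult ab xy xy')+
  then have int: "isint \<alpha>" "isint \<beta>"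
    using D by (simp_all add: \<alpha>_def \<beta>_def nrm_divide)
  have eq: "\<alpha> * x + \<beta> * x' = a" "\<alpha> * y + \<beta> * y' = b"
    using D(3) by (simp_all add: \<alpha>_def \<beta>_def field_simps) (simp_all add: D_def algebra_simps)
  have "redv (\<alpha> * x) (\<alpha> * y) \<in> S" "redv (\<beta> * x') (\<beta> * y') \<in> S"
    using subrep_scale int xy xy' by blast+
  then have "redv (\<alpha> * x + \<beta> * x') (\<alpha> * y + \<beta> * y') \<in> S"
    using int xy xy' by (intro subrep_add isint_mult)
  then show "v \<in> S" by (simp add: eq ab)
qed

end

end

section \<open>Reduction of an integral dihedral representation\<close>

text \<open>Separates the linear algebra from Galois theory: of the Weil groups only the two cosets,
  the values of \<xi> and the explicit integral matrices remain.\<close>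

locale dihedral_reduction = discretely_valued nrm K \<pi>
  for nrm :: "'b::field \<Rightarrow> real" and K \<pi> +
  fixes WF WE :: "('a \<Rightarrow> 'a) set" and \<sigma> :: "'a \<Rightarrow> 'a"
    and \<rho> :: "('a \<Rightarrow> 'a) \<Rightarrow> 'b mat2" and \<xi> :: "('a \<Rightarrow> 'a) \<Rightarrow> 'b" and a b d :: 'b and i :: nat
  assumes complete: "nrm_complete K" and nrm_2: "nrm 2 = 1"
    and \<sigma>: "bij \<sigma>" and id: "id \<in> WE" and disjoint: "\<And>h. h \<in> WE \<Longrightarrow> h \<circ> \<sigma> \<notin> WE"
    and WF_eq: "WF = WE \<union> (\<lambda>h. h \<circ> \<sigma>) ` WE"
    and abd: "a \<in> K" "b \<in> K" "d \<in> K" "a \<noteq> 0" "d \<noteq> 0"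
    and \<xi>_id: "\<xi> id = 1"
    and \<xi>: "\<And>h. h \<in> WE \<Longrightarrow> \<xi> h \<in> K" "\<And>h. h \<in> WE \<Longrightarrow> nrm (\<xi> h) = 1"
    and \<xi>': "\<And>h. h \<in> WE \<Longrightarrow> conj_char \<sigma> \<xi> h \<in> K" "\<And>h. h \<in> WE \<Longrightarrow> nrm (conj_char \<sigma> \<xi> h) = 1"
    and \<xi>_twist: "\<And>h. h \<in> WE \<Longrightarrow> \<xi> (\<sigma> \<circ> h \<circ> \<sigma>) = conj_char \<sigma> \<xi> h * \<xi> (\<sigma> \<circ> \<sigma>)"
    and u: "\<xi> (\<sigma> \<circ> \<sigma>) \<in> K" "nrm (\<xi> (\<sigma> \<circ> \<sigma>)) = 1"
    and \<rho>_WE: "\<And>h. h \<in> WE \<Longrightarrow>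
      \<rho> h = mat2 (\<xi> h) (b / d * (conj_char \<sigma> \<xi> h - \<xi> h)) 0 (conj_char \<sigma> \<xi> h)"
    and \<rho>_coset: "\<And>h. h \<in> WE \<Longrightarrow>
      \<rho> (h \<circ> \<sigma>) = mat2 (b / a * \<xi> (\<sigma> \<circ> h \<circ> \<sigma>)) (a / d * \<xi> h - b * b / (a * d) * \<xi> (\<sigma> \<circ> h \<circ> \<sigma>))
        (d / a * \<xi> (\<sigma> \<circ> h \<circ> \<sigma>)) (- (b / a) * \<xi> (\<sigma> \<circ> h \<circ> \<sigma>))"
    and \<rho>_integral: "\<And>g. g \<in> WF \<Longrightarrow> integral_mat (\<rho> g)"
    and i_cong: "\<And>h. h \<in> WE \<Longrightarrow> nrm (\<xi> h - conj_char \<sigma> \<xi> h) \<le> nrm \<pi> ^ i"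
    and i_max: "\<exists>h\<in>WE. \<not> nrm (\<xi> h - conj_char \<sigma> \<xi> h) \<le> nrm \<pi> ^ Suc i"
begin

abbreviation "\<xi>' \<equiv> conj_char \<sigma> \<xi>"

abbreviation "u \<equiv> \<xi> (\<sigma> \<circ> \<sigma>)"

abbreviation "\<rho>bar \<equiv> \<lambda>g. redm (\<rho> g)"

definition "trivial_mod \<longleftrightarrow> (\<forall>h\<in>WE. nrm (\<xi> h - \<xi>' h) < 1)"

lemma WF_cases [consumes 1, case_names WE coset]:
  assumes "g \<in> WF"
  obtains "g \<in> WE" | h where "h \<in> WE" "g = h \<circ> \<sigma>"
  using assms unfolding WF_eq by blast

lemma WE_WF: "h \<in> WE \<Longrightarrow> h \<in> WF" and coset_WF: "h \<in> WE \<Longrightarrow> h \<circ> \<sigma> \<in> WF"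
  unfolding WF_eq by blast+

lemma on_cosets_simps:
  "h \<in> WE \<Longrightarrow> on_cosets WE \<sigma> f f' h = f h" "h \<in> WE \<Longrightarrow> on_cosets WE \<sigma> f f' (h \<circ> \<sigma>) = f' h"
proof -
  have "h \<circ> \<sigma> \<circ> inv_into UNIV \<sigma> = h"
    using surj_iff[of \<sigma>] \<sigma> by (simp add: bij_def comp_assoc)
  then show "h \<in> WE \<Longrightarrow> on_cosets WE \<sigma> f f' h = f h"
    "h \<in> WE \<Longrightarrow> on_cosets WE \<sigma> f f' (h \<circ> \<sigma>) = f' h"
    using disjoint by (simp_all add: on_cosets_def)
qed

lemma Ind_simps:
  "h \<in> WE \<Longrightarrow> Ind k WE \<sigma> (red \<circ> \<xi>) h = redm (mat2 (\<xi> h) 0 0 (\<xi>' h))"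
  "h \<in> WE \<Longrightarrow> Ind k WE \<sigma> (red \<circ> \<xi>) (h \<circ> \<sigma>) = redm (mat2 0 (\<xi> h) (\<xi> (\<sigma> \<circ> h \<circ> \<sigma>)) 0)"
  unfolding Ind_def by (simp_all add: on_cosets_simps red_0 conj_char_def)

lemma y_integral: "h \<in> WE \<Longrightarrow> \<xi> (\<sigma> \<circ> h \<circ> \<sigma>) \<in> K" "h \<in> WE \<Longrightarrow> nrm (\<xi> (\<sigma> \<circ> h \<circ> \<sigma>)) = 1"
  using \<xi>' u by (simp_all add: \<xi>_twist nrm_mult)

lemma corner_integral: "h \<in> WE \<Longrightarrow> isint (b / d * (\<xi>' h - \<xi> h))"
  using \<rho>_integral[OF WE_WF] by (simp add: \<rho>_WE)

lemma coset_integral: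
  assumes "h \<in> WE"
  shows "isint (b / a * \<xi> (\<sigma> \<circ> h \<circ> \<sigma>))"
    "isint (a / d * \<xi> h - b * b / (a * d) * \<xi> (\<sigma> \<circ> h \<circ> \<sigma>))"
    "isint (d / a * \<xi> (\<sigma> \<circ> h \<circ> \<sigma>))" "isint (- (b / a) * \<xi> (\<sigma> \<circ> h \<circ> \<sigma>))"
  using \<rho>_integral[OF coset_WF[OF assms]] unfolding \<rho>_coset[OF assms] integral_mat_mat2 by blast+

text \<open>These are entries of \<open>\<rho> \<sigma>\<close>, obtained at \<open>h = id\<close>;
  the unit \<open>u\<close> is removed from the first two.\<close>

lemma quotients_integral: "isint (b / a)" "isint (d / a)" "isint (a / d - b * b / (a * d) * u)"
  using coset_integral[OF id] u(2) abd by (simp_all add: \<xi>_id nrm_mult nrm_divide)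

lemma \<rho>bar_closed: "g \<in> WF \<Longrightarrow> \<rho>bar g \<in> carrier (mat2_monoid k)"
  by (rule redm_closed[OF \<rho>_integral])

lemma Ind_closed: "g \<in> WF \<Longrightarrow> Ind k WE \<sigma> (red \<circ> \<xi>) g \<in> carrier (mat2_monoid k)"
  by (cases g rule: WF_cases) (simp_all add: Ind_simps \<xi> \<xi>' y_integral)

lemma nontrivial_k: "\<one>\<^bsub>k\<^esub> \<noteq> \<zero>\<^bsub>k\<^esub>"
  by (simp add: red_0 red_1 red_eq_iff)

lemma red_\<xi>_eq_iff: "h \<in> WE \<Longrightarrow> red (\<xi> h) = red (\<xi>' h) \<longleftrightarrow> nrm (\<xi> h - \<xi>' h) < 1"
  by (simp add: red_eq_iff \<xi> \<xi>')

section \<open>The case of a unit \<open>d / a\<close>\<close>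

text \<open>The matrix is \<open>U / a\<close>, of determinant \<open>d / a\<close>. It intertwines
  the lifts exactly, since conjugation by \<open>U\<close> is unchanged by the scalar
  \<open>1 / a\<close>.\<close>

lemma unit_iso_Ind:
  assumes unit: "nrm (d / a) = 1"
  shows "isomorphic_reps k WF \<rho>bar (Ind k WE \<sigma> (red \<circ> \<xi>))"
proof (rule isomorphic_reps_redI[of 1 "b / a" 0 "d / a"])
  let ?P = "mat2 1 (b / a) 0 (d / a)"
  fix g assume "g \<in> WF"
  then show "\<exists>A A'. \<rho>bar g = redm A \<and> Ind k WE \<sigma> (red \<circ> \<xi>) g = redm A' \<and> intertwines ?P A A'"
  proof (cases g rule: WF_cases)
    case WE
    have "\<xi> g * (b / a) + b / d * (\<xi>' g - \<xi> g) * (d / a) - (1 * 0 + b / a * \<xi>' g) = 0"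
      using abd by (simp add: field_simps)
    then have "intertwines ?P (\<rho> g) (mat2 (\<xi> g) 0 0 (\<xi>' g))"
      unfolding \<rho>_WE[OF WE] intertwines_mat2 using WE corner_integral[OF WE]
      by (simp add: \<xi> \<xi>' mult.commute)
    then show ?thesis using Ind_simps(1)[OF WE] by blast
  next
    case (coset h)
    let ?y = "\<xi> (\<sigma> \<circ> h \<circ> \<sigma>)"
    have e: "b / a * ?y * (b / a) + (a / d * \<xi> h - b * b / (a * d) * ?y) * (d / a) - (1 * \<xi> h + b / a * 0) = 0"
      "d / a * ?y * (b / a) + - (b / a) * ?y * (d / a) - (0 * \<xi> h + d / a * 0) = 0"
      using abd by (simp_all add: field_simps)
    have "intertwines ?P (\<rho> g) (mat2 0 (\<xi> h) ?y 0)"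
      unfolding coset(2) \<rho>_coset[OF coset(1)] intertwines_mat2 e
      using coset(1) coset_integral[OF coset(1)] by (simp add: \<xi> y_integral)
    then show ?thesis using Ind_simps(2)[OF coset(1)] coset(2) by blast
  qed
qed (use quotients_integral unit in simp_all)

text \<open>A vector \<open>(x, y)\<close> of \<open>S\<close> and its image \<open>(y, u x)\<close>
  under \<sigma> must be dependent, so \<open>y / x\<close> is a square root of \<open>u\<close>
  modulo \<lambda>. Its images under the diagonal matrices must be dependent on it as well, which
  makes the two characters congruent.\<close>

lemma Ind_subrep_full:
  assumes S: "subrep k WF (Ind k WE \<sigma> (red \<circ> \<xi>)) S" "S \<noteq> {\<zero>\<^bsub>vec2_module k\<^esub>}"
    and full: "S \<noteq> carrier (vec2_module k)"
  shows "trivial_mod" "\<exists>t. isint t \<and> nrm (t\<^sup>2 - u) < 1"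
proof -
  obtain x y where xy: "isint x" "isint y" "redv x y \<in> S" "nrm x = 1 \<or> nrm y = 1"
    using subrep_nonzero[OF S] .
  have u': "isint u" using u by simp
  have A: "redv (0 * x + 1 * y) (u * x + 0 * y) \<in> S"
    by (rule subrep_act[OF S(1) coset_WF[OF id]])
      (use xy u in \<open>simp_all add: Ind_simps(2)[OF id, unfolded id_o] \<xi>_id Ind_simps(2)[OF id]\<close>)
  then have A: "redv y (u * x) \<in> S" by simp
  have notA: "nrm (x * (u * x) - y * y) < 1"
  proof (rule ccontr)
    assume "\<not> nrm (x * (u * x) - y * y) < 1"
    moreover have "isint (x * (u * x) - y * y)"
      by (intro isint_diff isint_mult xy u')
    ultimately have "nrm (x * (u * x) - y * y) = 1" by simp
    then have "S = carrier (vec2_module k)"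
      by (intro subrep_full[OF S(1) xy(1-3) xy(2) isint_mult[OF u' xy(1)] A])
    then show False using full by simp
  qed
  \<comment> \<open>If \<open>u x^2\<close> and \<open>y^2\<close> had different norms, the larger
    would be the norm of their difference, hence below one; but one coordinate is a unit.\<close>
  have nxy: "nrm x = 1" "nrm y = 1"
  proof -
    have "nrm (x * (u * x)) = nrm x * nrm x" "nrm (y * y) = nrm y * nrm y"
      using u(2) by (simp_all add: nrm_mult)
    moreover have "nrm (x * (u * x)) = nrm (y * y) \<or> max (nrm (x * (u * x))) (nrm (y * y)) < 1"
      using notA nrm_diff_eq_max by metis
    ultimately have "nrm x * nrm x = nrm y * nrm y"
      using xy(4) by auto
    then have "(nrm x)\<^sup>2 = (nrm y)\<^sup>2"
      by (simp only: power2_eq_square)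
    then have "nrm x = nrm y"
      by (rule power2_eq_imp_eq) (rule nrm_nonneg)+
    then show "nrm x = 1" "nrm y = 1" using xy(4) by auto
  qed
  then have "x \<noteq> 0" by auto
  have "(y / x)\<^sup>2 - u = - ((x * (u * x) - y * y) / (x * x))"
    using \<open>x \<noteq> 0\<close> by (simp add: field_simps power2_eq_square)
  then have "nrm ((y / x)\<^sup>2 - u) < 1"
    using notA nxy by (simp add: nrm_divide nrm_mult)
  moreover have "isint (y / x)" using xy nxy by (simp add: nrm_divide)
  ultimately show "\<exists>t. isint t \<and> nrm (t\<^sup>2 - u) < 1" by blast
  show "trivial_mod"
    unfolding trivial_mod_def
  proof (rule ballI, rule ccontr)
    fix h assume h: "h \<in> WE" and not: "\<not> nrm (\<xi> h - \<xi>' h) < 1"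
    have int: "isint (\<xi> h)" "isint (\<xi>' h)" using \<xi> \<xi>' h by simp_all
    have "redv (\<xi> h * x + 0 * y) (0 * x + \<xi>' h * y) \<in> S"
      by (rule subrep_act[OF S(1) WE_WF[OF h]]) (use xy int in \<open>simp_all add: Ind_simps(1)[OF h]\<close>)
    then have D: "redv (\<xi> h * x) (\<xi>' h * y) \<in> S" by simp
    have "nrm (\<xi> h - \<xi>' h) = 1" using isint_diff[OF int] not by simp
    then have "nrm (x * (\<xi>' h * y) - \<xi> h * x * y) = 1"
      using nxy nrm_mult[of "\<xi> h - \<xi>' h" "x * y"] nrm_minus_commute[of "x * (\<xi>' h * y)"]
      by (simp add: nrm_mult algebra_simps)
    then have "S = carrier (vec2_module k)"
      using xy int by (intro subrep_full[OF S(1) xy(1-3) _ _ D] isint_mult)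
    then show False using full by simp
  qed
qed

lemma unit_reducible:
  assumes "nrm (d / a) = 1" "\<not> irreducible_rep k WF \<rho>bar"
  shows "trivial_mod" "\<exists>t. isint t \<and> nrm (t\<^sup>2 - u) < 1"
proof -
  have "\<not> irreducible_rep k WF (Ind k WE \<sigma> (red \<circ> \<xi>))"
    using assms cring.irreducible_rep_iso[OF cring_k unit_iso_Ind Ind_closed] by blast
  then obtain S where "subrep k WF (Ind k WE \<sigma> (red \<circ> \<xi>)) S" "S \<noteq> {\<zero>\<^bsub>vec2_module k\<^esub>}"
    "S \<noteq> carrier (vec2_module k)"
    unfolding irreducible_rep_def by blast
  from Ind_subrep_full[OF this] show "trivial_mod" "\<exists>t. isint t \<and> nrm (t\<^sup>2 - u) < 1" .
qed

text \<open>The intertwining matrix has as columns \<open>U / a\<close> applied to the eigenvectors \<open>(1, s)\<close> and \<open>(1, -s)\<close>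
  of the reduced induced representation.\<close>

lemma unit_iso_direct_sum:
  assumes unit: "nrm (d / a) = 1" and triv: "trivial_mod" and s: "s \<in> K" "s\<^sup>2 = u"
  shows "isomorphic_reps k WF \<rho>bar (direct_sum_chars k
     (red \<circ> on_cosets WE \<sigma> \<xi> (\<lambda>h. s * \<xi> h)) (red \<circ> on_cosets WE \<sigma> \<xi> (\<lambda>h. - s * \<xi> h)))"
    (is "isomorphic_reps k WF \<rho>bar ?r")
proof -
  have "nrm s * nrm s = 1" using s(2) u(2) by (metis nrm_mult power2_eq_square)
  then have ns: "nrm s = 1" using nrm_nonneg[of s] by (simp add: square_eq_1_iff)
  have si: "isint s" and mi: "isint (- s)" using s ns by simp_all
  have one: "isint 1" by simp
  have bs: "isint (b / a * s)" "isint (d / a * s)"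
    using isint_mult si quotients_integral by blast+
  show ?thesis
  proof (rule isomorphic_reps_redI[of "1 + b / a * s" "1 - b / a * s" "d / a * s" "- (d / a * s)"])
    \<comment> \<open>The determinant is a unit because 2 has norm one.\<close>
    have "(1 + b / a * s) * (- (d / a * s)) - (1 - b / a * s) * (d / a * s) = - (2 * (d / a * s))"
      by (simp add: algebra_simps)
    then show "nrm ((1 + b / a * s) * (- (d / a * s)) - (1 - b / a * s) * (d / a * s)) = 1"
      using nrm_2 unit ns by (simp only: nrm_minus nrm_mult)
    let ?P = "mat2 (1 + b / a * s) (1 - b / a * s) (d / a * s) (- (d / a * s))"
    fix g assume "g \<in> WF"
    then show "\<exists>A A'. \<rho>bar g = redm A \<and> ?r g = redm A' \<and> intertwines ?P A A'"
    proof (cases g rule: WF_cases)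
      case WE
      have small: "nrm (\<xi>' g - \<xi> g) < 1"
        using triv WE nrm_minus_commute unfolding trivial_mod_def by metis
      have sm: "nrm (b / a * s * (\<xi>' g - \<xi> g)) < 1" "nrm (d / a * s * (\<xi>' g - \<xi> g)) < 1"
        using nrm_mult_less_1(1)[OF _ small] bs by blast+
      let ?c = "b / d * (\<xi>' g - \<xi> g)"
      \<comment> \<open>All four errors are integral multiples of the difference of the two
        characters, which lies in \<lambda>.\<close>
      have e: "(\<xi> g * (1 + b / a * s) + ?c * (d / a * s)) - ((1 + b / a * s) * \<xi> g + (1 - b / a * s) * 0)
          = b / a * s * (\<xi>' g - \<xi> g)"
        "(\<xi> g * (1 - b / a * s) + ?c * (- (d / a * s))) - ((1 + b / a * s) * 0 + (1 - b / a * s) * \<xi> g)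
          = - (b / a * s * (\<xi>' g - \<xi> g))"
        "(0 * (1 + b / a * s) + \<xi>' g * (d / a * s)) - (d / a * s * \<xi> g + (- (d / a * s)) * 0)
          = d / a * s * (\<xi>' g - \<xi> g)"
        "(0 * (1 - b / a * s) + \<xi>' g * (- (d / a * s))) - (d / a * s * 0 + (- (d / a * s)) * \<xi> g)
          = - (d / a * s * (\<xi>' g - \<xi> g))"
        using abd by (simp_all add: field_simps)
      have r: "?r g = redm (mat2 (\<xi> g) 0 0 (\<xi> g))"
        using WE by (simp add: direct_sum_chars_def on_cosets_simps red_0)
      have "intertwines ?P (\<rho> g) (mat2 (\<xi> g) 0 0 (\<xi> g))"
        unfolding \<rho>_WE[OF WE] intertwines_mat2 e nrm_minus integral_mat_mat2
        using WE sm corner_integral[OF WE] \<xi> \<xi>' by (intro conjI) simp_all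
      then show ?thesis using r by blast
    next
      case (coset h)
      let ?y = "\<xi> (\<sigma> \<circ> h \<circ> \<sigma>)"
      have small: "nrm (\<xi>' h - \<xi> h) < 1"
        using triv coset(1) nrm_minus_commute unfolding trivial_mod_def by metis
      have y: "?y = \<xi>' h * (s * s)" "isint (s * s)"
        using \<xi>_twist[OF coset(1)] s isint_mult[OF si si] by (simp_all only: power2_eq_square)
      have sm: "nrm (b / a * (s * s) * (\<xi>' h - \<xi> h)) < 1" "nrm (d / a * (s * s) * (\<xi>' h - \<xi> h)) < 1"
        using nrm_mult_less_1(1)[OF _ small] isint_mult[OF quotients_integral(1) y(2)]
          isint_mult[OF quotients_integral(2) y(2)] by blast+
      let ?A = "b / a * ?y" and ?B = "a / d * \<xi> h - b * b / (a * d) * ?y"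
        and ?C = "d / a * ?y" and ?D = "- (b / a) * ?y"
      have e: "(?A * (1 + b / a * s) + ?B * (d / a * s)) - ((1 + b / a * s) * (s * \<xi> h) + (1 - b / a * s) * 0)
          = b / a * (s * s) * (\<xi>' h - \<xi> h)"
        "(?A * (1 - b / a * s) + ?B * (- (d / a * s))) - ((1 + b / a * s) * 0 + (1 - b / a * s) * (- s * \<xi> h))
          = b / a * (s * s) * (\<xi>' h - \<xi> h)"
        "(?C * (1 + b / a * s) + ?D * (d / a * s)) - (d / a * s * (s * \<xi> h) + (- (d / a * s)) * 0)
          = d / a * (s * s) * (\<xi>' h - \<xi> h)"
        "(?C * (1 - b / a * s) + ?D * (- (d / a * s))) - (d / a * s * 0 + (- (d / a * s)) * (- s * \<xi> h))
          = d / a * (s * s) * (\<xi>' h - \<xi> h)"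
        unfolding y(1) using abd by (simp_all add: field_simps)
      have r: "?r g = redm (mat2 (s * \<xi> h) 0 0 (- s * \<xi> h))"
        using coset by (simp add: direct_sum_chars_def on_cosets_simps red_0)
      have int: "isint (s * \<xi> h)" "isint (- s * \<xi> h)"
        using coset(1) s ns \<xi> by (simp_all add: nrm_mult)
      have "intertwines ?P (\<rho> g) (mat2 (s * \<xi> h) 0 0 (- s * \<xi> h))"
        unfolding coset(2) \<rho>_coset[OF coset(1)] intertwines_mat2 e integral_mat_mat2
        by (intro conjI sm int coset_integral[OF coset(1)] conjunct1[OF int(1)]; simp)
      then show ?thesis using r by blast
    qed
  qed (use bs isint_add[OF one bs(1)] isint_diff[OF one bs(1)] in simp_all)
qed

section \<open>The case \<open>d / a \<in> \<lambda>\<close>\<close>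

context
  assumes nonunit: "nrm (d / a) < 1"
begin

text \<open>The identity is the determinant of \<open>\<rho> \<sigma>\<close> divided by
  \<open>- u\<close>. As its lower left entry lies in \<lambda>, \<open>(b / a)^2 * u\<close> is
  congruent to 1, so \<open>a\<close> and \<open>b\<close> have equal norm, larger than that of
  \<open>d\<close>.\<close>

lemma nonunit_nrm: "nrm (b / a) = 1" "nrm (a / d) = nrm (b / d)" "1 < nrm (b / d)"
proof -
  have "(b / a)\<^sup>2 * u - 1 = - (d / a * (a / d - b * b / (a * d) * u))"
    using abd by (simp add: field_simps power2_eq_square)
  then have "nrm ((b / a)\<^sup>2 * u - 1) < 1"
    using nrm_mult_less_1(2)[OF conjunct2[OF quotients_integral(3)] nonunit] by simp
  then have "nrm ((b / a)\<^sup>2 * u) = 1"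
    using nrm_eq_if_close[of _ 1] by simp
  then have "nrm (b / a) * nrm (b / a) = 1"
    using u(2) by (simp only: nrm_mult power2_eq_square mult_1_right)
  then show *: "nrm (b / a) = 1"
    using nrm_nonneg[of "b / a"] by (metis abs_of_nonneg abs_mult_self_eq abs_square_eq_1 power2_eq_square)
  then show "nrm (a / d) = nrm (b / d)"
    by (auto simp: nrm_divide field_simps split: if_splits)
  moreover have "0 < nrm d" using abd nrm_pos by blast
  moreover have "nrm d < nrm a"
    using nonunit abd nrm_pos[of a] by (simp add: nrm_divide field_simps)
  ultimately show "1 < nrm (b / d)"
    using abd by (simp add: nrm_divide)
qed

text \<open>Since \<open>b / d\<close> has norm above one, integrality of the corner entry pushes
  the difference of the characters into \<lambda>.\<close>

lemma nonunit_trivial_mod: "trivial_mod"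
  unfolding trivial_mod_def
proof
  fix h assume "h \<in> WE"
  then have le: "nrm (b / d) * nrm (\<xi> h - \<xi>' h) \<le> 1"
    using corner_integral[of h] nrm_minus_commute[of "\<xi> h" "\<xi>' h"] by (simp add: nrm_mult nrm_divide)
  show "nrm (\<xi> h - \<xi>' h) < 1"
  proof (rule ccontr)
    assume "\<not> nrm (\<xi> h - \<xi>' h) < 1"
    then have "nrm (b / d) * 1 \<le> nrm (b / d) * nrm (\<xi> h - \<xi>' h)"
      by (intro mult_left_mono) simp_all
    then show False using le nonunit_nrm(3) by linarith
  qed
qed

lemma nonunit_reducible: "\<not> irreducible_rep k WF \<rho>bar"
proof (rule cring.upper_triangular_not_irreducible[OF cring_k \<rho>bar_closed _ nontrivial_k])
  fix g assume "g \<in> WF"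
  then show "\<rho>bar g $ 2 $ 1 = \<zero>\<^bsub>k\<^esub>"
  proof (cases g rule: WF_cases)
    case WE
    then show ?thesis by (simp add: \<rho>_WE red_0)
  next
    case (coset h)
    have "nrm (d / a * \<xi> (\<sigma> \<circ> h \<circ> \<sigma>) - 0) < 1"
      using nonunit coset by (simp add: nrm_mult nrm_divide y_integral)
    then show ?thesis
      using coset_integral(3)[OF coset(1)] unfolding coset(2) \<rho>_coset[OF coset(1)] red_0
      by (simp add: red_eq_iff del: diff_zero)
  qed
qed

text \<open>The matrix of \<open>\<rho>bar \<sigma>\<close> is upper triangular with distinct diagonal entries \<open>m\<close> and \<open>-m\<close>, so it
  is diagonalised by a unipotent matrix; on \<open>W\<^sub>E\<close> the representation is scalar.\<close>

lemma nonunit_iso_direct_sum: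
  assumes small: "\<And>h. h \<in> WE \<Longrightarrow> nrm (b / d * (\<xi>' h - \<xi> h)) < 1"
  shows "isomorphic_reps k WF \<rho>bar (direct_sum_chars k
     (red \<circ> on_cosets WE \<sigma> \<xi> (\<lambda>h. b / a * \<xi> (\<sigma> \<circ> h \<circ> \<sigma>)))
     (red \<circ> on_cosets WE \<sigma> (conj_char \<sigma> \<xi>) (\<lambda>h. - (b / a) * \<xi> (\<sigma> \<circ> h \<circ> \<sigma>))))"
    (is "isomorphic_reps k WF \<rho>bar ?r")
proof -
  define m where "m = b / a * u"
  define e where "e = a / d - b * b / (a * d) * u"
  \<comment> \<open>Modulo \<lambda> the matrix of \<sigma> has rows \<open>(m, e)\<close> and
    \<open>(0, - m)\<close>; this value makes \<open>(f, 1)\<close> an eigenvector for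
    \<open>- m\<close>.\<close>
  define f where "f = - e / (2 * m)"
  have "nrm m = nrm (b / a) * nrm u" unfolding m_def by (rule nrm_mult)
  then have m: "m \<in> K" "nrm m = 1" using abd u nonunit_nrm(1) by (simp_all add: m_def)
  have m0: "m \<noteq> 0" and two0: "(2::'b) \<noteq> 0" using m nrm_2 by auto
  have e: "isint e" using quotients_integral(3) by (simp add: e_def)
  have "(2::'b) \<in> K" using K_add[of 1 1] by simp
  then have f: "isint f" using m e nrm_2 by (simp add: f_def nrm_divide nrm_mult)
  have mf: "2 * m * f = - e" using m0 two0 by (simp add: f_def)
  show ?thesis
  proof (rule isomorphic_reps_redI[of 1 f 0 1])
    let ?P = "mat2 1 f 0 1"
    fix g assume "g \<in> WF"
    then show "\<exists>A A'. \<rho>bar g = redm A \<and> ?r g = redm A' \<and> intertwines ?P A A'"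
    proof (cases g rule: WF_cases)
      case WE
      let ?c = "b / d * (\<xi>' g - \<xi> g)"
      have eq: "(\<xi> g * f + ?c * 1) - (1 * 0 + f * \<xi>' g) = f * (\<xi> g - \<xi>' g) + ?c"
        by (simp add: algebra_simps)
      have "nrm (f * (\<xi> g - \<xi>' g)) < 1"
        using nonunit_trivial_mod WE f nrm_mult_less_1(1) unfolding trivial_mod_def by blast
      then have sm: "nrm ((\<xi> g * f + ?c * 1) - (1 * 0 + f * \<xi>' g)) < 1"
        unfolding eq using small[OF WE] by (rule nrm_add_less)
      have r: "?r g = redm (mat2 (\<xi> g) 0 0 (\<xi>' g))"
        using WE by (simp add: direct_sum_chars_def on_cosets_simps red_0)
      have "intertwines ?P (\<rho> g) (mat2 (\<xi> g) 0 0 (\<xi>' g))"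
        unfolding \<rho>_WE[OF WE] intertwines_mat2 integral_mat_mat2
        using WE corner_integral[OF WE] \<xi> \<xi>' by (intro conjI sm) simp_all
      then show ?thesis using r by blast
    next
      case (coset h)
      let ?y = "\<xi> (\<sigma> \<circ> h \<circ> \<sigma>)"
      let ?A = "b / a * ?y" and ?B = "a / d * \<xi> h - b * b / (a * d) * ?y"
        and ?C = "d / a * ?y" and ?D = "- (b / a) * ?y"
      note int = coset_integral[OF coset(1)]
      have "(?A * f + ?B * 1) - (1 * 0 + f * ?D) = 2 * m * f * \<xi>' h + ?B"
        by (simp add: \<xi>_twist[OF coset(1)] m_def algebra_simps)
      also have "\<dots> = a / d * (\<xi> h - \<xi>' h)"
        unfolding mf by (simp add: \<xi>_twist[OF coset(1)] e_def algebra_simps)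
      finally have eq: "(?A * f + ?B * 1) - (1 * 0 + f * ?D) = a / d * (\<xi> h - \<xi>' h)" .
      \<comment> \<open>As \<open>a / d\<close> and \<open>b / d\<close> have the same norm, this
        error is exactly as small as the corner entry on \<open>WE\<close>.\<close>
      have "nrm ((?A * f + ?B * 1) - (1 * 0 + f * ?D)) = nrm (b / d * (\<xi>' h - \<xi> h))"
        unfolding eq nrm_mult nonunit_nrm(2) by (simp only: nrm_minus_commute[of "\<xi> h" "\<xi>' h"])
      then have 1: "nrm ((?A * f + ?B * 1) - (1 * 0 + f * ?D)) < 1"
        using small[OF coset(1)] by simp
      have 2: "nrm ?C < 1" using nonunit coset(1) by (simp add: nrm_mult nrm_divide y_integral)
      have 3: "nrm (?C * f) < 1" using nrm_mult_less_1(2) f 2 by blast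
      have r: "?r g = redm (mat2 ?A 0 0 ?D)"
        using coset by (simp add: direct_sum_chars_def on_cosets_simps red_0)
      have "intertwines ?P (\<rho> g) (mat2 ?A 0 0 ?D)"
        unfolding coset(2) \<rho>_coset[OF coset(1)] intertwines_mat2 integral_mat_mat2
        using int 2 3 by (intro conjI 1) simp_all
      then show ?thesis using r by blast
    qed
  qed (use f in simp_all)
qed

text \<open>If a corner \<open>c\<close> is a unit, \<open>\<rho> h - \<xi> h\<close> sends
  \<open>(x, y)\<close> to \<open>(c y, 0)\<close> modulo \<lambda>. Every nonzero invariant
  subspace then contains the first basis vector, so two of them cannot meet trivially.\<close>

lemma decomposable_WE_imp_small:
  assumes "decomposable_rep k WE \<rho>bar" and h: "h \<in> WE"
  shows "nrm (b / d * (\<xi>' h - \<xi> h)) < 1"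
proof (rule ccontr)
  let ?c = "b / d * (\<xi>' h - \<xi> h)"
  assume "\<not> nrm ?c < 1"
  then have c: "isint ?c" "nrm ?c = 1" using corner_integral[OF h] by auto
  have int: "isint (\<xi> h)" "isint (\<xi>' h)" and mint: "isint (- \<xi> h)" using \<xi> \<xi>' h by simp_all
  have e1: "redv 1 0 \<in> S" if S: "subrep k WE \<rho>bar S" "S \<noteq> {\<zero>\<^bsub>vec2_module k\<^esub>}" for S
  proof -
    obtain x y where xy: "isint x" "isint y" "redv x y \<in> S" "nrm x = 1 \<or> nrm y = 1"
      using subrep_nonzero[OF S] .
    have line: "redv 1 0 \<in> S" if z: "isint z" "nrm z = 1" "redv z 0 \<in> S" for z
    proof -
      have "z \<noteq> 0" "isint (inverse z)" using z by (auto simp: nrm_inverse)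
      then show ?thesis
        using subrep_scale[OF S(1) _ z(1) _ z(3), of "inverse z"] by simp
    qed
    show ?thesis
    proof (cases "nrm y = 1")
      case True
      have "redv (\<xi> h * x + ?c * y) (0 * x + \<xi>' h * y) \<in> S"
        by (rule subrep_act[OF S(1) h]) (use \<rho>_WE[OF h] int c xy in simp_all)
      then have 1: "redv (\<xi> h * x + ?c * y) (\<xi>' h * y) \<in> S" by simp
      have 2: "redv (- \<xi> h * x) (- \<xi> h * y) \<in> S"
        using xy int by (intro subrep_scale[OF S(1)]) simp_all
      have "redv (\<xi> h * x + ?c * y + - \<xi> h * x) (\<xi>' h * y + - \<xi> h * y) \<in> S"
        by (rule subrep_add[OF S(1) isint_add[OF isint_mult[OF int(1) xy(1)] isint_mult[OF c(1) xy(2)]]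
              isint_mult[OF int(2) xy(2)] isint_mult[OF mint xy(1)] isint_mult[OF mint xy(2)] 1 2])
      moreover have "red (\<xi>' h * y + - \<xi> h * y) = red 0"
      proof -
        have "nrm ((\<xi>' h - \<xi> h) * y) < 1"
          using nonunit_trivial_mod h xy nrm_mult_less_1(2) nrm_minus_commute
          unfolding trivial_mod_def by metis
        moreover have "isint (\<xi>' h * y + - \<xi> h * y)"
          by (intro isint_add isint_mult; use xy int in simp)
        ultimately show ?thesis by (subst red_eq_iff) (simp_all add: algebra_simps)
      qed
      ultimately have "redv (?c * y) 0 \<in> S" by simp
      then show ?thesis
        using line[of "?c * y"] isint_mult[OF c(1) xy(2)] c(2) True nrm_mult[of ?c y] by simp
    next
      case False
      then have "red y = red 0" "nrm x = 1" using xy by (simp_all add: red_eq_iff)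
      then show ?thesis using line[of x] xy by simp
    qed
  qed
  obtain S T where "subrep k WE \<rho>bar S" "subrep k WE \<rho>bar T"
    "S \<noteq> {\<zero>\<^bsub>vec2_module k\<^esub>}" "T \<noteq> {\<zero>\<^bsub>vec2_module k\<^esub>}" "S \<inter> T = {\<zero>\<^bsub>vec2_module k\<^esub>}"
    using assms(1) unfolding decomposable_rep_def by blast
  then have "redv 1 0 \<in> {\<zero>\<^bsub>vec2_module k\<^esub>}" using e1 by blast
  then show False using nontrivial_k by (simp add: red_0 red_1)
qed

lemma decomposable_WF_imp_WE: "decomposable_rep k WF \<rho>bar \<Longrightarrow> decomposable_rep k WE \<rho>bar"
proof -
  have "subrep k WE \<rho>bar S" if "subrep k WF \<rho>bar S" for S
    using that WE_WF by (simp add: subrep_def)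
  then show "decomposable_rep k WF \<rho>bar \<Longrightarrow> decomposable_rep k WE \<rho>bar"
    unfolding decomposable_rep_def by (elim exE conjE) (intro exI conjI)
qed

text \<open>Maximality of \<open>i\<close> gives an \<open>h0\<close> at which the difference of the
  characters has norm exactly \<open>nrm \<pi> ^ i\<close>. Thus all corners lie in \<lambda> iff
  \<open>b / d\<close> times \<open>\<pi> ^ i\<close> does, that is, iff the integer valuation of
  \<open>b / d\<close> exceeds \<open>- i\<close>.\<close>

lemma small_iff_norm_val:
  "(\<forall>h\<in>WE. nrm (b / d * (\<xi>' h - \<xi> h)) < 1) \<longleftrightarrow> norm_val nrm K (b / d) \<ge> 1 - ereal (real i)"
proof -
  have bd: "b / d \<in> K" "b / d \<noteq> 0"
    using abd nonunit_nrm(1) by auto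
  obtain n where n: "nrm (b / d) = nrm \<pi> powi n"
    using exists_valuation[OF bd] .
  obtain h0 where h0: "h0 \<in> WE" "nrm \<pi> ^ Suc i < nrm (\<xi> h0 - \<xi>' h0)"
    using i_max by auto
  have "\<xi> h0 - \<xi>' h0 \<noteq> 0" using h0(2) \<pi>(2) zero_less_power[of "nrm \<pi>" "Suc i"] by (auto simp del: zero_less_power)
  then obtain m where m: "nrm (\<xi> h0 - \<xi>' h0) = nrm \<pi> powi m"
    using exists_valuation[of "\<xi> h0 - \<xi>' h0"] \<xi> \<xi>' h0(1) by auto
  have "nrm \<pi> powi int (Suc i) < nrm \<pi> powi m" "\<not> nrm \<pi> powi int i < nrm \<pi> powi m"
    using h0 i_cong[OF h0(1)] m by (simp_all only: power_int_of_nat not_less)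
  then have "m = int i" unfolding powi_less_iff by simp
  then have max: "nrm (\<xi> h0 - \<xi>' h0) = nrm \<pi> ^ i"
    using m by simp
  have prod: "nrm (b / d) * nrm \<pi> ^ i = nrm \<pi> powi (n + int i)"
    using \<pi>(2) by (simp add: n power_int_add)
  have "(\<forall>h\<in>WE. nrm (b / d * (\<xi>' h - \<xi> h)) < 1) \<longleftrightarrow> nrm (b / d) * nrm \<pi> ^ i < 1"
  proof
    assume "\<forall>h\<in>WE. nrm (b / d * (\<xi>' h - \<xi> h)) < 1"
    then have "nrm (b / d * (\<xi>' h0 - \<xi> h0)) < 1" using h0(1) by blast
    then show "nrm (b / d) * nrm \<pi> ^ i < 1"
      using max nrm_minus_commute[of "\<xi> h0"] by (simp add: nrm_mult nrm_divide)
  next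
    assume *: "nrm (b / d) * nrm \<pi> ^ i < 1"
    show "\<forall>h\<in>WE. nrm (b / d * (\<xi>' h - \<xi> h)) < 1"
    proof
      fix h assume "h \<in> WE"
      then have "nrm (b / d * (\<xi>' h - \<xi> h)) \<le> nrm (b / d) * nrm \<pi> ^ i"
        using i_cong nrm_minus_commute by (intro nrm_mult_le order_refl) metis
      with * show "nrm (b / d * (\<xi>' h - \<xi> h)) < 1" by simp
    qed
  qed
  also have "\<dots> \<longleftrightarrow> 0 < n + int i"
    unfolding prod using powi_less_iff[of "n + int i" 0] by simp
  also have "\<dots> \<longleftrightarrow> norm_val nrm K (b / d) \<ge> 1 - ereal (real i)"
  proof -
    have "1 - ereal (real i) = ereal (1 - real i)" by (simp add: one_ereal_def)
    then show ?thesis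
      unfolding norm_val_eq[OF bd(1) n] by simp linarith
  qed
  finally show ?thesis .
qed

text \<open>A circle of implications: small corners split the representation of \<open>WF\<close>,
  this restricts to \<open>WE\<close>, and a splitting on \<open>WE\<close> forces small
  corners.\<close>

lemma nonunit_decomposable_iff:
  "decomposable_rep k WF \<rho>bar \<longleftrightarrow> (\<forall>h\<in>WE. nrm (b / d * (\<xi>' h - \<xi> h)) < 1)"
  "decomposable_rep k WE \<rho>bar \<longleftrightarrow> (\<forall>h\<in>WE. nrm (b / d * (\<xi>' h - \<xi> h)) < 1)"
proof -
  have "decomposable_rep k WF \<rho>bar" if "\<forall>h\<in>WE. nrm (b / d * (\<xi>' h - \<xi> h)) < 1"
  proof (rule cring.decomposable_if_iso_direct_sum[OF cring_k nonunit_iso_direct_sum _ _ nontrivial_k])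
    show "nrm (b / d * (\<xi>' h - \<xi> h)) < 1" if "h \<in> WE" for h
      using that \<open>\<forall>h\<in>WE. _ h\<close> by blast
    fix g assume "g \<in> WF"
    then show "(red \<circ> on_cosets WE \<sigma> \<xi> (\<lambda>h. b / a * \<xi> (\<sigma> \<circ> h \<circ> \<sigma>))) g \<in> carrier k"
      "(red \<circ> on_cosets WE \<sigma> \<xi>' (\<lambda>h. - (b / a) * \<xi> (\<sigma> \<circ> h \<circ> \<sigma>))) g \<in> carrier k"
      by (cases g rule: WF_cases; use \<xi> \<xi>' coset_integral in \<open>simp add: on_cosets_simps\<close>)+
  qed
  then show "decomposable_rep k WF \<rho>bar \<longleftrightarrow> (\<forall>h\<in>WE. nrm (b / d * (\<xi>' h - \<xi> h)) < 1)"
    "decomposable_rep k WE \<rho>bar \<longleftrightarrow> (\<forall>h\<in>WE. nrm (b / d * (\<xi>' h - \<xi> h)) < 1)"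
    using decomposable_WE_imp_small decomposable_WF_imp_WE by blast+
qed

end

section \<open>The irreducibility criterion\<close>

lemma unit_cases: "nrm (d / a) = 1 \<or> nrm (d / a) < 1"
  using quotients_integral(2) by auto

lemma irreducible_if_nontrivial_mod: "\<not> trivial_mod \<Longrightarrow> irreducible_rep k WF \<rho>bar"
  using unit_cases unit_reducible(1) nonunit_trivial_mod by blast

text \<open>For a unit \<open>d / a\<close> the square root supplies the eigenlines of the reduction
  of \<sigma>; otherwise the reduction is triangular anyway.\<close>

lemma reducible_if_trivial_mod:
  assumes "trivial_mod" "nrm (d / a) = 1 \<Longrightarrow> \<exists>s\<in>K. s\<^sup>2 = u"
  shows "\<not> irreducible_rep k WF \<rho>bar"
proof (cases "nrm (d / a) = 1")
  case True
  then obtain s where s: "s \<in> K" "s\<^sup>2 = u" using assms by blast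
  then have "nrm s * nrm s = 1" using u(2) by (metis nrm_mult power2_eq_square)
  then have "nrm s = 1" using nrm_nonneg[of s] by (simp add: square_eq_1_iff)
  show ?thesis
  proof (rule cring.decomposable_imp_not_irreducible[OF cring_k],
      rule cring.decomposable_if_iso_direct_sum[OF cring_k unit_iso_direct_sum[OF True assms(1) s] _ _ nontrivial_k])
    fix g assume "g \<in> WF"
    then show "(red \<circ> on_cosets WE \<sigma> \<xi> (\<lambda>h. s * \<xi> h)) g \<in> carrier k"
      "(red \<circ> on_cosets WE \<sigma> \<xi> (\<lambda>h. - s * \<xi> h)) g \<in> carrier k"
      by (cases g rule: WF_cases; use \<xi> s \<open>nrm s = 1\<close> in \<open>simp add: on_cosets_simps nrm_mult\<close>)+
  qed
next
  case False
  then show ?thesis using unit_cases nonunit_reducible by blast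
qed

lemma reduction:
  "((\<exists>h \<in> WE. red (\<xi> h) \<noteq> red (\<xi>' h)) \<longrightarrow> irreducible_rep k WF \<rho>bar)
   \<and> ((nrm (d / a) = 1 \<longrightarrow> (\<exists>s \<in> K. s\<^sup>2 = u)) \<longrightarrow>
       (irreducible_rep k WF \<rho>bar \<longleftrightarrow> (\<exists>h \<in> WE. red (\<xi> h) \<noteq> red (\<xi>' h))))"
proof -
  have "(\<exists>h \<in> WE. red (\<xi> h) \<noteq> red (\<xi>' h)) \<longleftrightarrow> \<not> trivial_mod"
    unfolding trivial_mod_def using red_\<xi>_eq_iff by blast
  then show ?thesis
    using irreducible_if_nontrivial_mod reducible_if_trivial_mod by blast
qed

end

section \<open>From the Weil group to the dihedral setting\<close>

lemma conj_upper_triangular: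
  fixes a b d :: "'b::field"
  assumes "a \<noteq> 0" "d \<noteq> 0"
  shows "conj_mat2 (field_on UNIV) (mat2 a b 0 d) (mat2 w x y z) =
    mat2 (w + b * y / a) ((a * x + b * z) / d - b * (a * w + b * y) / (a * d)) (d * y / a) (z - b * y / a)"
proof -
  interpret F: field "field_on (UNIV :: 'b set)" by (rule field_field_on_UNIV)
  interpret M: Group.monoid "mat2_monoid (field_on (UNIV :: 'b set))" by (rule F.monoid_mat2)
  have "inv\<^bsub>mat2_monoid (field_on UNIV)\<^esub> mat2 a b 0 d = mat2 (1 / a) (- b / (a * d)) 0 (1 / d)"
    by (rule M.inv_unique'[symmetric]) (use assms in \<open>simp_all add: mat2_monoid_one\<close>)
  then show ?thesis
    using assms by (simp add: conj_mat2_def field_simps)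
qed

locale induced_rep = nonarch_field nrm for nrm :: "'a::field \<Rightarrow> real" +
  fixes F E :: "'a set" and \<sigma> :: "'a \<Rightarrow> 'a" and \<xi> :: "('a \<Rightarrow> 'a) \<Rightarrow> 'b::field"
    and \<rho> :: "('a \<Rightarrow> 'a) \<Rightarrow> 'b mat2" and a b d :: 'b
  assumes subset: "weil_set nrm E \<subseteq> weil_set nrm F"
    and \<sigma>: "\<sigma> \<in> weil_set nrm F" "\<sigma> \<notin> weil_set nrm E"
    and \<rho>_hom: "\<rho> \<in> hom (weil_group nrm F) (GL2 (field_on UNIV))"
    and \<xi>_hom: "\<xi> \<in> hom (weil_group nrm E) (units_of (field_on UNIV))"
    and ad: "a \<noteq> 0" "d \<noteq> 0"
    and \<rho>_eq: "\<And>g. g \<in> weil_set nrm F \<Longrightarrow>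
      \<rho> g = conj_mat2 (field_on UNIV) (mat2 a b 0 d) (Ind (field_on UNIV) (weil_set nrm E) \<sigma> \<xi> g)"
begin

abbreviation "WF \<equiv> weil_set nrm F"
abbreviation "WE \<equiv> weil_set nrm E"
abbreviation "\<xi>' \<equiv> conj_char \<sigma> \<xi>"
abbreviation "\<sigma>i \<equiv> inv_into UNIV \<sigma>"

lemma \<sigma>_inverse: "bij \<sigma>" "\<sigma>i \<circ> \<sigma> = id" "\<sigma> \<circ> \<sigma>i = id" "h \<circ> \<sigma> \<circ> \<sigma>i = h" "h \<circ> \<sigma>i \<circ> \<sigma> = h"
proof -
  show bij: "bij \<sigma>" using galois_setE(1)[OF weil_set_galois[OF \<sigma>(1)]] .
  then show *: "\<sigma>i \<circ> \<sigma> = id" "\<sigma> \<circ> \<sigma>i = id"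
    by (simp_all add: bij_def surj_iff)
  show "h \<circ> \<sigma> \<circ> \<sigma>i = h" "h \<circ> \<sigma>i \<circ> \<sigma> = h"
    by (simp_all add: comp_assoc *)
qed

lemma \<rho>_mult: "g \<in> WF \<Longrightarrow> h \<in> WF \<Longrightarrow> \<rho> (g \<circ> h) = \<rho> g \<otimes>\<^bsub>mat2_monoid (field_on UNIV)\<^esub> \<rho> h"
  using hom_mult[OF \<rho>_hom, of g h] by (simp add: weil_group_def GL2_def units_of_def)

lemma \<xi>_mult: "g \<in> WE \<Longrightarrow> h \<in> WE \<Longrightarrow> \<xi> (g \<circ> h) = \<xi> g * \<xi> h"
  using hom_mult[OF \<xi>_hom, of g h] by (simp add: weil_group_def units_of_def)

lemma \<xi>_nonzero: "g \<in> WE \<Longrightarrow> \<xi> g \<noteq> 0"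
  using hom_in_carrier[OF \<xi>_hom, of g] by (auto simp: weil_group_def units_of_def Units_def)

lemma \<xi>_id: "\<xi> id = 1"
  using \<xi>_mult[OF weil_set_id weil_set_id] \<xi>_nonzero[OF weil_set_id] by simp

lemma Ind_WE: "h \<in> WE \<Longrightarrow> Ind (field_on UNIV) WE \<sigma> \<xi> h = mat2 (\<xi> h) 0 0 (\<xi>' h)"
  and Ind_coset: "g \<notin> WE \<Longrightarrow>
    Ind (field_on UNIV) WE \<sigma> \<xi> g = mat2 0 (\<xi> (g \<circ> \<sigma>i)) (\<xi> (\<sigma> \<circ> (g \<circ> \<sigma>i) \<circ> \<sigma>)) 0"
  by (simp_all add: Ind_def on_cosets_def)

lemma \<rho>_WE: "h \<in> WE \<Longrightarrow> \<rho> h = mat2 (\<xi> h) (b / d * (\<xi>' h - \<xi> h)) 0 (\<xi>' h)"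
  using ad subset by (auto simp: \<rho>_eq Ind_WE conj_upper_triangular field_simps)

lemma \<rho>_coset:
  assumes h: "h \<in> WE" "h \<circ> \<sigma> \<in> WF" "h \<circ> \<sigma> \<notin> WE"
  shows "\<rho> (h \<circ> \<sigma>) = mat2 (b / a * \<xi> (\<sigma> \<circ> h \<circ> \<sigma>)) (a / d * \<xi> h - b * b / (a * d) * \<xi> (\<sigma> \<circ> h \<circ> \<sigma>))
    (d / a * \<xi> (\<sigma> \<circ> h \<circ> \<sigma>)) (- (b / a) * \<xi> (\<sigma> \<circ> h \<circ> \<sigma>))"
  unfolding \<rho>_eq[OF h(2)] Ind_coset[OF h(3)] conj_upper_triangular[OF ad] \<sigma>_inverse(4)
  using ad by (simp add: field_simps)

text \<open>Multiplicativity is inherited from \<rho> by conjugating back with \<open>U\<close>. The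
  matrix formula alone does not give it at this point, where
  \<open>\<sigma> \<circ> \<sigma>\<close> is not yet known to lie in \<open>WE\<close>.\<close>

lemma Ind_mult:
  assumes g: "g \<in> WF" and h: "h \<in> WF"
  shows "Ind (field_on UNIV) WE \<sigma> \<xi> (g \<circ> h) =
    Ind (field_on UNIV) WE \<sigma> \<xi> g \<otimes>\<^bsub>mat2_monoid (field_on UNIV)\<^esub> Ind (field_on UNIV) WE \<sigma> \<xi> h"
proof -
  interpret F: field "field_on (UNIV :: 'b set)" by (rule field_field_on_UNIV)
  interpret M: Group.monoid "mat2_monoid (field_on (UNIV :: 'b set))" by (rule F.monoid_mat2)
  let ?M = "mat2_monoid (field_on (UNIV :: 'b set))"
  let ?U = "mat2 a b 0 d" and ?V = "mat2 (1 / a) (- b / (a * d)) 0 (1 / d)"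
  let ?I = "Ind (field_on UNIV) WE \<sigma> \<xi>"
  have c: "A \<in> carrier ?M" for A by (cases A rule: mat2_cases) simp
  have UV: "?U \<otimes>\<^bsub>?M\<^esub> ?V = \<one>\<^bsub>?M\<^esub>" "?V \<otimes>\<^bsub>?M\<^esub> ?U = \<one>\<^bsub>?M\<^esub>"
    using ad by (simp_all add: mat2_monoid_one)
  have inv: "inv\<^bsub>?M\<^esub> ?U = ?V"
    by (rule M.inv_unique'[symmetric, OF c c UV])
  have \<rho>: "\<rho> g = ?U \<otimes>\<^bsub>?M\<^esub> ?I g \<otimes>\<^bsub>?M\<^esub> ?V" if "g \<in> WF" for g
    unfolding \<rho>_eq[OF that] conj_mat2_def inv ..
  have I: "?I g = ?V \<otimes>\<^bsub>?M\<^esub> \<rho> g \<otimes>\<^bsub>?M\<^esub> ?U" if "g \<in> WF" for g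
    unfolding \<rho>[OF that] using c UV M.m_assoc M.l_one M.r_one by metis
  have "?I (g \<circ> h) = ?V \<otimes>\<^bsub>?M\<^esub> (\<rho> g \<otimes>\<^bsub>?M\<^esub> \<rho> h) \<otimes>\<^bsub>?M\<^esub> ?U"
    using I[OF weil_set_comp[OF g h]] \<rho>_mult[OF g h] by simp
  also have "\<dots> = (?V \<otimes>\<^bsub>?M\<^esub> \<rho> g \<otimes>\<^bsub>?M\<^esub> ?U) \<otimes>\<^bsub>?M\<^esub> (?V \<otimes>\<^bsub>?M\<^esub> \<rho> h \<otimes>\<^bsub>?M\<^esub> ?U)"
    using c UV M.m_assoc M.l_one M.r_one by metis
  finally show ?thesis
    using I[OF g] I[OF h] by simp
qed

text \<open>The matrix of the induced representation is diagonal on \<open>W\<^sub>E\<close> and antidiagonal off \<open>W\<^sub>E\<close>, so its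
  multiplicativity already forces \<open>W\<^sub>E\<close> to have index two.\<close>

lemma parity:
  assumes g: "g \<in> WF" and h: "h \<in> WF"
  shows "g \<circ> h \<in> WE \<longleftrightarrow> (g \<in> WE \<longleftrightarrow> h \<in> WE)"
proof -
  let ?I = "Ind (field_on UNIV) WE \<sigma> \<xi>"
  have shape: "(\<exists>x y. ?I f = mat2 x 0 0 y)" if "f \<in> WE" for f
    using Ind_WE[OF that] by blast
  have coshape: "(\<exists>x y. ?I f = mat2 0 x y 0)" if "f \<notin> WE" for f
    using Ind_coset[OF that] by blast
  have nonzero: "?I f \<noteq> mat2 0 0 0 0" if f: "f \<in> WF" for f
  proof
    assume zero: "?I f = mat2 0 0 0 0"
    have "bij f" using galois_setE(1)[OF weil_set_galois[OF f]] .
    then have "f \<circ> inv_into UNIV f = id" by (simp add: bij_def surj_iff)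
    then have *: "?I id = mat2 0 0 0 0 \<otimes>\<^bsub>mat2_monoid (field_on UNIV)\<^esub> ?I (inv_into UNIV f)"
      using Ind_mult[OF f weil_set_inv[OF f]] zero by simp
    obtain w x y z where "?I (inv_into UNIV f) = mat2 w x y z" by (rule mat2_cases)
    then have "mat2 1 0 0 (\<xi>' id) = mat2 0 0 0 0"
      using * Ind_WE[OF weil_set_id] \<xi>_id by simp
    then show False by simp
  qed
  note mult = Ind_mult[OF g h] and nz = nonzero[OF weil_set_comp[OF g h]]
  show ?thesis
  \<comment> \<open>In each nontrivial case the product would be both diagonal and antidiagonal,
    hence zero, although its argument is invertible.\<close>
  proof (cases "g \<in> WE"; cases "h \<in> WE"; cases "g \<circ> h \<in> WE")
    assume *: "g \<in> WE" "h \<in> WE" "g \<circ> h \<notin> WE"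
    then show ?thesis using mult nz shape[OF *(1)] shape[OF *(2)] coshape[OF *(3)] by auto
  next
    assume *: "g \<in> WE" "h \<notin> WE" "g \<circ> h \<in> WE"
    then show ?thesis using mult nz shape[OF *(1)] coshape[OF *(2)] shape[OF *(3)] by auto
  next
    assume *: "g \<notin> WE" "h \<in> WE" "g \<circ> h \<in> WE"
    then show ?thesis using mult nz coshape[OF *(1)] shape[OF *(2)] shape[OF *(3)] by auto
  next
    assume *: "g \<notin> WE" "h \<notin> WE" "g \<circ> h \<notin> WE"
    then show ?thesis using mult nz coshape[OF *(1)] coshape[OF *(2)] coshape[OF *(3)] by auto
  qed simp_all
qed

lemma coset_not_WE: "h \<in> WE \<Longrightarrow> h \<circ> \<sigma> \<notin> WE"
  using parity[of h \<sigma>] subset \<sigma> by blast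

lemma WF_eq: "WF = WE \<union> (\<lambda>h. h \<circ> \<sigma>) ` WE"
proof (rule Set.equalityI; rule subsetI)
  fix g assume g: "g \<in> WF"
  show "g \<in> WE \<union> (\<lambda>h. h \<circ> \<sigma>) ` WE"
  proof (cases "g \<in> WE")
    case False
    have "g \<circ> \<sigma>i \<in> WF" by (intro weil_set_comp weil_set_inv g \<sigma>(1))
    then have "g \<circ> \<sigma>i \<in> WE"
      using parity[of "g \<circ> \<sigma>i" \<sigma>] \<sigma> False by (simp add: \<sigma>_inverse)
    then show ?thesis
      using \<sigma>_inverse(5)[of g] by (intro UnI2 image_eqI[of _ _ "g \<circ> \<sigma>i"]) simp_all
  qed simp
next
  fix g assume "g \<in> WE \<union> (\<lambda>h. h \<circ> \<sigma>) ` WE"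
  then show "g \<in> WF" using subset weil_set_comp[OF _ \<sigma>(1)] by blast
qed

lemma conj_WE: "h \<in> WE \<Longrightarrow> \<sigma> \<circ> h \<circ> \<sigma>i \<in> WE" and \<sigma>\<sigma>_WE: "\<sigma> \<circ> \<sigma> \<in> WE"
proof -
  show "\<sigma> \<circ> \<sigma> \<in> WE" using parity[OF \<sigma>(1) \<sigma>(1)] by simp
  have i: "\<sigma>i \<in> WF" by (rule weil_set_inv[OF \<sigma>(1)])
  have "\<sigma>i \<notin> WE" using parity[OF i \<sigma>(1)] \<sigma>(2) weil_set_id by (simp add: \<sigma>_inverse)
  moreover assume h: "h \<in> WE"
  moreover from h have "h \<in> WF" using subset by blast
  ultimately show "\<sigma> \<circ> h \<circ> \<sigma>i \<in> WE"
    using parity[OF weil_set_comp[OF \<sigma>(1)] i, of h] parity[OF \<sigma>(1), of h] \<sigma>(2) by blast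
qed

text \<open>Insert the inverse of \<sigma>: the argument is the conjugate of \<open>h\<close>
  followed on the right by the square of \<sigma>, and both factors lie in
  \<open>WE\<close>.\<close>

lemma \<xi>_twist: "h \<in> WE \<Longrightarrow> \<xi> (\<sigma> \<circ> h \<circ> \<sigma>) = \<xi>' h * \<xi> (\<sigma> \<circ> \<sigma>)"
proof -
  assume h: "h \<in> WE"
  have "(\<sigma> \<circ> h \<circ> \<sigma>i) \<circ> (\<sigma> \<circ> \<sigma>) = \<sigma> \<circ> h \<circ> (\<sigma>i \<circ> \<sigma>) \<circ> \<sigma>"
    by (simp only: comp_assoc)
  then have "(\<sigma> \<circ> h \<circ> \<sigma>i) \<circ> (\<sigma> \<circ> \<sigma>) = \<sigma> \<circ> h \<circ> \<sigma>"
    by (simp add: \<sigma>_inverse(2))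
  then show ?thesis
    using \<xi>_mult[OF conj_WE[OF h] \<sigma>\<sigma>_WE] by (simp add: conj_char_def)
qed

end

theorem theorem2p10:
  fixes p l :: nat
    and nrm :: "'a::{field_char_0, alg_closed_field} \<Rightarrow> real"
    and nrm' :: "'b::{field_char_0, alg_closed_field} \<Rightarrow> real"
    and F E :: "'a set" and K :: "'b set"
    and \<sigma> :: "'a \<Rightarrow> 'a"
    and \<rho> :: "('a \<Rightarrow> 'a) \<Rightarrow> 'b^2^2"
    and \<xi> :: "('a \<Rightarrow> 'a) \<Rightarrow> 'b"
    and a b d :: 'b and i :: nat
  defines "WF \<equiv> weil_set nrm F" and "WE \<equiv> weil_set nrm E"
    and "\<O> \<equiv> integers nrm' K" and "\<ll> \<equiv> max_ideal nrm' K"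
    and "k \<equiv> residue_field nrm' K" and "red \<equiv> residue nrm' K"
    and "\<rho>bar \<equiv> (\<lambda>g. map_mat2 (residue nrm' K) (\<rho> g))"
  assumes "Factorial_Ring.prime p" "odd p" "Factorial_Ring.prime l" "odd l" "p \<noteq> l"
    and "padic_alg_closure p nrm" and "padic_alg_closure l nrm'"
    and "finite_ext (rat_closure nrm) F" and "quadratic_ext F E"
    and "finite_ext (rat_closure nrm') K"
    and "\<sigma> \<in> WF - WE"
    and "nonexceptional_supercuspidal nrm nrm' F \<rho>"
    and "\<rho> ` WF \<subseteq> carrier (GL2 \<O>)"
    and "weil_character nrm nrm' E \<xi>"
    and "\<exists>h \<in> WE. \<xi> h \<noteq> conj_char \<sigma> \<xi> h"
    and "mat2 a b 0 d \<in> carrier (GL2 (field_on K))"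
    and "\<forall>g \<in> WF. \<rho> g = conj_mat2 (field_on UNIV) (mat2 a b 0 d) (Ind (field_on UNIV) WE \<sigma> \<xi> g)"
    and "\<forall>h \<in> WE. cong_max_ideal_power nrm' K i (\<xi> h) (conj_char \<sigma> \<xi> h)"
    and "\<forall>j. (\<forall>h \<in> WE. cong_max_ideal_power nrm' K j (\<xi> h) (conj_char \<sigma> \<xi> h)) \<longrightarrow> j \<le> i"
  shows
    "((\<exists>h \<in> WE. red (\<xi> h) \<noteq> red (conj_char \<sigma> \<xi> h)) \<longrightarrow> irreducible_rep k WF \<rho>bar)
     \<and> ((d / a \<in> Units \<O> \<longrightarrow> (\<exists>s \<in> K. s\<^sup>2 = \<xi> (\<sigma> \<circ> \<sigma>))) \<longrightarrow>
         (irreducible_rep k WF \<rho>bar \<longleftrightarrow> (\<exists>h \<in> WE. red (\<xi> h) \<noteq> red (conj_char \<sigma> \<xi> h))))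
     \<and> (\<not> irreducible_rep k WF \<rho>bar \<longrightarrow>
         (d / a \<in> Units \<O> \<longrightarrow>
            isomorphic_reps k WF \<rho>bar (Ind k WE \<sigma> (red \<circ> \<xi>))
            \<and> (\<exists>s \<in> carrier \<O>. s\<^sup>2 = \<xi> (\<sigma> \<circ> \<sigma>))
            \<and> (\<forall>s \<in> carrier \<O>. s\<^sup>2 = \<xi> (\<sigma> \<circ> \<sigma>) \<longrightarrow>
                 isomorphic_reps k WF \<rho>bar (direct_sum_chars k
                   (red \<circ> on_cosets WE \<sigma> \<xi> (\<lambda>h. s * \<xi> h))
                   (red \<circ> on_cosets WE \<sigma> \<xi> (\<lambda>h. - s * \<xi> h)))))
         \<and> (d / a \<in> \<ll> \<longrightarrow>
            (decomposable_rep k WF \<rho>bar \<longleftrightarrow> norm_val nrm' K (b / d) \<ge> 1 - ereal (real i))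
            \<and> (decomposable_rep k WF \<rho>bar \<longleftrightarrow> decomposable_rep k WE \<rho>bar)
            \<and> (decomposable_rep k WF \<rho>bar \<longrightarrow>
                 isomorphic_reps k WF \<rho>bar (direct_sum_chars k
                   (red \<circ> on_cosets WE \<sigma> \<xi> (\<lambda>h. b / a * \<xi> (\<sigma> \<circ> h \<circ> \<sigma>)))
                   (red \<circ> on_cosets WE \<sigma> (conj_char \<sigma> \<xi>) (\<lambda>h. - (b / a) * \<xi> (\<sigma> \<circ> h \<circ> \<sigma>)))))))"
proof -
  interpret A: padic p nrm by (rule padic.intro[OF assms(8,13)])
  interpret B: padic l nrm' by (rule padic.intro[OF assms(10,14)])
  have sub: "subfield F (field_on UNIV)" "subfield E (field_on UNIV)" "F \<subseteq> E"
    using assms(15,16) unfolding finite_ext_def quadratic_ext_def by simp_all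
  obtain \<pi> where "discretely_valued nrm' K \<pi>"
    using B.finite_ext_uniformizer[OF assms(17)] by blast
  then interpret D: discretely_valued nrm' K \<pi> .
  have abd: "a \<in> K" "b \<in> K" "d \<in> K" "a \<noteq> 0" "d \<noteq> 0"
  proof -
    obtain V where V: "mat2 a b 0 d \<in> carrier (mat2_monoid (field_on K))"
      "V \<otimes>\<^bsub>mat2_monoid (field_on K)\<^esub> mat2 a b 0 d = \<one>\<^bsub>mat2_monoid (field_on K)\<^esub>"
      "mat2 a b 0 d \<otimes>\<^bsub>mat2_monoid (field_on K)\<^esub> V = \<one>\<^bsub>mat2_monoid (field_on K)\<^esub>"
      using assms(23) unfolding carrier_GL2 Units_def by blast
    obtain w x y z where "V = mat2 w x y z" by (rule mat2_cases)
    then show "a \<in> K" "b \<in> K" "d \<in> K" "a \<noteq> 0" "d \<noteq> 0"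
      using V by (auto simp: mat2_monoid_one)
  qed
  have \<sigma>: "\<sigma> \<in> weil_set nrm F" "\<sigma> \<notin> weil_set nrm E"
    using assms(18) unfolding WF_def WE_def by simp_all
  interpret I: induced_rep nrm F E \<sigma> \<xi> \<rho> a b d
  proof
    show "weil_set nrm E \<subseteq> weil_set nrm F" by (rule A.weil_set_mono[OF sub])
    show "\<rho> \<in> hom (weil_group nrm F) (GL2 (field_on UNIV))"
      using assms(19) unfolding nonexceptional_supercuspidal_def weil_rep2_def by simp
    show "\<xi> \<in> hom (weil_group nrm E) (units_of (field_on UNIV))"
      using assms(21) unfolding weil_character_def by simp
  qed (use assms(24) abd \<sigma> in \<open>simp_all add: WF_def WE_def\<close>)
  have int: "D.integral_mat (\<rho> g)" if "g \<in> I.WF" for g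
  proof -
    have "\<rho> g \<in> carrier (mat2_monoid \<O>)"
      using assms(20) that unfolding WF_def carrier_GL2 Units_def by blast
    then show ?thesis
      unfolding \<O>_def by (cases "\<rho> g" rule: mat2_cases) simp
  qed
  have \<xi>i: "\<xi> h \<in> K" "nrm' (\<xi> h) \<le> 1" if "h \<in> I.WE" for h
    using int[of h] I.subset I.\<rho>_WE[OF that] that by auto
  \<comment> \<open>The values at \<open>h\<close> and at its inverse are diagonal entries of
    integral matrices and multiply to 1, so both are units.\<close>
  have \<xi>n: "nrm' (\<xi> h) = 1" if h: "h \<in> I.WE" for h
  proof -
    let ?i = "inv_into UNIV h"
    have i: "?i \<in> I.WE" by (rule A.weil_set_inv[OF h])
    have "h \<circ> ?i = id"
      using galois_setE(1)[OF A.weil_set_galois[OF h]] by (simp add: bij_def surj_iff)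
    then have "\<xi> h * \<xi> ?i = 1" using I.\<xi>_mult[OF h i] I.\<xi>_id by simp
    then have "nrm' (\<xi> h) * nrm' (\<xi> ?i) = 1" by (metis B.nrm_1 B.nrm_mult)
    moreover have "nrm' (\<xi> h) * nrm' (\<xi> ?i) \<le> nrm' (\<xi> h)"
      using \<xi>i(2)[OF i] by (intro mult_right_le_one_le) simp_all
    ultimately show ?thesis using \<xi>i(2)[OF h] by simp
  qed
  have \<xi>': "conj_char \<sigma> \<xi> h \<in> K" "nrm' (conj_char \<sigma> \<xi> h) = 1" if "h \<in> I.WE" for h
    using \<xi>i(1)[OF I.conj_WE[OF that]] \<xi>n[OF I.conj_WE[OF that]] by (simp_all add: conj_char_def)
  interpret R: dihedral_reduction nrm' K \<pi> I.WF I.WE \<sigma> \<rho> \<xi> a b d i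
  proof
    show "B.nrm_complete K" by (rule B.finite_ext_complete[OF assms(17)])
    show "nrm' 2 = 1" by (rule B.nrm_2[OF assms(11)])
    show "bij \<sigma>" by (rule I.\<sigma>_inverse)
    show "id \<in> I.WE" by (rule A.weil_set_id)
    fix h assume h: "h \<in> I.WE"
    show "\<rho> (h \<circ> \<sigma>) = mat2 (b / a * \<xi> (\<sigma> \<circ> h \<circ> \<sigma>)) (a / d * \<xi> h - b * b / (a * d) * \<xi> (\<sigma> \<circ> h \<circ> \<sigma>))
        (d / a * \<xi> (\<sigma> \<circ> h \<circ> \<sigma>)) (- (b / a) * \<xi> (\<sigma> \<circ> h \<circ> \<sigma>))"
      using I.\<rho>_coset[OF h _ I.coset_not_WE[OF h]] h I.WF_eq by blast
    show "nrm' (\<xi> h - conj_char \<sigma> \<xi> h) \<le> nrm' \<pi> ^ i"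
      using assms(25) h \<xi>i \<xi>' D.cong_max_ideal_power_iff unfolding WE_def by blast
  next
    \<comment> \<open>Maximality of \<open>i\<close> enters only through the failure of the
      congruence at the next exponent.\<close>
    have "\<not> (\<forall>h\<in>I.WE. cong_max_ideal_power nrm' K (Suc i) (\<xi> h) (conj_char \<sigma> \<xi> h))"
      using assms(26) unfolding WE_def by (metis Suc_n_not_le_n)
    then show "\<exists>h\<in>I.WE. \<not> nrm' (\<xi> h - conj_char \<sigma> \<xi> h) \<le> nrm' \<pi> ^ Suc i"
      using \<xi>i \<xi>' D.cong_max_ideal_power_iff by blast
  qed (fact abd \<xi>i(1) \<xi>n \<xi>' int I.coset_not_WE I.WF_eq I.\<xi>_id I.\<xi>_twist I.\<rho>_WE
      \<xi>i(1)[OF I.\<sigma>\<sigma>_WE] \<xi>n[OF I.\<sigma>\<sigma>_WE])+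
  have unit_iff: "d / a \<in> Units \<O> \<longleftrightarrow> nrm' (d / a) = 1"
    using abd by (simp add: \<O>_def D.Units_integers)
  have max_iff: "d / a \<in> \<ll> \<longleftrightarrow> nrm' (d / a) < 1"
    using abd by (simp add: \<ll>_def max_ideal_def)
  have sqrt: "\<exists>s \<in> carrier \<O>. s\<^sup>2 = \<xi> (\<sigma> \<circ> \<sigma>)"
    if unit: "nrm' (d / a) = 1" and red: "\<not> irreducible_rep D.k I.WF R.\<rho>bar"
  proof -
    obtain t where t: "t \<in> K" "nrm' (t\<^sup>2 - \<xi> (\<sigma> \<circ> \<sigma>)) < 1"
      using R.unit_reducible(2)[OF unit red] by blast
    \<comment> \<open>The root is taken in the algebraic closure; the approximate root
      \<open>t\<close> in \<open>K\<close> and completeness then place it in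
      \<open>K\<close>.\<close>
    obtain s where s: "s\<^sup>2 = \<xi> (\<sigma> \<circ> \<sigma>)"
      using nth_root_exists[of 2 "\<xi> (\<sigma> \<circ> \<sigma>)"] by auto
    then have "(nrm' s)\<^sup>2 = 1\<^sup>2"
      using R.u(2) by (simp flip: B.nrm_power)
    then have ns: "nrm' s = 1"
      by (rule power2_eq_imp_eq) simp_all
    then have "s \<in> K"
      by (rule D.hensel_sqrt[OF R.complete R.nrm_2 t(1), of s, unfolded s, OF R.u(1) _ t(2)])
    then show ?thesis using s ns by (intro bexI[of _ s]) (simp_all add: \<O>_def)
  qed
  show ?thesis
    unfolding WF_def WE_def k_def red_def \<rho>bar_def unit_iff max_iff
  proof (intro conjI)
    show "(\<exists>h\<in>I.WE. D.red (\<xi> h) \<noteq> D.red (conj_char \<sigma> \<xi> h)) \<longrightarrow> irreducible_rep D.k I.WF R.\<rho>bar"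
      by (rule conjunct1[OF R.reduction])
  next
    show "(nrm' (d / a) = 1 \<longrightarrow> (\<exists>s\<in>K. s\<^sup>2 = \<xi> (\<sigma> \<circ> \<sigma>))) \<longrightarrow>
        (irreducible_rep D.k I.WF R.\<rho>bar \<longleftrightarrow> (\<exists>h\<in>I.WE. D.red (\<xi> h) \<noteq> D.red (conj_char \<sigma> \<xi> h)))"
      by (rule conjunct2[OF R.reduction])
  next
    let ?\<theta>1 = "D.red \<circ> on_cosets I.WE \<sigma> \<xi> (\<lambda>h. b / a * \<xi> (\<sigma> \<circ> h \<circ> \<sigma>))"
    let ?\<theta>2 = "D.red \<circ> on_cosets I.WE \<sigma> (conj_char \<sigma> \<xi>) (\<lambda>h. - (b / a) * \<xi> (\<sigma> \<circ> h \<circ> \<sigma>))"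
    have unit: "isomorphic_reps D.k I.WF R.\<rho>bar (Ind D.k I.WE \<sigma> (D.red \<circ> \<xi>))
        \<and> (\<exists>s \<in> carrier \<O>. s\<^sup>2 = \<xi> (\<sigma> \<circ> \<sigma>))
        \<and> (\<forall>s \<in> carrier \<O>. s\<^sup>2 = \<xi> (\<sigma> \<circ> \<sigma>) \<longrightarrow>
             isomorphic_reps D.k I.WF R.\<rho>bar (direct_sum_chars D.k
               (D.red \<circ> on_cosets I.WE \<sigma> \<xi> (\<lambda>h. s * \<xi> h))
               (D.red \<circ> on_cosets I.WE \<sigma> \<xi> (\<lambda>h. - s * \<xi> h))))"
      if red: "\<not> irreducible_rep D.k I.WF R.\<rho>bar" and u: "nrm' (d / a) = 1"
      using R.unit_iso_Ind[OF u] sqrt[OF u red]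
        R.unit_iso_direct_sum[OF u R.unit_reducible(1)[OF u red]]
      unfolding \<O>_def by simp
    have nonunit: "(decomposable_rep D.k I.WF R.\<rho>bar \<longleftrightarrow> norm_val nrm' K (b / d) \<ge> 1 - ereal (real i))
        \<and> (decomposable_rep D.k I.WF R.\<rho>bar \<longleftrightarrow> decomposable_rep D.k I.WE R.\<rho>bar)
        \<and> (decomposable_rep D.k I.WF R.\<rho>bar \<longrightarrow>
             isomorphic_reps D.k I.WF R.\<rho>bar (direct_sum_chars D.k ?\<theta>1 ?\<theta>2))"
      if u: "nrm' (d / a) < 1"
      unfolding R.nonunit_decomposable_iff[OF u] R.small_iff_norm_val[OF u, symmetric]
      using R.nonunit_iso_direct_sum[OF u] by simp
    show "\<not> irreducible_rep D.k I.WF R.\<rho>bar \<longrightarrow>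
       (nrm' (d / a) = 1 \<longrightarrow>
          isomorphic_reps D.k I.WF R.\<rho>bar (Ind D.k I.WE \<sigma> (D.red \<circ> \<xi>))
          \<and> (\<exists>s \<in> carrier \<O>. s\<^sup>2 = \<xi> (\<sigma> \<circ> \<sigma>))
          \<and> (\<forall>s \<in> carrier \<O>. s\<^sup>2 = \<xi> (\<sigma> \<circ> \<sigma>) \<longrightarrow>
               isomorphic_reps D.k I.WF R.\<rho>bar (direct_sum_chars D.k
                 (D.red \<circ> on_cosets I.WE \<sigma> \<xi> (\<lambda>h. s * \<xi> h))
                 (D.red \<circ> on_cosets I.WE \<sigma> \<xi> (\<lambda>h. - s * \<xi> h)))))
       \<and> (nrm' (d / a) < 1 \<longrightarrow>
          (decomposable_rep D.k I.WF R.\<rho>bar \<longleftrightarrow> norm_val nrm' K (b / d) \<ge> 1 - ereal (real i))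
          \<and> (decomposable_rep D.k I.WF R.\<rho>bar \<longleftrightarrow> decomposable_rep D.k I.WE R.\<rho>bar)
          \<and> (decomposable_rep D.k I.WF R.\<rho>bar \<longrightarrow>
               isomorphic_reps D.k I.WF R.\<rho>bar (direct_sum_chars D.k ?\<theta>1 ?\<theta>2)))"
      by (intro impI conjI[OF impI impI] unit nonunit)
  qed
qed

end
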